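(* Let $\mathfrak g$ be a finite-dimensional $\mathbb Z_2$-graded vector space, let $\hat Q=\frac12\xi^j\xi^iQ_{ij}^k\,\partial/\partial\xi^k$ be a quadratic homological vector field on $\Pi\mathfrak g$, and let $S=\frac12\xi^lS_l^{nm}\xi_m\xi_n\in C^\infty(T^*\Pi\mathfrak g)$ be the odd Hamiltonian (Schouten tensor) of a linear Schouten bracket on $\Pi\mathfrak g$, where $\xi^i$ are linear coordinates on $\Pi\mathfrak g$ and $\xi_i$ the conjugate momenta. Let $Q=\frac12\xi^j\xi^iQ_{ij}^k\xi_k\in C^\infty(T^*\Pi\mathfrak g)$ be the Hamiltonian of $\hat Q$. The following hold for $T^*\Pi\mathfrak g\cong\Pi(\mathfrak g\oplus\mathfrak g^* )$. 1. The $QS$-condition for $\Pi\mathfrak g$ with the field $\hat Q$ and the Schouten tensor $S$ (i.e. that $\hat Q$ is a derivation of the Schouten bracket) is equivalent to the vanishing of the canonical Poisson bracket $$\{Q,S\}=\frac14\{\xi^j\xi^iQ_{ij}^k\xi_k,\ \xi^lS_l^{nm}\xi_m\xi_n\}=0 .$$ 2. If the $QS$-condition holds, then the function $Q+S$ on $T^*\Pi\mathfrak g$ satisfies $\{Q+S,Q+S\}=0$, so the Hamiltonian vector field $\hat Q_D:=X_{Q+S}=\{Q+S,\ \}$ on $T^*\Pi\mathfrak g$ is homological. It corresponds to the Lie algebra structure in Drinfeld's double $\mathfrak d=\mathfrak g\oplus\mathfrak g^*$ of the Lie bialgebra $\mathfrak g$ defined by $\hat Q$ and $S$.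
   Context: Everything is $\mathbb Z_2$-graded; ``Lie algebra'' means Lie superalgebra; tilde denotes parity; $\Pi$ is parity reversion. For a basis $e_i$ of $\mathfrak g$ with $\tilde e_i=\tilde\imath$, the supermanifold $\Pi\mathfrak g$ has linear coordinates $\xi^i$ of parity $\tilde\imath+1$. On $T^*M$ with coordinates $x^a$ (parity $\tilde a$) and momenta $p_a$, the canonical Poisson bracket is $\{f,g\}=(-1)^{\tilde a(\tilde f+1)}\frac{\partial f}{\partial p_a}\frac{\partial g}{\partial x^a}-(-1)^{\tilde a\tilde f}\frac{\partial f}{\partial x^a}\frac{\partial g}{\partial p_a}$; here $M=\Pi\mathfrak g$, $x^a=\xi^i$, $p_a=\xi_i$. A homological vector field is an odd vector field of square zero. A Schouten bracket on $M$ (odd Poisson bracket) is given by an odd fiberwise quadratic $S\in C^\infty(T^*M)$ with $\{S,S\}=0$ via $\{f,g\}_S=\{f,\{S,g\}\}$. Correspondences: a quadratic homological field $\hat Q$ on $\Pi\mathfrak g$ corresponds to the Lie bracket on $\mathfrak g$ determined by $i_{[X,Y]}=[i_X,[\hat Q,i_Y]]$, where for $X=X^ie_i$ one puts $i_X=(-1)^{\tilde X}X^i\partial/\partial\xi^i$; thus $[e_i,e_j]=(-1)^{\tilde\jmath}Q_{ij}^ke_k$. The same correspondence is used on $\Pi(\mathfrak g\oplus\mathfrak g^* )$. A linear Schouten bracket on $\Pi\mathfrak g$ corresponds to a Lie bracket on $\mathfrak g^*$, of which it is the Lie–Schouten bracket: it extends (as a biderivation) the Lie bracket of elements of $\mathfrak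 g^*$ viewed, after parity shift, as linear functions on $\Pi\mathfrak g$. A Lie bialgebra is a Lie algebra $\mathfrak g$ with a Lie algebra structure on $\mathfrak g^*$ such that the dual map $\delta:\mathfrak g\to\wedge^2\mathfrak g$ of the bracket of $\mathfrak g^*$ is a $1$-cocycle of $\mathfrak g$ with respect to $\wedge^2\mathrm{ad}$; a $QS$-structure on $\Pi\mathfrak g$ with quadratic $\hat Q$ and linear Schouten bracket is the same as a Lie bialgebra structure on $\mathfrak g$. The Lie algebra structure of Drinfeld's double $\mathfrak d=\mathfrak g\oplus\mathfrak g^*$ is the unique one for which $\mathfrak g$ and $\mathfrak g^*$ (with the given brackets) are Lie subalgebras and the natural inner product on $\mathfrak g\oplus\mathfrak g^*$ is $\mathrm{ad}$-invariant. For purely even $\mathfrak g$ it is $[e_i,e_j]=c_{ij}^ke_k$, $[e^i,e^j]=b^{ij}_ke^k$, $[e_i,e^j]=b^{jk}_ie_k-c^j_{ik}e^k$, with $c_{ij}^k$, $b^{ij}_k$ the structure constants of $\mathfrak g$, $\mathfrak g^*$ and $e^i$ the dual basis. *)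

theory Defs
  imports "HOL-Analysis.Analysis" "HOL-Library.Z2" "HOL-Library.Function_Algebras"
begin

section \<open>Parities and smooth functions on a superdomain\<close>

definition ksgn :: "bit \<Rightarrow> real" where
  "ksgn a = (if a = 0 then 1 else - 1)"

text \<open>
  A superdomain is given by a number \<open>N\<close> of coordinates, numbered \<open>0, \<dots>, N - 1\<close>, and their parities
  \<open>q\<close>. A function on it is written as the sum over \<open>A\<close> of \<open>f A x\<close> times the monomial \<open>\<theta>\<^sub>A\<close>, where \<open>x\<close>
  collects the even coordinates and \<open>\<theta>\<^sub>A\<close> is the product, in increasing order, of the odd coordinates
  with numbers in \<open>A\<close>. Addition of such functions is pointwise; their product is \<open>\<star>\<close> below.
\<close>

type_synonym sfun = "nat set \<Rightarrow> (nat \<Rightarrow> real) \<Rightarrow> real"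

definition even_coords :: "nat \<Rightarrow> (nat \<Rightarrow> bit) \<Rightarrow> nat set" where
  "even_coords N q = {c. c < N \<and> q c = 0}"

definition odd_coords :: "nat \<Rightarrow> (nat \<Rightarrow> bit) \<Rightarrow> nat set" where
  "odd_coords N q = {c. c < N \<and> q c = 1}"

definition pd :: "nat \<Rightarrow> ((nat \<Rightarrow> real) \<Rightarrow> real) \<Rightarrow> (nat \<Rightarrow> real) \<Rightarrow> real" where
  "pd c u x = deriv (\<lambda>t. u (x(c := t))) (x c)"

text \<open>Functions of class \<open>C\<^sup>\<infinity>\<close> in the coordinates from \<open>E\<close>, not depending on the other ones: all
  iterated partial derivatives exist and are continuous.\<close>

definition smooth_in :: "nat set \<Rightarrow> ((nat \<Rightarrow> real) \<Rightarrow> real) \<Rightarrow> bool" where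
  "smooth_in E u \<longleftrightarrow>
     (\<forall>x y. (\<forall>c\<in>E. x c = y c) \<longrightarrow> u x = u y) \<and>
     (\<forall>cs. set cs \<subseteq> E \<longrightarrow>
        continuous_on UNIV (foldr pd cs u) \<and>
        (\<forall>c\<in>E. \<forall>x. (\<lambda>t. foldr pd cs u (x(c := t))) differentiable (at (x c))))"

definition Cinf :: "nat \<Rightarrow> (nat \<Rightarrow> bit) \<Rightarrow> sfun set" where
  "Cinf N q = {f. (\<forall>A. \<not> A \<subseteq> odd_coords N q \<longrightarrow> f A = 0) \<and>
                  (\<forall>A. smooth_in (even_coords N q) (f A))}"

definition spart :: "bit \<Rightarrow> sfun \<Rightarrow> sfun" where
  "spart \<epsilon> f = (\<lambda>A. if of_nat (card A) = \<epsilon> then f A else 0)"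

definition has_parity :: "bit \<Rightarrow> sfun \<Rightarrow> bool" where
  "has_parity \<epsilon> f \<longleftrightarrow> spart \<epsilon> f = f"

definition sscale :: "real \<Rightarrow> sfun \<Rightarrow> sfun" (infixr "*\<^sub>s" 75) where
  "r *\<^sub>s f = (\<lambda>A x. r * f A x)"

text \<open>The sign counts the transpositions that sort \<open>\<theta>\<^sub>B \<theta>\<^sub>C\<close>, \<open>C = A - B\<close>.\<close>

definition smul :: "sfun \<Rightarrow> sfun \<Rightarrow> sfun" (infixl "\<star>" 76) where
  "f \<star> g = (\<lambda>A x. \<Sum>B\<in>Pow A.
     (- 1) ^ card {(b, c). b \<in> B \<and> c \<in> A - B \<and> c < b} * f B x * g (A - B) x)"

definition coord :: "(nat \<Rightarrow> bit) \<Rightarrow> nat \<Rightarrow> sfun" where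
  "coord q c = (if q c = 0 then (\<lambda>A x. if A = {} then x c else 0)
                else (\<lambda>A x. if A = {c} then 1 else 0))"

text \<open>Left partial derivatives.\<close>

definition sderiv :: "(nat \<Rightarrow> bit) \<Rightarrow> nat \<Rightarrow> sfun \<Rightarrow> sfun" where
  "sderiv q c f = (if q c = 0 then (\<lambda>A. pd c (f A))
     else (\<lambda>A x. if c \<in> A then 0 else (- 1) ^ card {a \<in> A. a < c} * f (insert c A) x))"

section \<open>Vector fields\<close>

text \<open>Vector fields are derivations of the algebra of functions; only their values on
  \<open>Cinf N q\<close> matter.\<close>

definition odd_vector_field :: "nat \<Rightarrow> (nat \<Rightarrow> bit) \<Rightarrow> (sfun \<Rightarrow> sfun) \<Rightarrow> bool" where
  "odd_vector_field N q D \<longleftrightarrow>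
     (\<forall>f\<in>Cinf N q. D f \<in> Cinf N q) \<and>
     (\<forall>f\<in>Cinf N q. \<forall>g\<in>Cinf N q. \<forall>r. D (f + r *\<^sub>s g) = D f + r *\<^sub>s D g) \<and>
     (\<forall>\<epsilon>. \<forall>f\<in>Cinf N q. has_parity \<epsilon> f \<longrightarrow> has_parity (\<epsilon> + 1) (D f)) \<and>
     (\<forall>\<epsilon>. \<forall>f\<in>Cinf N q. \<forall>g\<in>Cinf N q. has_parity \<epsilon> f \<longrightarrow>
        D (f \<star> g) = D f \<star> g + ksgn \<epsilon> *\<^sub>s (f \<star> D g))"

definition homological :: "nat \<Rightarrow> (nat \<Rightarrow> bit) \<Rightarrow> (sfun \<Rightarrow> sfun) \<Rightarrow> bool" where
  "homological N q D \<longleftrightarrow> odd_vector_field N q D \<and> (\<forall>f\<in>Cinf N q. D (D f) = 0)"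

text \<open>Commutator of operators of parities \<open>a\<close> and \<open>b\<close>.\<close>

definition scomm :: "bit \<Rightarrow> bit \<Rightarrow> (sfun \<Rightarrow> sfun) \<Rightarrow> (sfun \<Rightarrow> sfun) \<Rightarrow> sfun \<Rightarrow> sfun" where
  "scomm a b D E f = D (E f) - ksgn (a * b) *\<^sub>s E (D f)"

section \<open>The cotangent bundle and its canonical Poisson bracket\<close>

text \<open>
  If \<open>M\<close> has coordinates \<open>0, \<dots>, n - 1\<close> with parities \<open>q\<close>, then \<open>T\<^sup>*M\<close> has \<open>2n\<close> coordinates:
  those of \<open>M\<close>, followed by the momenta, the momentum conjugate to the coordinate \<open>a\<close> having number
  \<open>n + a\<close>. So \<open>Cinf n q\<close> is contained in \<open>Cinf (2 * n) (dbl n q)\<close>, the inclusion being the pull-back of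
  functions. The same numbering is used for \<open>\<gg> \<oplus> \<gg>\<^sup>*\<close>: basis vectors \<open>e\<^sub>i\<close> (number \<open>i\<close>) and
  \<open>e\<^sup>i\<close> (number \<open>n + i\<close>).
\<close>

definition dbl :: "nat \<Rightarrow> (nat \<Rightarrow> bit) \<Rightarrow> nat \<Rightarrow> bit" where
  "dbl n q c = (if c < n then q c else q (c - n))"

definition poisson_hom :: "nat \<Rightarrow> (nat \<Rightarrow> bit) \<Rightarrow> bit \<Rightarrow> sfun \<Rightarrow> sfun \<Rightarrow> sfun" where
  "poisson_hom n q \<epsilon> f g = (\<Sum>a<n.
      ksgn (q a * (\<epsilon> + 1)) *\<^sub>s (sderiv (dbl n q) (n + a) f \<star> sderiv (dbl n q) a g)
    - ksgn (q a * \<epsilon>) *\<^sub>s (sderiv (dbl n q) a f \<star> sderiv (dbl n q) (n + a) g))"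

text \<open>The defining formula is for homogeneous \<open>f\<close>; it is extended by additivity.\<close>

definition poisson :: "nat \<Rightarrow> (nat \<Rightarrow> bit) \<Rightarrow> sfun \<Rightarrow> sfun \<Rightarrow> sfun" where
  "poisson n q f g = poisson_hom n q 0 (spart 0 f) g + poisson_hom n q 1 (spart 1 f) g"

definition ham_field :: "nat \<Rightarrow> (nat \<Rightarrow> bit) \<Rightarrow> sfun \<Rightarrow> sfun \<Rightarrow> sfun" where
  "ham_field n q H = (\<lambda>f. poisson n q H f)"

definition schouten_tensor :: "nat \<Rightarrow> (nat \<Rightarrow> bit) \<Rightarrow> sfun \<Rightarrow> bool" where
  "schouten_tensor n q S \<longleftrightarrow>
     S \<in> Cinf (2 * n) (dbl n q) \<and> has_parity 1 S \<and>
     (\<exists>h. (\<forall>a<n. \<forall>b<n. h a b \<in> Cinf n q) \<and>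
          S = (\<Sum>a<n. \<Sum>b<n. h a b \<star> coord (dbl n q) (n + b) \<star> coord (dbl n q) (n + a))) \<and>
     poisson n q S S = 0"

definition schouten_bracket :: "nat \<Rightarrow> (nat \<Rightarrow> bit) \<Rightarrow> sfun \<Rightarrow> sfun \<Rightarrow> sfun \<Rightarrow> sfun" where
  "schouten_bracket n q S f g = poisson n q f (poisson n q S g)"

text \<open>An odd derivation of an odd bracket: the sign is \<open>(-1)\<close> to the shifted parity of \<open>f\<close>.\<close>

definition QS_condition :: "nat \<Rightarrow> (nat \<Rightarrow> bit) \<Rightarrow> (sfun \<Rightarrow> sfun) \<Rightarrow> sfun \<Rightarrow> bool" where
  "QS_condition n q D S \<longleftrightarrow>
     (\<forall>\<epsilon>. \<forall>f\<in>Cinf n q. \<forall>g\<in>Cinf n q. has_parity \<epsilon> f \<longrightarrow>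
        D (schouten_bracket n q S f g) =
          schouten_bracket n q S (D f) g + ksgn (\<epsilon> + 1) *\<^sub>s schouten_bracket n q S f (D g))"

section \<open>Lie superalgebras, Lie bialgebras and doubles\<close>

text \<open>
  The graded vector space with homogeneous basis \<open>e\<^sub>0, \<dots>, e\<^sub>N\<^sub>-\<^sub>1\<close>; the vector \<open>X\<close> has components
  \<open>X i\<close>. The parity of \<open>e\<^sub>i\<close> is \<open>p i\<close>.
\<close>

definition vspace :: "nat \<Rightarrow> (nat \<Rightarrow> real) set" where
  "vspace N = {X. \<forall>i\<ge>N. X i = 0}"

definition vhom :: "nat \<Rightarrow> (nat \<Rightarrow> bit) \<Rightarrow> bit \<Rightarrow> (nat \<Rightarrow> real) set" where
  "vhom N p \<epsilon> = {X \<in> vspace N. \<forall>i<N. p i \<noteq> \<epsilon> \<longrightarrow> X i = 0}"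

definition vscale :: "real \<Rightarrow> (nat \<Rightarrow> real) \<Rightarrow> nat \<Rightarrow> real" (infixr "*\<^sub>v" 75) where
  "r *\<^sub>v X = (\<lambda>i. r * X i)"

definition bvec :: "nat \<Rightarrow> nat \<Rightarrow> real" where
  "bvec i = (\<lambda>k. if k = i then 1 else 0)"

type_synonym vbracket = "(nat \<Rightarrow> real) \<Rightarrow> (nat \<Rightarrow> real) \<Rightarrow> nat \<Rightarrow> real"

definition lie_superalgebra :: "nat \<Rightarrow> (nat \<Rightarrow> bit) \<Rightarrow> vbracket \<Rightarrow> bool" where
  "lie_superalgebra N p br \<longleftrightarrow>
     (\<forall>X\<in>vspace N. \<forall>Y\<in>vspace N. br X Y \<in> vspace N) \<and>
     (\<forall>X\<in>vspace N. \<forall>Y\<in>vspace N. \<forall>Z\<in>vspace N. \<forall>r.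
        br (X + r *\<^sub>v Y) Z = br X Z + r *\<^sub>v br Y Z \<and>
        br Z (X + r *\<^sub>v Y) = br Z X + r *\<^sub>v br Z Y) \<and>
     (\<forall>a b. \<forall>X\<in>vhom N p a. \<forall>Y\<in>vhom N p b. br X Y \<in> vhom N p (a + b)) \<and>
     (\<forall>a b. \<forall>X\<in>vhom N p a. \<forall>Y\<in>vhom N p b. br X Y = - (ksgn (a * b) *\<^sub>v br Y X)) \<and>
     (\<forall>a b. \<forall>X\<in>vhom N p a. \<forall>Y\<in>vhom N p b. \<forall>Z\<in>vspace N.
        br X (br Y Z) = br (br X Y) Z + ksgn (a * b) *\<^sub>v br Y (br X Z))"

text \<open>The parities of the coordinates on \<open>\<Pi>V\<close>.\<close>

definition Pi_par :: "(nat \<Rightarrow> bit) \<Rightarrow> nat \<Rightarrow> bit" where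
  "Pi_par p = (\<lambda>i. p i + 1)"

text \<open>
  The constant vector field \<open>i\<^sub>X\<close> on \<open>\<Pi>V\<close>, extended linearly from homogeneous \<open>X\<close>; since the
  components are numbers, \<open>X i\<close> can be nonzero only if \<open>p i\<close> is the parity of \<open>X\<close>.
\<close>

definition const_field :: "nat \<Rightarrow> (nat \<Rightarrow> bit) \<Rightarrow> (nat \<Rightarrow> real) \<Rightarrow> sfun \<Rightarrow> sfun" where
  "const_field N p X f = (\<Sum>i<N. (ksgn (p i) * X i) *\<^sub>s sderiv (Pi_par p) i f)"

text \<open>The bracket \<open>br\<close> on \<open>V\<close> corresponds to the odd vector field \<open>D\<close> on \<open>\<Pi>V\<close>.\<close>

definition bracket_of_field ::
  "nat \<Rightarrow> (nat \<Rightarrow> bit) \<Rightarrow> (sfun \<Rightarrow> sfun) \<Rightarrow> vbracket \<Rightarrow> bool" where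
  "bracket_of_field N p D br \<longleftrightarrow>
     (\<forall>a b. \<forall>X\<in>vhom N p a. \<forall>Y\<in>vhom N p b. \<forall>f\<in>Cinf N (Pi_par p).
        const_field N p (br X Y) f =
          scomm (a + 1) (1 + (b + 1)) (const_field N p X) (scomm 1 (b + 1) D (const_field N p Y)) f)"

text \<open>
  Elements of \<open>V\<^sup>*\<close> are given by their components in the dual basis \<open>e\<^sup>i\<close>, which has the parities of
  \<open>e\<^sub>i\<close>; after parity shift, \<open>e\<^sup>i\<close> becomes the coordinate \<open>\<xi>\<^sup>i\<close> on \<open>\<Pi>V\<close>.
\<close>

definition lin_fun :: "nat \<Rightarrow> (nat \<Rightarrow> bit) \<Rightarrow> (nat \<Rightarrow> real) \<Rightarrow> sfun" where
  "lin_fun n p \<alpha> = (\<Sum>i<n. \<alpha> i *\<^sub>s coord (Pi_par p) i)"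

definition bracket_of_schouten :: "nat \<Rightarrow> (nat \<Rightarrow> bit) \<Rightarrow> sfun \<Rightarrow> vbracket \<Rightarrow> bool" where
  "bracket_of_schouten n p S br \<longleftrightarrow>
     (\<forall>\<alpha>\<in>vspace n. \<forall>\<beta>\<in>vspace n.
        schouten_bracket n (Pi_par p) S (lin_fun n p \<alpha>) (lin_fun n p \<beta>) = lin_fun n p (br \<alpha> \<beta>))"

text \<open>
  The components \<open>\<delta>\<^sup>i\<^sup>j\<close> of \<open>\<delta>(X)\<close>, the sum of \<open>\<delta>\<^sup>i\<^sup>j e\<^sub>i \<otimes> e\<^sub>j\<close>, where \<open>\<delta>\<close> is dual to the bracket
  of \<open>\<gg>\<^sup>*\<close>: \<open>\<langle>\<delta>(X), \<alpha> \<otimes> \<beta>\<rangle> = \<langle>X, [\<alpha>, \<beta>]\<rangle>\<close>. The sign comes from the pairing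
  \<open>\<langle>e\<^sub>i \<otimes> e\<^sub>j, e\<^sup>i \<otimes> e\<^sup>j\<rangle> = (-1)\<^bsup>ij\<^esup>\<close> (with \<open>i\<close>, \<open>j\<close> in the exponent standing for parities).
\<close>

definition cobracket ::
  "nat \<Rightarrow> (nat \<Rightarrow> bit) \<Rightarrow> vbracket \<Rightarrow> (nat \<Rightarrow> real) \<Rightarrow> nat \<Rightarrow> nat \<Rightarrow> real" where
  "cobracket n p brs X = (\<lambda>i j. ksgn (p i * p j) * (\<Sum>k<n. X k * brs (bvec i) (bvec j) k))"

text \<open>Components of \<open>ad\<^sub>X\<close> applied to the tensor \<open>t\<^sup>i\<^sup>j e\<^sub>i \<otimes> e\<^sub>j\<close>, where \<open>X\<close> has parity \<open>a\<close>.\<close>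

definition ad_tensor ::
  "nat \<Rightarrow> (nat \<Rightarrow> bit) \<Rightarrow> vbracket \<Rightarrow> bit \<Rightarrow> (nat \<Rightarrow> real) \<Rightarrow> (nat \<Rightarrow> nat \<Rightarrow> real) \<Rightarrow> nat \<Rightarrow> nat \<Rightarrow> real"
where
  "ad_tensor n p br a X t = (\<lambda>k l.
     (\<Sum>i<n. t i l * br X (bvec i) k) + (\<Sum>j<n. ksgn (a * p k) * t k j * br X (bvec j) l))"

definition lie_bialgebra :: "nat \<Rightarrow> (nat \<Rightarrow> bit) \<Rightarrow> vbracket \<Rightarrow> vbracket \<Rightarrow> bool" where
  "lie_bialgebra n p br brs \<longleftrightarrow>
     lie_superalgebra n p br \<and> lie_superalgebra n p brs \<and>
     (\<forall>a b. \<forall>X\<in>vhom n p a. \<forall>Y\<in>vhom n p b. \<forall>k<n. \<forall>l<n.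
        cobracket n p brs (br X Y) k l =
          ad_tensor n p br a X (cobracket n p brs Y) k l
          - ksgn (a * b) * ad_tensor n p br b Y (cobracket n p brs X) k l)"

definition dual_emb :: "nat \<Rightarrow> (nat \<Rightarrow> real) \<Rightarrow> nat \<Rightarrow> real" where
  "dual_emb n \<alpha> = (\<lambda>c. if c < n then 0 else \<alpha> (c - n))"

text \<open>
  The natural inner product on \<open>\<gg> \<oplus> \<gg>\<^sup>*\<close>: \<open>\<langle>e\<^sub>i, e\<^sup>j\<rangle> = \<delta>\<^sub>i\<^sup>j\<close>, \<open>\<gg>\<close> and \<open>\<gg>\<^sup>*\<close> are isotropic, and
  \<open>\<langle>u, v\<rangle> = (-1)\<^bsup>uv\<^esup> \<langle>v, u\<rangle>\<close>, which makes \<open>\<langle>e\<^sup>i, e\<^sub>i\<rangle>\<close> negative for odd \<open>e\<^sub>i\<close>.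
\<close>

definition dbl_inner :: "nat \<Rightarrow> (nat \<Rightarrow> bit) \<Rightarrow> (nat \<Rightarrow> real) \<Rightarrow> (nat \<Rightarrow> real) \<Rightarrow> real" where
  "dbl_inner n p u v = (\<Sum>i<n. u i * v (n + i) + ksgn (p i) * u (n + i) * v i)"

definition double_structure ::
  "nat \<Rightarrow> (nat \<Rightarrow> bit) \<Rightarrow> vbracket \<Rightarrow> vbracket \<Rightarrow> vbracket \<Rightarrow> bool" where
  "double_structure n p br brs brd \<longleftrightarrow>
     lie_superalgebra (2 * n) (dbl n p) brd \<and>
     (\<forall>X\<in>vspace n. \<forall>Y\<in>vspace n. brd X Y = br X Y) \<and>
     (\<forall>\<alpha>\<in>vspace n. \<forall>\<beta>\<in>vspace n.
        brd (dual_emb n \<alpha>) (dual_emb n \<beta>) = dual_emb n (brs \<alpha> \<beta>)) \<and>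
     (\<forall>a b. \<forall>u\<in>vhom (2 * n) (dbl n p) a. \<forall>v\<in>vhom (2 * n) (dbl n p) b. \<forall>w\<in>vspace (2 * n).
        dbl_inner n p (brd u v) w + ksgn (a * b) * dbl_inner n p v (brd u w) = 0)"

definition drinfeld_double ::
  "nat \<Rightarrow> (nat \<Rightarrow> bit) \<Rightarrow> vbracket \<Rightarrow> vbracket \<Rightarrow> vbracket \<Rightarrow> bool" where
  "drinfeld_double n p br brs brd \<longleftrightarrow>
     lie_bialgebra n p br brs \<and> double_structure n p br brs brd \<and>
     (\<forall>brd'. double_structure n p br brs brd' \<longrightarrow>
        (\<forall>u\<in>vspace (2 * n). \<forall>v\<in>vspace (2 * n). brd' u v = brd u v))"

section \<open>The data\<close>

definition Q_field :: "nat \<Rightarrow> (nat \<Rightarrow> bit) \<Rightarrow> (nat \<Rightarrow> nat \<Rightarrow> nat \<Rightarrow> real) \<Rightarrow> sfun \<Rightarrow> sfun" where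
  "Q_field n q Qc f = (1/2) *\<^sub>s (\<Sum>i<n. \<Sum>j<n. \<Sum>k<n.
     Qc i j k *\<^sub>s (coord q j \<star> coord q i \<star> sderiv q k f))"

text \<open>Below \<open>\<xi> i\<close> and \<open>\<eta> i\<close> are the coordinates \<open>\<xi>\<^sup>i\<close> and the momenta \<open>\<xi>\<^sub>i\<close>; \<open>Qc i j k\<close> is \<open>Q\<^sub>i\<^sub>j\<^sup>k\<close> and
  \<open>Sc l n m\<close> is \<open>S\<^sub>l\<^sup>n\<^sup>m\<close>. The functions are without the factor one half.\<close>

definition Q_form :: "nat \<Rightarrow> (nat \<Rightarrow> bit) \<Rightarrow> (nat \<Rightarrow> nat \<Rightarrow> nat \<Rightarrow> real) \<Rightarrow> sfun" where
  "Q_form n q Qc = (let \<xi> = coord (dbl n q); \<eta> = (\<lambda>i. coord (dbl n q) (n + i)) in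
     \<Sum>i<n. \<Sum>j<n. \<Sum>k<n. Qc i j k *\<^sub>s (\<xi> j \<star> \<xi> i \<star> \<eta> k))"

definition S_form :: "nat \<Rightarrow> (nat \<Rightarrow> bit) \<Rightarrow> (nat \<Rightarrow> nat \<Rightarrow> nat \<Rightarrow> real) \<Rightarrow> sfun" where
  "S_form d q Sc = (let \<xi> = coord (dbl d q); \<eta> = (\<lambda>i. coord (dbl d q) (d + i)) in
     \<Sum>l<d. \<Sum>n<d. \<Sum>m<d. Sc l n m *\<^sub>s (\<xi> l \<star> \<eta> m \<star> \<eta> n))"

definition Q_ham :: "nat \<Rightarrow> (nat \<Rightarrow> bit) \<Rightarrow> (nat \<Rightarrow> nat \<Rightarrow> nat \<Rightarrow> real) \<Rightarrow> sfun" where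
  "Q_ham n q Qc = (1/2) *\<^sub>s Q_form n q Qc"

definition S_ham :: "nat \<Rightarrow> (nat \<Rightarrow> bit) \<Rightarrow> (nat \<Rightarrow> nat \<Rightarrow> nat \<Rightarrow> real) \<Rightarrow> sfun" where
  "S_ham n q Sc = (1/2) *\<^sub>s S_form n q Sc"

end

theory Submission
  imports Defs
begin

text \<open>
  Everything reduces to the calculus of the canonical Poisson bracket. A vector field is determined
  by its values on the coordinates, so the Jacobi identity, being an equality of vector fields in each
  argument, need only be checked on coordinates. On functions of the base \<open>Q\<close> acts as the given field,
  so \<open>{Q, Q} = 0\<close>, and the failure of the \<open>QS\<close>-condition is \<open>{f, {{Q, S}, g}}\<close> up to sign; as \<open>{Q, S}\<close> is
  quadratic in the momenta, this vanishes for all \<open>f\<close>, \<open>g\<close> only if \<open>{Q, S} = 0\<close>.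

  The Lie bracket of a quadratic homological field is the derived bracket of constant fields, whence
  its Jacobi identity. For the field of \<open>H = Q + S\<close> its structure constants, with an index lowered by
  the inner product, are the third derivatives of \<open>H\<close>; invariance is their symmetry, and \<open>\<gg>\<close>, \<open>\<gg>\<^sup>*\<close> are
  subalgebras because the momentum degrees of \<open>Q\<close> and \<open>S\<close> are 1 and 2. The cocycle condition is then part
  of the Jacobi identity of the double.
\<close>

text \<open>The arrays \<open>Qc\<close> and \<open>Sc\<close> are not assumed to be graded
  symmetric or compatible with parities; such information sits only in the functions built from
  them. Parities of the components of \<open>Q\<close> are therefore extracted from the oddness of
  the field, and all structure constants are read off as derivatives, which symmetrize
  automatically. Vector fields are handled in coordinate form, so that they are determined by their
  values on coordinates by definition; the derivation property is then a consequence. Functions are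
  smooth rather than polynomial, so degrees are measured by eigenvalues of Euler fields, with one
  choice of weights for the total degree and another for the degree in the momenta. Sign identities
  are mostly settled by running through the values of the parities; where the signs do not agree
  identically, a parity rule shows that they agree wherever the coefficient is nonzero. For this the
  operations on \<open>bit\<close> have to remain ring operations, hence the removal of the
  rewriting to exclusive or and conjunction.\<close>

declare add_bit_eq_xor [simp del] mult_bit_eq_and [simp del]

section \<open>Arithmetic of parities and Koszul signs\<close>

lemma bit_add_self_zero [simp]: "(a::bit) + a = 0" "a + (a + b) = b"
  by (cases a; cases b; simp)+

lemma bit_mult_self [simp]: "(a::bit) * a = a" "a * (a * b) = a * b"
  by (cases a; simp)+

lemma ksgn_simps [simp]: "ksgn 0 = 1" "ksgn 1 = - 1" "ksgn a * ksgn a = 1" "ksgn a * (ksgn a * r) = r"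
  by (simp_all add: ksgn_def)

lemma ksgn_add: "ksgn (a + b) = ksgn a * ksgn b"
  by (cases a; cases b; simp)

lemma ksgn_of_nat: "ksgn (of_nat k) = (- 1) ^ k"
  by (induction k) (simp_all add: ksgn_add)

lemma ksgn_nonzero [simp]: "ksgn a \<noteq> 0"
  by (simp add: ksgn_def)

subsection \<open>Smooth functions\<close>

text \<open>A coinduction principle: a set \<open>U\<close> of functions closed under partial
  derivatives contains all iterated ones, so smoothness can be shown without a formula for
  \<open>foldr pd cs u\<close>.\<close>

lemma smooth_in_coinduct:
  assumes "u \<in> U"
    and "\<And>v c. v \<in> U \<Longrightarrow> c \<in> E \<Longrightarrow> pd c v \<in> U"
    and "\<And>v. v \<in> U \<Longrightarrow> continuous_on UNIV v"
    and "\<And>v c x. v \<in> U \<Longrightarrow> c \<in> E \<Longrightarrow> (\<lambda>t. v (x(c := t))) differentiable (at (x c))"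
    and "\<And>v x y. v \<in> U \<Longrightarrow> (\<forall>c\<in>E. x c = y c) \<Longrightarrow> v x = v y"
  shows "smooth_in E u"
proof -
  have "set cs \<subseteq> E \<Longrightarrow> foldr pd cs u \<in> U" for cs
    by (induction cs) (auto intro: assms)
  then show ?thesis
    unfolding smooth_in_def using assms by blast
qed

lemma smooth_in_continuous: "smooth_in E u \<Longrightarrow> continuous_on UNIV u"
  unfolding smooth_in_def by (metis empty_subsetI foldr_Nil id_apply set_empty2)

lemma smooth_in_cong: "smooth_in E u \<Longrightarrow> (\<And>c. c \<in> E \<Longrightarrow> x c = y c) \<Longrightarrow> u x = u y"
  unfolding smooth_in_def by blast

lemma smooth_in_differentiable_pt:
  "smooth_in E u \<Longrightarrow> c \<in> E \<Longrightarrow> (\<lambda>t. u (x(c := t))) differentiable (at (x c))"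
  unfolding smooth_in_def by (metis empty_subsetI foldr_Nil id_apply set_empty2)

lemma smooth_in_DERIV:
  assumes "smooth_in E u" "c \<in> E"
  shows "((\<lambda>t. u (x(c := t))) has_real_derivative pd c u (x(c := s))) (at s)"
proof -
  have "(\<lambda>t. u ((x(c := s))(c := t))) differentiable (at ((x(c := s)) c))"
    using smooth_in_differentiable_pt[OF assms] .
  then show ?thesis
    by (simp add: pd_def DERIV_deriv_iff_real_differentiable)
qed

lemma pd_cong:
  assumes "\<And>x y. (\<forall>c\<in>E. x c = y c) \<Longrightarrow> u x = u y" "\<forall>c\<in>E. x c = y c" "d \<in> E"
  shows "pd d u x = pd d u y"
proof -
  have "u (x(d := t)) = u (y(d := t))" for t
    using assms(2) by (intro assms(1)) auto
  then show ?thesis using assms(2,3) by (simp add: pd_def)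
qed

lemma smooth_in_pd:
  assumes "smooth_in E u" "c \<in> E"
  shows "smooth_in E (pd c u)"
proof -
  have *: "foldr pd (cs @ [c]) u = foldr pd cs (pd c u)" for cs by simp
  have dep: "\<forall>x y. (\<forall>c\<in>E. x c = y c) \<longrightarrow> pd c u x = pd c u y"
    using pd_cong[of E u _ _ c] assms unfolding smooth_in_def by blast
  show ?thesis
    unfolding smooth_in_def
  proof (intro conjI allI impI)
    fix cs assume "set cs \<subseteq> E"
    then have "set (cs @ [c]) \<subseteq> E" using assms by simp
    then have "continuous_on UNIV (foldr pd (cs @ [c]) u) \<and>
        (\<forall>c'\<in>E. \<forall>x. (\<lambda>t. foldr pd (cs @ [c]) u (x(c' := t))) differentiable (at (x c')))"
      using assms(1) unfolding smooth_in_def by blast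
    then show "continuous_on UNIV (foldr pd cs (pd c u))"
      "\<forall>c'\<in>E. \<forall>x. (\<lambda>t. foldr pd cs (pd c u) (x(c' := t))) differentiable (at (x c'))"
      unfolding * by auto
  qed (use dep in blast)
qed

lemma pd_not_dependent:
  assumes "smooth_in E u" "c \<notin> E"
  shows "pd c u = 0"
proof
  fix x
  have "u (x(c := t)) = u x" for t
    by (rule smooth_in_cong[OF assms(1)]) (use assms(2) in auto)
  then show "pd c u x = 0 x" by (simp add: pd_def)
qed

lemma pd_const: "pd c (\<lambda>x. r) = 0"
  by (simp add: pd_def fun_eq_iff)

lemma smooth_in_const: "smooth_in E (\<lambda>x. r)"
  by (rule smooth_in_coinduct[of _ "{(\<lambda>x. s) | s. True}"]) (auto simp: pd_const zero_fun_def)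

lemma smooth_in_zero: "smooth_in E 0"
  unfolding zero_fun_def by (rule smooth_in_const)

text \<open>Needed for the pull-back from the base to the cotangent bundle. Derivatives in the
  additional coordinates vanish, so the functions smooth in \<open>E\<close> are already closed
  under all derivatives from \<open>E'\<close>.\<close>

lemma smooth_in_mono:
  assumes "smooth_in E u" "E \<subseteq> E'"
  shows "smooth_in E' u"
proof (rule smooth_in_coinduct[of _ "{v. smooth_in E v}"])
  fix v c assume v: "v \<in> {v. smooth_in E v}"
  show "pd c v \<in> {v. smooth_in E v}"
    using v by (cases "c \<in> E") (simp_all add: smooth_in_pd pd_not_dependent smooth_in_zero)
  show "(\<lambda>t. v (x(c := t))) differentiable at (x c)" for x
  proof (cases "c \<in> E")
    case False
    have "v (x(c := t)) = v x" for t
      by (rule smooth_in_cong[of E]) (use v False in auto)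
    then show ?thesis by simp
  qed (use v smooth_in_differentiable_pt in auto)
  show "v x = v y" if "\<forall>c\<in>E'. x c = y c" for x y
    using v that assms(2) smooth_in_cong[of E v x y] by blast
qed (use assms in \<open>auto intro: smooth_in_continuous\<close>)

lemma DERIV_pdI:
  "((\<lambda>t. u (x(c := t))) has_real_derivative D) (at (x c)) \<Longrightarrow> pd c u x = D"
  by (simp add: pd_def DERIV_imp_deriv)

lemma smooth_in_DERIV':
  assumes "smooth_in E u" "c \<in> E"
  shows "((\<lambda>t. u (x(c := t))) has_real_derivative pd c u x) (at (x c))"
  using smooth_in_DERIV[OF assms, of x "x c"] by simp

lemma pd_add: "smooth_in E u \<Longrightarrow> smooth_in E v \<Longrightarrow> c \<in> E \<Longrightarrow> pd c (u + v) = pd c u + pd c v"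
  by (rule ext, rule DERIV_pdI) (auto intro!: derivative_eq_intros smooth_in_DERIV')

lemma pd_mult: "smooth_in E u \<Longrightarrow> smooth_in E v \<Longrightarrow> c \<in> E \<Longrightarrow> pd c (u * v) = pd c u * v + u * pd c v"
  by (rule ext, rule DERIV_pdI) (auto intro!: derivative_eq_intros smooth_in_DERIV')

text \<open>By the product rule the derivative of a product is a sum of products, so products alone
  are not an invariant for coinduction. The algebra generated by the smooth functions is closed
  under derivatives and turns out to consist of smooth functions.\<close>

inductive_set smooth_alg :: "nat set \<Rightarrow> ((nat \<Rightarrow> real) \<Rightarrow> real) set" for E where
  base: "smooth_in E u \<Longrightarrow> u \<in> smooth_alg E"
| add: "u \<in> smooth_alg E \<Longrightarrow> v \<in> smooth_alg E \<Longrightarrow> u + v \<in> smooth_alg E"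
| mult: "u \<in> smooth_alg E \<Longrightarrow> v \<in> smooth_alg E \<Longrightarrow> u * v \<in> smooth_alg E"

lemma smooth_alg_props:
  assumes "u \<in> smooth_alg E"
  shows "continuous_on UNIV u \<and> (\<forall>x y. (\<forall>c\<in>E. x c = y c) \<longrightarrow> u x = u y) \<and>
    (\<forall>c\<in>E. pd c u \<in> smooth_alg E \<and>
      (\<forall>x. ((\<lambda>t. u (x(c := t))) has_real_derivative pd c u x) (at (x c))))"
  using assms
proof induction
  case (base u)
  then show ?case
    using smooth_in_continuous smooth_in_cong[of E u] smooth_in_DERIV' smooth_in_pd[THEN smooth_alg.base]
    by (intro conjI allI impI ballI) blast+
next
  case (add u v)
  have D: "((\<lambda>t. (u + v) (x(c := t))) has_real_derivative (pd c u + pd c v) x) (at (x c))" if "c \<in> E" for c x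
    using DERIV_add[of "\<lambda>t. u (x(c := t))" "pd c u x" "x c" UNIV "\<lambda>t. v (x(c := t))" "pd c v x"] add that
    by (simp del: fun_upd_apply)
  then have "pd c (u + v) = pd c u + pd c v" if "c \<in> E" for c
    using that by (intro ext DERIV_pdI)
  moreover have "continuous_on UNIV (u + v)"
    using add continuous_on_add[of UNIV u v] by (simp add: plus_fun_def)
  moreover have "(u + v) x = (u + v) y" if "\<forall>c\<in>E. x c = y c" for x y
    using add that by (metis plus_fun_apply)
  moreover have "pd c u + pd c v \<in> smooth_alg E" if "c \<in> E" for c
    using add that by (simp add: smooth_alg.add)
  ultimately show ?case
    using D by (intro conjI allI impI ballI) (simp_all del: plus_fun_apply fun_upd_apply)
next
  case (mult u v)
  have D: "((\<lambda>t. (u * v) (x(c := t))) has_real_derivative (pd c u * v + u * pd c v) x) (at (x c))"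
    if "c \<in> E" for c x
    using DERIV_mult[of "\<lambda>t. u (x(c := t))" "pd c u x" "x c" UNIV "\<lambda>t. v (x(c := t))" "pd c v x"] mult that
    by (simp del: fun_upd_apply add: algebra_simps)
  then have "pd c (u * v) = pd c u * v + u * pd c v" if "c \<in> E" for c
    using that by (intro ext DERIV_pdI)
  moreover have "continuous_on UNIV (u * v)"
    using mult continuous_on_mult[of UNIV u v] by (simp add: times_fun_def)
  moreover have "(u * v) x = (u * v) y" if "\<forall>c\<in>E. x c = y c" for x y
    using mult that by (metis times_fun_apply)
  moreover have "pd c u * v + u * pd c v \<in> smooth_alg E" if "c \<in> E" for c
    using mult that by (simp add: smooth_alg.add smooth_alg.mult)
  ultimately show ?case
    using D by (intro conjI allI impI ballI) (simp_all del: plus_fun_apply times_fun_apply fun_upd_apply)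
qed

lemma smooth_in_iff_smooth_alg: "smooth_in E u \<longleftrightarrow> u \<in> smooth_alg E"
proof
  assume u: "u \<in> smooth_alg E"
  then show "smooth_in E u"
  proof (rule smooth_in_coinduct)
    fix v assume v: "v \<in> smooth_alg E"
    show "v x = v y" if "\<forall>c\<in>E. x c = y c" for x y
      using smooth_alg_props[OF v] that by blast
    show "(\<lambda>t. v (x(c := t))) differentiable at (x c)" if "c \<in> E" for c x
      using smooth_alg_props[OF v] that real_differentiable_def by blast
  qed (use smooth_alg_props in blast)+
qed (rule smooth_alg.base)

lemma smooth_in_add: "smooth_in E u \<Longrightarrow> smooth_in E v \<Longrightarrow> smooth_in E (u + v)"
  by (simp add: smooth_in_iff_smooth_alg smooth_alg.add)

lemma smooth_in_mult: "smooth_in E u \<Longrightarrow> smooth_in E v \<Longrightarrow> smooth_in E (u * v)"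
  by (simp add: smooth_in_iff_smooth_alg smooth_alg.mult)

lemma smooth_in_cmult: "smooth_in E u \<Longrightarrow> smooth_in E (\<lambda>x. r * u x)"
  using smooth_in_mult[OF smooth_in_const, of E u r] by (simp add: times_fun_def)

lemma pd_cmult: "smooth_in E u \<Longrightarrow> c \<in> E \<Longrightarrow> pd c (\<lambda>x. r * u x) = (\<lambda>x. r * pd c u x)"
  using pd_mult[OF smooth_in_const, of E u c r] by (simp add: times_fun_def pd_const plus_fun_def)

lemma smooth_in_sum: "(\<And>i. i \<in> I \<Longrightarrow> smooth_in E (u i)) \<Longrightarrow> smooth_in E (\<Sum>i\<in>I. u i)"
  by (induction I rule: infinite_finite_induct) (auto intro: smooth_in_zero smooth_in_add)

lemma pd_zero [simp]: "pd c 0 = 0"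
  using pd_const[of c 0] by (simp add: zero_fun_def)

lemma pd_sum:
  "(\<And>i. i \<in> I \<Longrightarrow> smooth_in E (u i)) \<Longrightarrow> c \<in> E \<Longrightarrow> pd c (\<Sum>i\<in>I. u i) = (\<Sum>i\<in>I. pd c (u i))"
  by (induction I rule: infinite_finite_induct) (auto simp: pd_add[of E] smooth_in_sum)

lemma pd_coord: "pd c (\<lambda>x. x d) = (\<lambda>x. if c = d then 1 else 0)"
  by (auto simp: pd_def fun_eq_iff)

lemma differentiable_upd_coord: "(\<lambda>t. (x(c := t)) d) differentiable (at (r :: real))"
  by (cases "d = c") simp_all

lemma smooth_in_coord:
  assumes "d \<in> E" shows "smooth_in E (\<lambda>x. x d)"
proof (rule smooth_in_coinduct[of _ "insert (\<lambda>x. x d) {(\<lambda>x. s) | s. True}"])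
  fix v :: "(nat \<Rightarrow> real) \<Rightarrow> real"
  assume "v \<in> insert (\<lambda>x. x d) {(\<lambda>x. s) | s. True}"
  then show "continuous_on UNIV v" "\<And>c. pd c v \<in> insert (\<lambda>x. x d) {(\<lambda>x. s) | s. True}"
    "\<And>c x. (\<lambda>t. v (x(c := t))) differentiable (at (x c))"
    "\<And>x y. (\<forall>c\<in>E. x c = y c) \<Longrightarrow> v x = v y"
    using assms differentiable_upd_coord
    by (auto simp: pd_coord pd_const zero_fun_def continuous_on_product_coordinates simp del: fun_upd_apply)
qed auto

text \<open>The theorem of Schwarz. The second difference of \<open>g\<close> over a square of side
  \<open>h\<close> with corner \<open>(a, b)\<close> equals \<open>h * h\<close> times a value of
  \<open>g12\<close> and also \<open>h * h\<close> times a value of \<open>g21\<close>, both at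
  points inside the square; continuity gives the claim as \<open>h\<close> tends to 0.\<close>

lemma mixed_derivatives_equal:
  fixes g :: "real \<Rightarrow> real \<Rightarrow> real"
  assumes g1: "\<And>s t. ((\<lambda>s. g s t) has_real_derivative g1 s t) (at s)"
    and g2: "\<And>s t. ((\<lambda>t. g s t) has_real_derivative g2 s t) (at t)"
    and g12: "\<And>s t. ((\<lambda>t. g1 s t) has_real_derivative g12 s t) (at t)"
    and g21: "\<And>s t. ((\<lambda>s. g2 s t) has_real_derivative g21 s t) (at s)"
    and c12: "continuous_on UNIV (\<lambda>(s, t). g12 s t)"
    and c21: "continuous_on UNIV (\<lambda>(s, t). g21 s t)"
  shows "g12 a b = g21 a b"
proof -
  have "\<exists>s t s' t'. a < s \<and> s < a + h \<and> b < t \<and> t < b + h \<and> a < s' \<and> s' < a + h \<and> b < t' \<and> t' < b + h \<and>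
     g12 s t = g21 s' t'" if h: "h > 0" for h
  proof -
    \<comment> \<open>The mean value theorem for the difference \<open>g s (b+h) - g s b\<close> as
      a function of \<open>s\<close>; a second application, in \<open>t\<close>, produces
      \<open>g12\<close>.\<close>
    have "\<exists>s>a. s < a + h \<and>
      (g (a+h) (b+h) - g (a+h) b) - (g a (b+h) - g a b) = (a + h - a) * (g1 s (b+h) - g1 s b)"
      by (rule MVT2) (use h in \<open>auto intro!: derivative_intros g1\<close>)
    then obtain s where s: "a < s" "s < a + h"
      "(g (a+h) (b+h) - g (a+h) b) - (g a (b+h) - g a b) = (a + h - a) * (g1 s (b+h) - g1 s b)"
      by blast
    obtain t where t: "b < t" "t < b + h" "g1 s (b+h) - g1 s b = (b + h - b) * g12 s t"
      using MVT2[of b "b+h" "\<lambda>t. g1 s t" "\<lambda>t. g12 s t"] h g12 by auto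
    \<comment> \<open>The same second difference, grouped the other way.\<close>
    have "\<exists>t'>b. t' < b + h \<and>
      (g (a+h) (b+h) - g a (b+h)) - (g (a+h) b - g a b) = (b + h - b) * (g2 (a+h) t' - g2 a t')"
      by (rule MVT2) (use h in \<open>auto intro!: derivative_intros g2\<close>)
    then obtain t' where t': "b < t'" "t' < b + h"
      "(g (a+h) (b+h) - g a (b+h)) - (g (a+h) b - g a b) = (b + h - b) * (g2 (a+h) t' - g2 a t')"
      by blast
    obtain s' where s': "a < s'" "s' < a + h" "g2 (a+h) t' - g2 a t' = (a + h - a) * g21 s' t'"
      using MVT2[of a "a+h" "\<lambda>s. g2 s t'" "\<lambda>s. g21 s t'"] h g21 by auto
    have "h * (h * g12 s t) = h * (h * g21 s' t')"
      using s(3) t'(3) unfolding t(3) s'(3) add_diff_cancel_left' by linarith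
    then have "g12 s t = g21 s' t'" using h by simp
    then show ?thesis using s t s' t' by blast
  qed
  \<comment> \<open>Squares of side \<open>1 / (n + 1)\<close> give two sequences of points that
    converge to the corner.\<close>
  then have "\<forall>n. \<exists>s t s' t'. a < s \<and> s < a + inverse (real (Suc n)) \<and> b < t \<and> t < b + inverse (real (Suc n)) \<and>
     a < s' \<and> s' < a + inverse (real (Suc n)) \<and> b < t' \<and> t' < b + inverse (real (Suc n)) \<and> g12 s t = g21 s' t'"
    by (metis inverse_positive_iff_positive of_nat_0_less_iff zero_less_Suc)
  then obtain s t s' t' where st: "\<And>n. a < s n" "\<And>n. s n < a + inverse (real (Suc n))" "\<And>n. b < t n"
     "\<And>n. t n < b + inverse (real (Suc n))" "\<And>n. a < s' n" "\<And>n. s' n < a + inverse (real (Suc n))" "\<And>n. b < t' n"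
     "\<And>n. t' n < b + inverse (real (Suc n))" and eq: "\<And>n. g12 (s n) (t n) = g21 (s' n) (t' n)"
    by metis
  have lim: "r \<longlonglongrightarrow> e" if "\<And>n. e < r n" "\<And>n. r n < e + inverse (real (Suc n))" for r and e :: real
  proof (rule tendsto_sandwich[of "\<lambda>n. e" _ _ "\<lambda>n. e + inverse (real (Suc n))"])
    show "(\<lambda>n. e + inverse (real (Suc n))) \<longlonglongrightarrow> e"
      using LIMSEQ_inverse_real_of_nat_add .
  qed (use that less_imp_le in \<open>auto intro!: always_eventually\<close>)
  have "(\<lambda>n. (s n, t n)) \<longlonglongrightarrow> (a, b)" "(\<lambda>n. (s' n, t' n)) \<longlonglongrightarrow> (a, b)"
    using st by (auto intro!: tendsto_Pair lim)
  then have "(\<lambda>n. g12 (s n) (t n)) \<longlonglongrightarrow> g12 a b" "(\<lambda>n. g21 (s' n) (t' n)) \<longlonglongrightarrow> g21 a b"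
    using continuous_on_tendsto_compose[OF c12, of "\<lambda>n. (s n, t n)" "(a, b)" sequentially]
      continuous_on_tendsto_compose[OF c21, of "\<lambda>n. (s' n, t' n)" "(a, b)" sequentially] by simp_all
  then show ?thesis
    using eq LIMSEQ_unique by simp
qed

text \<open>Everything is restricted to the plane through \<open>x\<close> in the directions
  \<open>c\<close> and \<open>d\<close>. As these differ, the two updates commute, so each variable
  in turn can be treated as the last one updated.\<close>

lemma pd_commute:
  assumes "smooth_in E u" "c \<in> E" "d \<in> E"
  shows "pd c (pd d u) = pd d (pd c u)"
proof (cases "c = d")
  case False
  show ?thesis
  proof
    fix x
    define y where "y s t = x(c := s, d := t)" for s t :: real
    have y: "y s t = x(d := t, c := s)" for s t
      using False by (auto simp: y_def fun_eq_iff)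
    have yc: "continuous_on UNIV (\<lambda>(s, t). y s t)"
    proof (rule continuous_on_coordinatewise_then_product)
      show "continuous_on UNIV (\<lambda>z. (case z of (s, t) \<Rightarrow> y s t) i)" for i
        by (cases "i = d"; cases "i = c") (simp_all add: y_def case_prod_unfold continuous_on_fst continuous_on_snd)
    qed
    have cc: "continuous_on UNIV (\<lambda>(s, t). v (y s t))" if "smooth_in E v" for v
      using continuous_on_compose2[OF smooth_in_continuous[OF that] yc] by (simp add: case_prod_unfold)
    have "pd d (pd c u) (y (x c) (x d)) = pd c (pd d u) (y (x c) (x d))"
    proof (rule mixed_derivatives_equal[where g = "\<lambda>s t. u (y s t)" and ?g1.0 = "\<lambda>s t. pd c u (y s t)"
          and ?g2.0 = "\<lambda>s t. pd d u (y s t)" and ?g12.0 = "\<lambda>s t. pd d (pd c u) (y s t)"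
          and ?g21.0 = "\<lambda>s t. pd c (pd d u) (y s t)" and a = "x c" and b = "x d"])
      show "((\<lambda>s. u (y s t)) has_real_derivative pd c u (y s t)) (at s)" for s t
        unfolding y by (rule smooth_in_DERIV[OF assms(1,2)])
      show "((\<lambda>s. pd d u (y s t)) has_real_derivative pd c (pd d u) (y s t)) (at s)" for s t
        unfolding y by (rule smooth_in_DERIV[OF smooth_in_pd[OF assms(1,3)] assms(2)])
      show "((\<lambda>t. u (y s t)) has_real_derivative pd d u (y s t)) (at t)" for s t
        unfolding y_def by (rule smooth_in_DERIV[OF assms(1,3)])
      show "((\<lambda>t. pd c u (y s t)) has_real_derivative pd d (pd c u) (y s t)) (at t)" for s t
        unfolding y_def by (rule smooth_in_DERIV[OF smooth_in_pd[OF assms(1,2)] assms(3)])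
    qed (use assms in \<open>auto intro!: cc smooth_in_pd\<close>)
    then show "pd c (pd d u) x = pd d (pd c u) x"
      by (simp add: y_def)
  qed
qed simp

subsection \<open>The algebra of functions\<close>

text \<open>The exponent of the sign in \<open>smul\<close>, with the second set no longer tied to
  be a complement, so that it can be split additively in either argument.\<close>

definition invs :: "nat set \<Rightarrow> nat set \<Rightarrow> nat" where
  "invs B C = card {(b, c). b \<in> B \<and> c \<in> C \<and> c < b}"

lemma finite_invs: "finite B \<Longrightarrow> finite C \<Longrightarrow> finite {(b, c). b \<in> B \<and> c \<in> C \<and> c < (b::nat)}"
  by (rule finite_subset[of _ "B \<times> C"]) auto

lemma invs_Un_left:
  assumes "finite B" "finite B'" "finite C" "B \<inter> B' = {}"
  shows "invs (B \<union> B') C = invs B C + invs B' C"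
proof -
  have "{(b, c). b \<in> B \<union> B' \<and> c \<in> C \<and> c < b} =
    {(b, c). b \<in> B \<and> c \<in> C \<and> c < b} \<union> {(b, c). b \<in> B' \<and> c \<in> C \<and> c < b}" by auto
  then show ?thesis unfolding invs_def
    using assms by (simp only:) (rule card_Un_disjoint; auto simp: finite_invs)
qed

lemma invs_Un_right:
  assumes "finite B" "finite C" "finite C'" "C \<inter> C' = {}"
  shows "invs B (C \<union> C') = invs B C + invs B C'"
proof -
  have "{(b, c). b \<in> B \<and> c \<in> C \<union> C' \<and> c < b} =
    {(b, c). b \<in> B \<and> c \<in> C \<and> c < b} \<union> {(b, c). b \<in> B \<and> c \<in> C' \<and> c < b}" by auto
  then show ?thesis unfolding invs_def
    using assms by (simp only:) (rule card_Un_disjoint; auto simp: finite_invs)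
qed

lemma invs_singleton: "invs {a} C = card {c \<in> C. c < a}" "invs B {a} = card {b \<in> B. a < b}"
proof -
  have "{(b, c). b \<in> {a} \<and> c \<in> C \<and> c < b} = Pair a ` {c \<in> C. c < a}"
    "{(b, c). b \<in> B \<and> c \<in> {a} \<and> c < b} = (\<lambda>b. (b, a)) ` {b \<in> B. a < b}" by auto
  then show "invs {a} C = card {c \<in> C. c < a}" "invs B {a} = card {b \<in> B. a < b}"
    unfolding invs_def by (simp_all add: card_image inj_on_def)
qed

lemma invs_insert_left:
  "finite B \<Longrightarrow> finite C \<Longrightarrow> a \<notin> B \<Longrightarrow> invs (insert a B) C = card {c \<in> C. c < a} + invs B C"
  using invs_Un_left[of "{a}" B C] by (simp add: invs_singleton)

lemma invs_insert_right:
  "finite B \<Longrightarrow> finite C \<Longrightarrow> a \<notin> C \<Longrightarrow> invs B (insert a C) = card {b \<in> B. a < b} + invs B C"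
  using invs_Un_right[of B "{a}" C] by (simp add: invs_singleton)

lemma invs_empty [simp]: "invs {} C = 0" "invs B {} = 0"
  by (simp_all add: invs_def)

text \<open>Each pair from disjoint sets is an inversion in exactly one of the two orders. This is
  the origin of the sign in graded commutativity.\<close>

lemma invs_swap:
  assumes "finite B" "finite C" "B \<inter> C = {}"
  shows "invs B C + invs C B = card B * card C"
  using assms
proof (induction B rule: finite_induct)
  case (insert a B)
  have "{c \<in> C. c < a} \<union> {c \<in> C. a < c} = C"
    using insert by (auto simp: not_less_iff_gr_or_eq dest: nat_neq_iff[THEN iffD1])
  moreover have "card ({c \<in> C. c < a} \<union> {c \<in> C. a < c}) = card {c \<in> C. c < a} + card {c \<in> C. a < c}"
    using insert by (intro card_Un_disjoint) auto
  ultimately show ?case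
    using insert by (simp add: invs_insert_left invs_insert_right)
qed simp

lemma smul_apply: "(f \<star> g) A x = (\<Sum>B\<in>Pow A. (- 1) ^ invs B (A - B) * f B x * g (A - B) x)"
  by (simp add: smul_def invs_def)

lemma smul_apply_infinite: "infinite A \<Longrightarrow> (f \<star> g) A x = 0"
  by (simp add: smul_apply)

definition sone :: sfun where
  "sone = (\<lambda>A x. if A = {} then 1 else 0)"

lemma sfun_eqI: "(\<And>A x. f A x = g A x) \<Longrightarrow> f = (g :: sfun)"
  by (simp add: fun_eq_iff)

lemma sscale_apply [simp]: "(r *\<^sub>s f) A x = r * f A x"
  by (simp add: sscale_def)

interpretation sscale: vector_space sscale
  by unfold_locales (auto intro!: sfun_eqI simp: algebra_simps)

lemma smul_add_left: "(f + g) \<star> h = f \<star> h + g \<star> h"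
  by (rule sfun_eqI) (simp add: smul_apply algebra_simps sum.distrib)

lemma smul_add_right: "f \<star> (g + h) = f \<star> g + f \<star> h"
  by (rule sfun_eqI) (simp add: smul_apply algebra_simps sum.distrib)

lemma smul_scale_left [simp]: "(r *\<^sub>s f) \<star> g = r *\<^sub>s (f \<star> g)"
  by (rule sfun_eqI) (simp add: smul_apply sum_distrib_left ac_simps)

lemma smul_scale_right [simp]: "f \<star> (r *\<^sub>s g) = r *\<^sub>s (f \<star> g)"
  by (rule sfun_eqI) (simp add: smul_apply sum_distrib_left ac_simps)

lemma smul_zero_left [simp]: "0 \<star> f = 0"
  by (rule sfun_eqI) (simp add: smul_apply)

lemma smul_zero_right [simp]: "f \<star> 0 = 0"
  by (rule sfun_eqI) (simp add: smul_apply)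

lemma smul_minus_left [simp]: "(- f) \<star> g = - (f \<star> g)"
  by (rule sfun_eqI) (simp add: smul_apply sum_negf)

lemma smul_minus_right [simp]: "f \<star> (- g) = - (f \<star> g)"
  by (rule sfun_eqI) (simp add: smul_apply sum_negf)

lemma smul_diff_left: "(f - g) \<star> h = f \<star> h - g \<star> h"
  using smul_add_left[of f "- g" h] by simp

lemma smul_sum_left: "(\<Sum>i\<in>I. f i) \<star> g = (\<Sum>i\<in>I. f i \<star> g)"
  by (induction I rule: infinite_finite_induct) (simp_all add: smul_add_left del: plus_fun_apply zero_fun_apply)

lemma smul_sum_right: "g \<star> (\<Sum>i\<in>I. f i) = (\<Sum>i\<in>I. g \<star> f i)"
  by (induction I rule: infinite_finite_induct) (simp_all add: smul_add_right del: plus_fun_apply zero_fun_apply)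

text \<open>Both sides are the sum over all splittings of \<open>A\<close> into three ordered
  blocks; \<open>F B C\<close> is the contribution of the blocks \<open>B\<close>, \<open>C\<close>
  and the rest, its exponent counting the inversions between each two blocks.\<close>

lemma smul_assoc: "(f \<star> g) \<star> h = f \<star> (g \<star> h)"
proof (rule sfun_eqI)
  fix A x
  show "((f \<star> g) \<star> h) A x = (f \<star> (g \<star> h)) A x"
  proof (cases "finite A")
    case True
    define F where "F B C = (- 1) ^ (invs B C + invs B (A - (B \<union> C)) + invs C (A - (B \<union> C)))
      * f B x * g C x * h (A - (B \<union> C)) x" for B C
    have "((f \<star> g) \<star> h) A x = (\<Sum>E\<in>Pow A. \<Sum>B\<in>Pow E. F B (E - B))"
      unfolding smul_apply sum_distrib_left sum_distrib_right
    proof (intro sum.cong refl)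
      fix E B assume *: "E \<in> Pow A" "B \<in> Pow E"
      then have "invs E (A - E) = invs B (A - E) + invs (E - B) (A - E)"
        using invs_Un_left[of B "E - B" "A - E"] True finite_subset[of E A] finite_subset[of B E]
        by (auto simp: Un_absorb1)
      moreover have "B \<union> (E - B) = E" using * by auto
      ultimately show "(- 1) ^ invs E (A - E) * ((- 1) ^ invs B (E - B) * f B x * g (E - B) x) * h (A - E) x = F B (E - B)"
        unfolding F_def by (simp add: power_add)
    qed
    also have "\<dots> = (\<Sum>(E, B)\<in>Sigma (Pow A) Pow. F B (E - B))"
      using True by (subst sum.Sigma) (auto intro: finite_subset)
    \<comment> \<open>A union of the first two blocks with its first block is the same datum as the
      two blocks themselves.\<close>
    also have "\<dots> = (\<Sum>(B, C)\<in>Sigma (Pow A) (\<lambda>B. Pow (A - B)). F B C)"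
      by (rule sum.reindex_bij_witness[of _ "\<lambda>(B, C). (B \<union> C, B)" "\<lambda>(E, B). (B, E - B)"]) auto
    also have "\<dots> = (\<Sum>B\<in>Pow A. \<Sum>C\<in>Pow (A - B). F B C)"
      using True by (subst sum.Sigma) auto
    also have "\<dots> = (f \<star> (g \<star> h)) A x"
      unfolding smul_apply sum_distrib_left sum_distrib_right
    proof (intro sum.cong refl)
      fix B C assume *: "B \<in> Pow A" "C \<in> Pow (A - B)"
      then have "invs B (A - B) = invs B C + invs B (A - B - C)"
        using invs_Un_right[of B C "A - B - C"] True finite_subset[of B A] finite_subset[of C A]
        by (auto simp: Un_absorb1)
      moreover have "A - (B \<union> C) = A - B - C" by auto
      ultimately show "F B C = (- 1) ^ invs B (A - B) * f B x * ((- 1) ^ invs C (A - B - C) * g C x * h (A - B - C) x)"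
        unfolding F_def by (simp add: power_add)
    qed
    finally show ?thesis .
  qed (simp add: smul_apply_infinite)
qed

lemma has_parity_iff: "has_parity \<epsilon> f \<longleftrightarrow> (\<forall>A. of_nat (card A) \<noteq> \<epsilon> \<longrightarrow> f A = 0)"
  unfolding has_parity_def spart_def fun_eq_iff[of _ f] by auto

text \<open>Passing to complements exchanges the two factors, and \<open>invs_swap\<close> compares
  the signs: the quotient is governed by the product of the cardinalities, whose parity is
  \<open>a * b\<close> wherever both coefficients are nonzero.\<close>

lemma smul_commute:
  assumes "has_parity a f" "has_parity b g"
  shows "g \<star> f = ksgn (a * b) *\<^sub>s (f \<star> g)"
proof (rule sfun_eqI)
  fix A :: "nat set" and x
  show "(g \<star> f) A x = (ksgn (a * b) *\<^sub>s (f \<star> g)) A x"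
  proof (cases "finite A")
    case True
    have "(g \<star> f) A x = (\<Sum>B\<in>Pow A. (- 1) ^ invs (A - B) B * g (A - B) x * f B x)"
      unfolding smul_apply
      by (rule sum.reindex_bij_witness[of _ "\<lambda>B. A - B" "\<lambda>B. A - B"]) (auto simp: double_diff)
    also have "\<dots> = (\<Sum>B\<in>Pow A. ksgn (a * b) * ((- 1) ^ invs B (A - B) * f B x * g (A - B) x))"
    proof (rule sum.cong[OF refl])
      fix B assume B: "B \<in> Pow A"
      show "(- 1) ^ invs (A - B) B * g (A - B) x * f B x = ksgn (a * b) * ((- 1) ^ invs B (A - B) * f B x * g (A - B) x)"
      proof (cases "of_nat (card B) = a \<and> of_nat (card (A - B)) = b")
        case ab: True
        have "invs B (A - B) + invs (A - B) B = card B * card (A - B)"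
          using B True by (intro invs_swap) (auto intro: finite_subset)
        then have "ksgn (a * b) = (- 1) ^ (invs B (A - B) + invs (A - B) B)"
          using ab by (metis ksgn_of_nat of_nat_mult)
        also have "\<dots> * (- 1) ^ invs B (A - B) = (- 1) ^ invs (A - B) B"
          by (simp add: power_add)
        finally show ?thesis by simp
      next
        case False
        then have "f B x = 0 \<or> g (A - B) x = 0"
          using assms unfolding has_parity_iff by auto
        then show ?thesis by auto
      qed
    qed
    finally show ?thesis by (simp add: smul_apply sum_distrib_left)
  qed (simp add: smul_apply_infinite)
qed

lemma has_parity_zero [simp, intro]: "has_parity a 0"
  by (simp add: has_parity_iff)

lemma has_parity_add: "has_parity a f \<Longrightarrow> has_parity a g \<Longrightarrow> has_parity a (f + g)"
  by (simp add: has_parity_iff)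

lemma has_parity_scale: "has_parity a f \<Longrightarrow> has_parity a (r *\<^sub>s f)"
  by (simp add: has_parity_iff sscale_def zero_fun_def)

lemma has_parity_minus: "has_parity a f \<Longrightarrow> has_parity a (- f)"
  by (simp add: has_parity_iff)

lemma has_parity_diff: "has_parity a f \<Longrightarrow> has_parity a g \<Longrightarrow> has_parity a (f - g)"
  by (simp add: has_parity_iff)

lemma has_parity_sum: "(\<And>i. i \<in> I \<Longrightarrow> has_parity a (f i)) \<Longrightarrow> has_parity a (\<Sum>i\<in>I. f i)"
  by (induction I rule: infinite_finite_induct) (auto intro: has_parity_add)

lemma has_parity_mult:
  assumes "has_parity a f" "has_parity b g"
  shows "has_parity (a + b) (f \<star> g)"
  unfolding has_parity_iff
proof (intro allI impI ext)
  fix A :: "nat set" and x assume A: "of_nat (card A) \<noteq> a + b"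
  show "(f \<star> g) A x = 0 x"
  proof (cases "finite A")
    case True
    have "f B x * g (A - B) x = 0" if "B \<in> Pow A" for B
    proof -
      have "card A = card B + card (A - B)"
        using that True by (metis PowD card_Diff_subset card_mono finite_subset le_add_diff_inverse)
      then have "of_nat (card B) \<noteq> a \<or> of_nat (card (A - B)) \<noteq> b"
        using A by auto
      then show ?thesis using assms unfolding has_parity_iff by auto
    qed
    then have "(- 1) ^ invs B (A - B) * f B x * g (A - B) x = 0" if "B \<in> Pow A" for B
      using that by (simp only: mult.assoc mult_zero_right)
    then show ?thesis unfolding smul_apply by (subst sum.neutral) auto
  qed (simp add: smul_apply_infinite)
qed

lemma has_parity_spart: "has_parity a (spart a f)"
  by (simp add: has_parity_iff spart_def)

lemma spart_sum: "f = spart 0 f + spart 1 f"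
proof
  fix A show "f A = (spart 0 f + spart 1 f) A"
    by (cases "of_nat (card A) :: bit") (simp_all add: spart_def)
qed

lemma spart_eq: "has_parity a f \<Longrightarrow> spart a f = f"
  by (simp add: has_parity_def)

lemma spart_eq_zero: "has_parity a f \<Longrightarrow> a \<noteq> b \<Longrightarrow> spart b f = 0"
  by (auto simp: has_parity_iff spart_def fun_eq_iff)

lemma spart_add: "spart a (f + g) = spart a f + spart a g"
  by (auto simp: spart_def fun_eq_iff)

lemma spart_scale: "spart a (r *\<^sub>s f) = r *\<^sub>s spart a f"
  by (auto simp: spart_def fun_eq_iff)

lemma has_parity_sone: "has_parity 0 sone"
  by (auto simp: has_parity_iff sone_def fun_eq_iff)

lemma has_parity_coord: "has_parity (q c) (coord q c)"
  by (cases "q c") (auto simp: has_parity_iff coord_def fun_eq_iff)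

section \<open>Closure of smooth functions on a superdomain under the algebra operations\<close>

lemma Cinf_iff: "f \<in> Cinf N q \<longleftrightarrow>
    (\<forall>A. \<not> A \<subseteq> odd_coords N q \<longrightarrow> f A = 0) \<and> (\<forall>A. smooth_in (even_coords N q) (f A))"
  by (simp add: Cinf_def)

lemma Cinf_zero [simp, intro]: "0 \<in> Cinf N q"
  by (simp add: Cinf_iff smooth_in_zero)

lemma Cinf_add: "f \<in> Cinf N q \<Longrightarrow> g \<in> Cinf N q \<Longrightarrow> f + g \<in> Cinf N q"
  by (simp add: Cinf_iff smooth_in_add)

lemma Cinf_scale: "f \<in> Cinf N q \<Longrightarrow> r *\<^sub>s f \<in> Cinf N q"
  by (simp add: Cinf_iff smooth_in_cmult sscale_def zero_fun_def)

lemma Cinf_minus: "f \<in> Cinf N q \<Longrightarrow> - f \<in> Cinf N q"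
  using Cinf_scale[of f N q "- 1"] by simp

lemma Cinf_diff: "f \<in> Cinf N q \<Longrightarrow> g \<in> Cinf N q \<Longrightarrow> f - g \<in> Cinf N q"
  using Cinf_add[of f N q "- g"] by (simp add: Cinf_minus)

lemma Cinf_sum: "(\<And>i. i \<in> I \<Longrightarrow> f i \<in> Cinf N q) \<Longrightarrow> (\<Sum>i\<in>I. f i) \<in> Cinf N q"
  by (induction I rule: infinite_finite_induct) (auto intro: Cinf_add)

lemma Cinf_sone: "sone \<in> Cinf N q"
  by (auto simp: Cinf_iff sone_def fun_eq_iff intro: smooth_in_const)

lemma Cinf_coord: "c < N \<Longrightarrow> coord q c \<in> Cinf N q"
proof (cases "q c")
  case zero
  assume "c < N"
  then have "smooth_in (even_coords N q) (\<lambda>x. x c)" using zero by (simp add: smooth_in_coord even_coords_def)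
  then have "smooth_in (even_coords N q) (coord q c A)" for A
    using zero by (cases "A = {}") (simp_all add: coord_def smooth_in_const)
  then show ?thesis using zero by (auto simp: Cinf_iff coord_def fun_eq_iff)
qed (auto simp: Cinf_iff coord_def fun_eq_iff odd_coords_def intro: smooth_in_const)

lemma Cinf_spart: "f \<in> Cinf N q \<Longrightarrow> spart a f \<in> Cinf N q"
  by (auto simp: Cinf_iff spart_def smooth_in_zero)

lemma sum_fun_apply: "(\<Sum>i\<in>I. f i) x = (\<Sum>i\<in>I. f i x)"
  by (induction I rule: infinite_finite_induct) auto

lemma smul_summands:
  "(f \<star> g) A = (\<Sum>B\<in>Pow A. (\<lambda>x. (- 1) ^ invs B (A - B) * (f B * g (A - B)) x))"
  by (rule ext) (simp add: smul_apply sum_fun_apply mult.assoc)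

lemma Cinf_mult:
  assumes "f \<in> Cinf N q" "g \<in> Cinf N q"
  shows "f \<star> g \<in> Cinf N q"
  unfolding Cinf_iff
proof (intro conjI allI impI)
  fix A
  show "smooth_in (even_coords N q) ((f \<star> g) A)"
    unfolding smul_summands
    using assms by (intro smooth_in_sum smooth_in_cmult smooth_in_mult) (auto simp: Cinf_iff)
  assume A: "\<not> A \<subseteq> odd_coords N q"
  have "f B * g (A - B) = 0" if "B \<in> Pow A" for B
  proof -
    have "\<not> B \<subseteq> odd_coords N q \<or> \<not> A - B \<subseteq> odd_coords N q" using A by auto
    then have "f B = 0 \<or> g (A - B) = 0" using assms unfolding Cinf_iff by blast
    then show ?thesis by (auto simp: fun_eq_iff)
  qed
  then show "(f \<star> g) A = 0"
    unfolding smul_summands by (intro sum.neutral) (auto simp: zero_fun_def)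
qed

lemma Cinf_apply_infinite: "f \<in> Cinf N q \<Longrightarrow> infinite A \<Longrightarrow> f A = 0"
  unfolding Cinf_iff odd_coords_def
  by (metis (no_types, lifting) bounded_nat_set_is_finite mem_Collect_eq subsetD)

text \<open>Membership in \<open>Cinf\<close> matters: a product is zero on every infinite index
  set, so \<open>sone\<close> can be a unit only for functions that vanish there.\<close>

lemma smul_sone_right [simp]: "f \<in> Cinf N q \<Longrightarrow> f \<star> sone = f"
proof (rule sfun_eqI)
  fix A x assume f: "f \<in> Cinf N q"
  show "(f \<star> sone) A x = f A x"
  proof (cases "finite A")
    case True
    have "(f \<star> sone) A x = (\<Sum>B\<in>Pow A. if B = A then f A x else 0)"
      unfolding smul_apply sone_def by (rule sum.cong) auto
    then show ?thesis using True by simp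
  qed (use f Cinf_apply_infinite in \<open>simp add: smul_apply_infinite\<close>)
qed

lemma smul_sone_left [simp]: "f \<in> Cinf N q \<Longrightarrow> sone \<star> f = f"
proof (rule sfun_eqI)
  fix A x assume f: "f \<in> Cinf N q"
  show "(sone \<star> f) A x = f A x"
  proof (cases "finite A")
    case True
    have "(sone \<star> f) A x = (\<Sum>B\<in>Pow A. if B = {} then f A x else 0)"
      unfolding smul_apply sone_def by (rule sum.cong) auto
    then show ?thesis using True by simp
  qed (use f Cinf_apply_infinite in \<open>simp add: smul_apply_infinite\<close>)
qed

subsection \<open>Partial derivatives\<close>

lemma sderiv_even: "q c = 0 \<Longrightarrow> sderiv q c f A = pd c (f A)"
  by (simp add: sderiv_def)

lemma sderiv_odd: "q c = 1 \<Longrightarrow>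
    sderiv q c f A x = (if c \<in> A then 0 else (- 1) ^ card {a \<in> A. a < c} * f (insert c A) x)"
  by (simp add: sderiv_def)

lemma Cinf_sderiv:
  assumes "f \<in> Cinf N q" "c < N"
  shows "sderiv q c f \<in> Cinf N q"
proof (cases "q c")
  case zero
  then show ?thesis using assms
    by (auto simp: Cinf_iff sderiv_even even_coords_def intro!: smooth_in_pd)
next
  case one
  have "sderiv q c f A = (\<lambda>x. (if c \<in> A then 0 else (- 1) ^ card {a \<in> A. a < c}) * f (insert c A) x)" for A
    using one by (auto simp: sderiv_odd)
  then show ?thesis using assms
    by (auto simp: Cinf_iff zero_fun_def intro!: smooth_in_cmult smooth_in_const)
qed

lemma sderiv_add: "f \<in> Cinf N q \<Longrightarrow> g \<in> Cinf N q \<Longrightarrow> c < N \<Longrightarrow>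
    sderiv q c (f + g) = sderiv q c f + sderiv q c g"
proof (cases "q c")
  case zero
  assume "f \<in> Cinf N q" "g \<in> Cinf N q" "c < N"
  then have "pd c (f A + g A) = pd c (f A) + pd c (g A)" for A
    using zero by (intro pd_add[of "even_coords N q"]) (auto simp: Cinf_iff even_coords_def)
  then show ?thesis using zero by (simp add: sderiv_def plus_fun_def)
qed (auto simp: sderiv_odd algebra_simps intro!: sfun_eqI)

lemma sderiv_scale: "f \<in> Cinf N q \<Longrightarrow> c < N \<Longrightarrow> sderiv q c (r *\<^sub>s f) = r *\<^sub>s sderiv q c f"
proof (cases "q c")
  case zero
  assume "f \<in> Cinf N q" "c < N"
  then have "pd c (\<lambda>x. r * f A x) = (\<lambda>x. r * pd c (f A) x)" for A
    using zero by (intro pd_cmult[of "even_coords N q"]) (auto simp: Cinf_iff even_coords_def)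
  then show ?thesis using zero by (simp add: sscale_def sderiv_def)
qed (auto simp: sderiv_odd intro!: sfun_eqI)

lemma sderiv_zero [simp]: "sderiv q c 0 = 0"
  by (cases "q c") (auto simp: sderiv_even sderiv_odd fun_eq_iff)

lemma sderiv_sum: "(\<And>i. i \<in> I \<Longrightarrow> f i \<in> Cinf N q) \<Longrightarrow> c < N \<Longrightarrow>
    sderiv q c (\<Sum>i\<in>I. f i) = (\<Sum>i\<in>I. sderiv q c (f i))"
  by (induction I rule: infinite_finite_induct) (auto simp: sderiv_add[of _ N] Cinf_sum)

lemma sderiv_sone [simp]: "sderiv q c sone = 0"
proof (cases "q c")
  case zero
  have "pd c (sone A) = 0" for A
    using pd_const[of c "if A = {} then 1 else 0"] by (simp add: sone_def)
  then show ?thesis using zero by (simp add: sderiv_def zero_fun_def)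
qed (auto simp: sderiv_odd sone_def intro!: sfun_eqI)

lemma sderiv_coord: "sderiv q c (coord q d) = (if c = d then sone else 0)"
proof (cases "q c")
  case c: zero
  show ?thesis
  proof (cases "q d")
    case zero
    have "pd c (coord q d A) = (\<lambda>x. if A = {} \<and> c = d then 1 else 0)" for A
      using zero pd_coord[of c d] pd_const[of c 0] by (cases "A = {}") (simp_all add: coord_def zero_fun_def)
    then show ?thesis using c by (auto simp: sderiv_def sone_def fun_eq_iff)
  next
    case one
    have "pd c (coord q d A) = 0" for A
      using one pd_const[of c "if A = {d} then 1 else 0"] by (simp add: coord_def)
    then show ?thesis using c one by (auto simp: sderiv_def fun_eq_iff)
  qed
qed (auto simp: sderiv_odd coord_def sone_def intro!: sfun_eqI)

lemma has_parity_sderiv: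
  assumes "has_parity a f" "f \<in> Cinf N q"
  shows "has_parity (a + q c) (sderiv q c f)"
  unfolding has_parity_iff
proof (intro allI impI)
  fix A :: "nat set" assume A: "of_nat (card A) \<noteq> a + q c"
  show "sderiv q c f A = 0"
  proof (cases "q c")
    case zero
    then show ?thesis using A assms by (simp add: has_parity_iff sderiv_even)
  next
    case one
    have "f (insert c A) = 0" if "c \<notin> A"
    proof (cases "finite A")
      case True
      then have "of_nat (card (insert c A)) = (1 + of_nat (card A) :: bit)" using that by simp
      then have "of_nat (card (insert c A)) \<noteq> a" using A one by (cases a; cases "of_nat (card A) :: bit") auto
      then show ?thesis using assms(1) by (simp add: has_parity_iff)
    qed (use assms(2) Cinf_apply_infinite in auto)
    then show ?thesis using one by (auto simp: sderiv_odd fun_eq_iff)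
  qed
qed

lemma sign_greater:
  assumes "finite B" "c \<notin> B"
  shows "(- 1 :: real) ^ card {b \<in> B. c < b} = (- 1) ^ card B * (- 1) ^ card {b \<in> B. b < (c::nat)}"
proof -
  have "B = {b \<in> B. b < c} \<union> {b \<in> B. c < b}"
    using assms by (auto simp: not_less_iff_gr_or_eq)
  moreover have "card ({b \<in> B. b < c} \<union> {b \<in> B. c < b}) = card {b \<in> B. b < c} + card {b \<in> B. c < b}"
    using assms by (intro card_Un_disjoint) auto
  ultimately have "card B = card {b \<in> B. b < c} + card {b \<in> B. c < b}"
    by simp
  then show ?thesis by (simp add: power_add)
qed

text \<open>For even \<open>c\<close> this is the product rule for each coefficient. For odd
  \<open>c\<close> it is a comparison of inversion counts: the derivative removes \<open>c\<close>
  from either factor, and reaching the second one costs the sign for passing all of the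
  first.\<close>

lemma sderiv_mult:
  assumes "has_parity a f" "f \<in> Cinf N q" "g \<in> Cinf N q" "c < N"
  shows "sderiv q c (f \<star> g) = sderiv q c f \<star> g + ksgn (q c * a) *\<^sub>s (f \<star> sderiv q c g)"
proof (cases "q c")
  case zero
  then have c: "c \<in> even_coords N q" using assms by (simp add: even_coords_def)
  have sm: "smooth_in (even_coords N q) (f A)" "smooth_in (even_coords N q) (g A)" for A
    using assms by (auto simp: Cinf_iff)
  show ?thesis
  proof (rule sfun_eqI)
    fix A x
    have "sderiv q c (f \<star> g) A x =
      (\<Sum>B\<in>Pow A. (- 1) ^ invs B (A - B) * (pd c (f B) * g (A - B) + f B * pd c (g (A - B))) x)"
      unfolding sderiv_even[of q c, OF zero] smul_summands
      by (subst pd_sum[OF _ c]) (simp_all add: smooth_in_cmult smooth_in_mult sm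
          pd_cmult[OF smooth_in_mult[OF sm] c] pd_mult[OF sm c] sum_fun_apply del: times_fun_apply plus_fun_apply)
    then show "sderiv q c (f \<star> g) A x = (sderiv q c f \<star> g + ksgn (q c * a) *\<^sub>s (f \<star> sderiv q c g)) A x"
      using zero by (simp add: smul_apply sderiv_even algebra_simps sum.distrib)
  qed
next
  case one
  show ?thesis
  proof (rule sfun_eqI)
    fix A x
    show "sderiv q c (f \<star> g) A x = (sderiv q c f \<star> g + ksgn (q c * a) *\<^sub>s (f \<star> sderiv q c g)) A x"
    proof (cases "finite A \<and> c \<notin> A")
      case True
      define s :: "nat set \<Rightarrow> real" where "s B = (- 1) ^ card {a \<in> B. a < c}" for B
      have s: "s A = s B * s (A - B)" if "B \<subseteq> A" for B
      proof -
        have "{a \<in> A. a < c} = {a \<in> B. a < c} \<union> {a \<in> A - B. a < c}" using that by auto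
        moreover have "card ({a \<in> B. a < c} \<union> {a \<in> A - B. a < c}) = card {a \<in> B. a < c} + card {a \<in> A - B. a < c}"
          using True that by (intro card_Un_disjoint) (auto intro: finite_subset)
        ultimately show ?thesis by (simp add: s_def power_add)
      qed
      have ss: "s B * s B = 1" "s B * (s B * r) = r" for B r
        by (simp_all add: s_def flip: power_add mult.assoc)
      have "sderiv q c (f \<star> g) A x = s A * (\<Sum>B\<in>Pow (insert c A). (- 1) ^ invs B (insert c A - B) * f B x * g (insert c A - B) x)"
        using True one by (simp add: sderiv_odd smul_apply s_def)
      \<comment> \<open>The subsets of \<open>insert c A\<close> are sorted by whether
        \<open>c\<close> goes to the second or to the first factor; these are the two terms of the
        Leibniz rule.\<close>
      also have "\<dots> = s A * (\<Sum>B\<in>Pow A. (- 1) ^ invs B (insert c A - B) * f B x * g (insert c A - B) x)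
         + s A * (\<Sum>B\<in>Pow A. (- 1) ^ invs (insert c B) (insert c A - insert c B) * f (insert c B) x * g (insert c A - insert c B) x)"
      proof -
        have "Pow A \<inter> insert c ` Pow A = {}" "inj_on (insert c) (Pow A)"
          using True by (auto simp: inj_on_def)
        then show ?thesis
          using True by (simp add: Pow_insert sum.union_disjoint sum.reindex algebra_simps)
      qed
      also have "s A * (\<Sum>B\<in>Pow A. (- 1) ^ invs (insert c B) (insert c A - insert c B) * f (insert c B) x * g (insert c A - insert c B) x)
          = (sderiv q c f \<star> g) A x"
        unfolding smul_apply sum_distrib_left
      proof (rule sum.cong[OF refl])
        fix B assume B: "B \<in> Pow A"
        have B': "insert c A - insert c B = A - B" "c \<notin> B" "finite B" using True B by (auto intro: finite_subset)
        show "s A * ((- 1) ^ invs (insert c B) (insert c A - insert c B) * f (insert c B) x * g (insert c A - insert c B) x)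
           = (- 1) ^ invs B (A - B) * sderiv q c f B x * g (A - B) x"
        proof -
          have "(- 1) ^ invs (insert c B) (A - B) = s (A - B) * (- 1) ^ invs B (A - B)"
            unfolding s_def using True B' by (subst invs_insert_left) (auto simp: power_add)
          moreover have "sderiv q c f B x = s B * f (insert c B) x"
            using one B'(2) by (simp add: sderiv_odd s_def)
          ultimately show ?thesis
            using B s[of B] ss B'(1) by (simp add: ac_simps)
        qed
      qed
      also have "s A * (\<Sum>B\<in>Pow A. (- 1) ^ invs B (insert c A - B) * f B x * g (insert c A - B) x)
          = (ksgn (q c * a) *\<^sub>s (f \<star> sderiv q c g)) A x"
        unfolding sscale_apply smul_apply sum_distrib_left
      proof (rule sum.cong[OF refl])
        fix B assume B: "B \<in> Pow A"
        then have B': "insert c A - B = insert c (A - B)" "c \<notin> B" "finite B" using True by (auto intro: finite_subset)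
        show "s A * ((- 1) ^ invs B (insert c A - B) * f B x * g (insert c A - B) x)
           = ksgn (q c * a) * ((- 1) ^ invs B (A - B) * f B x * sderiv q c g (A - B) x)"
        \<comment> \<open>Only sets \<open>B\<close> of parity \<open>a\<close> carry a nonzero
          coefficient of \<open>f\<close>, and for them the sign of passing all of \<open>B\<close>
          is \<open>ksgn a\<close>.\<close>
        proof (cases "of_nat (card B) = a")
          case a: True
          have "(- 1) ^ card {b \<in> B. c < b} = ksgn a * s B"
            using sign_greater[of B c] B' a ksgn_of_nat[of "card B"] by (simp add: s_def)
          then have "(- 1) ^ invs B (insert c A - B) = ksgn a * s B * (- 1) ^ invs B (A - B)"
            unfolding B'(1) using True B' by (subst invs_insert_right) (auto simp: power_add)
          moreover have "sderiv q c g (A - B) x = s (A - B) * g (insert c A - B) x"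
            unfolding B'(1) using one True by (simp add: sderiv_odd s_def)
          moreover have "s A * s B = s (A - B)"
            using B s[of B] ss by (simp add: mult.commute mult.left_commute)
          ultimately show ?thesis
            using one by (simp add: ac_simps)
        next
          case False
          then have "f B x = 0" using assms(1) by (simp add: has_parity_iff)
          then show ?thesis by simp
        qed
      qed
      finally show ?thesis by simp
    next
      case False
      show ?thesis
      proof (cases "finite A")
        case True
        \<comment> \<open>If \<open>c\<close> lies in \<open>A\<close>, the left side vanishes, so
          the two terms on the right have to cancel. In the first term \<open>c\<close> must belong
          to the second factor, in the second term to the first factor; both are indexed by subsets
          of \<open>A'\<close> and cancel one by one.\<close>
        define A' where "A' = A - {c}"
        have A: "A = insert c A'" "c \<notin> A'" "finite A'" using True False by (auto simp: A'_def)
        have inj: "Pow A' \<inter> insert c ` Pow A' = {}" "inj_on (insert c) (Pow A')"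
          using A by (auto simp: inj_on_def)
        have z: "sderiv q c h B x = 0" if "c \<in> B" for h B using one that by (simp add: sderiv_odd)
        have e1: "(sderiv q c f \<star> g) A x = (\<Sum>B\<in>Pow A'. (- 1) ^ invs B (A - B) * sderiv q c f B x * g (A - B) x)"
          unfolding smul_apply using A inj
          by (simp add: A(1) Pow_insert sum.union_disjoint sum.reindex z)
        have e2: "(f \<star> sderiv q c g) A x =
            (\<Sum>B\<in>Pow A'. (- 1) ^ invs (insert c B) (A - insert c B) * f (insert c B) x * sderiv q c g (A - insert c B) x)"
        proof -
          have "sderiv q c g (A - B) x = 0" if "B \<in> Pow A'" for B
            using that A by (intro z) auto
          then show ?thesis
            unfolding smul_apply using A inj
            by (simp add: A(1) Pow_insert sum.union_disjoint sum.reindex)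
        qed
        have e3: "(- 1) ^ invs B (A - B) * sderiv q c f B x * g (A - B) x + ksgn (q c * a) *
            ((- 1) ^ invs (insert c B) (A - insert c B) * f (insert c B) x * sderiv q c g (A - insert c B) x) = 0"
          if B: "B \<in> Pow A'" for B
        proof (cases "of_nat (card (insert c B)) = a")
          case a: True
          have B': "A - insert c B = A' - B" "A - B = insert c (A' - B)" "c \<notin> B" "finite B"
            using A B by (auto intro: finite_subset)
          have "ksgn a = - ((- 1) ^ card B)"
            using a ksgn_of_nat[of "card (insert c B)"] B' by simp
          then show ?thesis
            using B' A one sign_greater[of B c]
            by (simp add: invs_insert_left invs_insert_right sderiv_odd power_add ac_simps)
        next
          case False
          then have "f (insert c B) x = 0" using assms(1) by (simp add: has_parity_iff)
          then show ?thesis using one by (simp add: sderiv_odd)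
        qed
        have "(sderiv q c f \<star> g) A x + ksgn (q c * a) * (f \<star> sderiv q c g) A x = 0"
          unfolding e1 e2 sum_distrib_left sum.distrib[symmetric] by (rule sum.neutral) (use e3 in blast)
        then show ?thesis using False True z[of A "f \<star> g"] by simp
      qed (simp add: smul_apply_infinite sderiv_odd one)
    qed
  qed
qed

text \<open>Inserting the smaller of \<open>c\<close> and \<open>d\<close> raises by one the count
  below the larger, while inserting the larger leaves the count below the smaller unchanged; hence
  the single minus sign.\<close>

lemma odd_derivative_sign:
  assumes "c \<noteq> d" "finite A" "c \<notin> A" "d \<notin> A"
  shows "(- 1 :: real) ^ card {a \<in> insert c A. a < d} * (- 1) ^ card {a \<in> A. a < (c::nat)} =
    - ((- 1) ^ card {a \<in> insert d A. a < c} * (- 1) ^ card {a \<in> A. a < d})"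
proof (cases "c < d")
  case True
  then have "{a \<in> insert c A. a < d} = insert c {a \<in> A. a < d}" "{a \<in> insert d A. a < c} = {a \<in> A. a < c}"
    by auto
  then show ?thesis using assms by simp
next
  case False
  then have "{a \<in> insert c A. a < d} = {a \<in> A. a < d}" "{a \<in> insert d A. a < c} = insert d {a \<in> A. a < c}"
    using assms by auto
  then show ?thesis using assms by simp
qed

text \<open>Two even derivatives commute by the theorem of Schwarz. An odd derivative only selects a
  coefficient up to a constant sign, so it commutes with even ones; two odd derivatives anticommute,
  and the square of one is zero.\<close>

lemma sderiv_commute:
  assumes "f \<in> Cinf N q" "c < N" "d < N"
  shows "sderiv q c (sderiv q d f) = ksgn (q c * q d) *\<^sub>s sderiv q d (sderiv q c f)"
proof -
  have sm: "smooth_in (even_coords N q) (f A)" for A using assms by (simp add: Cinf_iff)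
  have mixed: "sderiv q c (sderiv q d f) = sderiv q d (sderiv q c f)"
    if "q c = 0" "q d = 1" "c < N" for c d
  proof (rule sfun_eqI)
    fix A x
    have c: "c \<in> even_coords N q" using that by (simp add: even_coords_def)
    have "sderiv q d f A = (\<lambda>x. (if d \<in> A then 0 else (- 1) ^ card {a \<in> A. a < d}) * f (insert d A) x)"
      using that by (auto simp: sderiv_odd)
    then show "sderiv q c (sderiv q d f) A x = sderiv q d (sderiv q c f) A x"
      using that by (simp add: sderiv_even sderiv_odd pd_cmult[OF sm c])
  qed
  consider "q c = 0" "q d = 0" | "q c = 0" "q d = 1" | "q c = 1" "q d = 0" | "q c = 1" "q d = 1" "c = d"
    | "q c = 1" "q d = 1" "c \<noteq> d"
    by (cases "q c"; cases "q d") auto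
  then show ?thesis
  proof cases
    case 1
    then show ?thesis using assms pd_commute[OF sm, of c d]
      by (auto simp: sderiv_even even_coords_def intro!: ext[of "sderiv q c (sderiv q d f)"] sfun_eqI)
  next
    case 4
    then show ?thesis by (auto intro!: sfun_eqI simp: sderiv_odd)
  next
    case 5
    show ?thesis
    proof (rule sfun_eqI)
      fix A x
      show "sderiv q c (sderiv q d f) A x = (ksgn (q c * q d) *\<^sub>s sderiv q d (sderiv q c f)) A x"
      proof (cases "finite A")
        case True
        then show ?thesis
          using 5 odd_derivative_sign[of d c A]
          by (cases "c \<in> A"; cases "d \<in> A")
            (simp_all add: sderiv_odd insert_commute[of d c A] flip: mult.assoc, simp add: ac_simps)
      next
        case False
        then show ?thesis
          using 5 Cinf_apply_infinite[OF assms(1)] by (simp add: sderiv_odd)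
      qed
    qed
  qed (use mixed[of c d] mixed[of d c] assms in simp_all)
qed

text \<open>From here on functions are elements of an algebra; pointwise evaluation by the
  simplifier would break up the identities.\<close>

declare plus_fun_apply [simp del] zero_fun_apply [simp del] minus_apply [simp del] uminus_apply [simp del]
  sscale_apply [simp del]

subsection \<open>Vector fields\<close>

lemmas sscale_simps = sscale.scale_right_distrib sscale.scale_right_diff_distrib sscale.scale_sum_right

text \<open>The expansion in partial derivatives is made part of the notion, in contrast to
  \<open>odd_vector_field\<close>, which asks for a derivation. Equality of two such fields then
  needs to be checked only on coordinates; the Leibniz rule is derived in
  \<open>vfield_mult\<close>.\<close>

definition vfield :: "nat \<Rightarrow> (nat \<Rightarrow> bit) \<Rightarrow> bit \<Rightarrow> (sfun \<Rightarrow> sfun) \<Rightarrow> bool" where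
  "vfield N q a D \<longleftrightarrow>
     (\<forall>c<N. D (coord q c) \<in> Cinf N q \<and> has_parity (a + q c) (D (coord q c))) \<and>
     (\<forall>f\<in>Cinf N q. D f = (\<Sum>c<N. D (coord q c) \<star> sderiv q c f))"

lemma vector_field_coord:
  assumes "\<And>c. c < N \<Longrightarrow> v c \<in> Cinf N q" "c < N"
    and D: "\<And>f. f \<in> Cinf N q \<Longrightarrow> D f = (\<Sum>c<N. v c \<star> sderiv q c f)"
  shows "D (coord q c) = v c"
proof -
  have "D (coord q c) = (\<Sum>b<N. if b = c then v b else 0)"
    unfolding D[OF Cinf_coord[OF assms(2)]] using assms(1)
    by (intro sum.cong) (auto simp: sderiv_coord smul_sone_right[of _ N q])
  then show ?thesis using assms(2) by simp
qed

lemma vfieldI: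
  assumes "\<And>c. c < N \<Longrightarrow> v c \<in> Cinf N q" "\<And>c. c < N \<Longrightarrow> has_parity (a + q c) (v c)"
    and "\<And>f. f \<in> Cinf N q \<Longrightarrow> D f = (\<Sum>c<N. v c \<star> sderiv q c f)"
  shows "vfield N q a D" "\<And>c. c < N \<Longrightarrow> D (coord q c) = v c"
  unfolding vfield_def using assms vector_field_coord[of N v q _ D] by simp_all

context
  fixes N q a D
  assumes vf: "vfield N q a D"
begin

lemma vfield_eq: "f \<in> Cinf N q \<Longrightarrow> D f = (\<Sum>c<N. D (coord q c) \<star> sderiv q c f)"
  using vf unfolding vfield_def by blast

lemma vfield_coord: "c < N \<Longrightarrow> D (coord q c) \<in> Cinf N q" "c < N \<Longrightarrow> has_parity (a + q c) (D (coord q c))"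
  using vf unfolding vfield_def by blast+

lemma vfield_closed: "f \<in> Cinf N q \<Longrightarrow> D f \<in> Cinf N q"
  by (subst vfield_eq) (auto intro!: Cinf_sum Cinf_mult vfield_coord Cinf_sderiv)

lemma vfield_add:
  assumes "f \<in> Cinf N q" "g \<in> Cinf N q"
  shows "D (f + g) = D f + D g"
  unfolding vfield_eq[OF Cinf_add[OF assms]] vfield_eq[OF assms(1)] vfield_eq[OF assms(2)]
  using assms by (simp add: sderiv_add[of _ N] smul_add_right sum.distrib)

lemma vfield_scale:
  assumes "f \<in> Cinf N q"
  shows "D (r *\<^sub>s f) = r *\<^sub>s D f"
  unfolding vfield_eq[OF Cinf_scale[OF assms]] vfield_eq[OF assms]
  using assms by (simp add: sderiv_scale[of _ N] sscale_simps)

lemma vfield_zero [simp]: "D 0 = 0"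
  using vfield_eq[of 0] by simp

lemma vfield_minus: "f \<in> Cinf N q \<Longrightarrow> D (- f) = - D f"
  using vfield_scale[of f "- 1"] by simp

lemma vfield_diff: "f \<in> Cinf N q \<Longrightarrow> g \<in> Cinf N q \<Longrightarrow> D (f - g) = D f - D g"
  using vfield_add[of f "- g"] by (simp add: vfield_minus Cinf_minus)

lemma vfield_sum: "(\<And>i. i \<in> I \<Longrightarrow> f i \<in> Cinf N q) \<Longrightarrow> D (\<Sum>i\<in>I. f i) = (\<Sum>i\<in>I. D (f i))"
  by (induction I rule: infinite_finite_induct) (simp_all add: vfield_add Cinf_sum)

lemma vfield_sone: "D sone = 0"
  by (subst vfield_eq) (simp_all add: Cinf_sone)

lemma vfield_parity:
  assumes "f \<in> Cinf N q" "has_parity b f"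
  shows "has_parity (a + b) (D f)"
proof -
  have "has_parity ((a + q c) + (b + q c)) (D (coord q c) \<star> sderiv q c f)" if "c < N" for c
    using that assms by (intro has_parity_mult vfield_coord has_parity_sderiv)
  then show ?thesis
    unfolding vfield_eq[OF assms(1)] by (intro has_parity_sum) (simp add: ac_simps)
qed

lemma vfield_mult:
  assumes "f \<in> Cinf N q" "g \<in> Cinf N q" "has_parity b f"
  shows "D (f \<star> g) = D f \<star> g + ksgn (a * b) *\<^sub>s (f \<star> D g)"
proof -
  have "D (coord q c) \<star> sderiv q c (f \<star> g) =
      D (coord q c) \<star> sderiv q c f \<star> g + ksgn (a * b) *\<^sub>s (f \<star> (D (coord q c) \<star> sderiv q c g))" if c: "c < N" for c
  proof -
    have "f \<star> D (coord q c) = ksgn ((a + q c) * b) *\<^sub>s (D (coord q c) \<star> f)"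
      using smul_commute[OF vfield_coord(2)[OF c] assms(3)] .
    then have "f \<star> (D (coord q c) \<star> sderiv q c g) = ksgn ((a + q c) * b) *\<^sub>s (D (coord q c) \<star> (f \<star> sderiv q c g))"
      by (metis smul_assoc smul_scale_left)
    moreover have "ksgn (a * b) * ksgn ((a + q c) * b) = ksgn (q c * b)"
      by (cases a; cases b; cases "q c"; simp)
    ultimately show ?thesis
      using assms c by (simp add: sderiv_mult[of b] smul_add_right smul_assoc)
  qed
  then show ?thesis
    unfolding vfield_eq[OF Cinf_mult[OF assms(1,2)]] vfield_eq[OF assms(1)] vfield_eq[OF assms(2)]
    by (simp add: sum.distrib smul_sum_left smul_sum_right sscale_simps)
qed

end

lemma vfield_eqI:
  assumes "vfield N q a D" "vfield N q b E" "f \<in> Cinf N q"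
    and "\<And>c. c < N \<Longrightarrow> D (coord q c) = E (coord q c)"
  shows "D f = E f"
  unfolding vfield_eq[OF assms(1,3)] vfield_eq[OF assms(2,3)] using assms(4) by simp

text \<open>Composition yields second-order terms, but by the graded symmetry of second derivatives
  they are the same for both orders and cancel, leaving a first-order operator.\<close>

lemma vfield_scomm:
  assumes D: "vfield N q a D" and E: "vfield N q b E"
  shows "vfield N q (a + b) (scomm a b D E)"
proof (rule vfieldI)
  let ?v = "\<lambda>c. D (coord q c)" and ?w = "\<lambda>c. E (coord q c)"
  note closed = vfield_closed[OF D] vfield_closed[OF E]
  show "scomm a b D E (coord q c) \<in> Cinf N q" if "c < N" for c
    using that unfolding scomm_def by (intro Cinf_diff Cinf_scale closed Cinf_coord)
  show "has_parity (a + b + q c) (scomm a b D E (coord q c))" if "c < N" for c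
  proof -
    have "has_parity (a + (b + q c)) (D (E (coord q c)))" "has_parity (b + (a + q c)) (E (D (coord q c)))"
      using vfield_parity[OF D vfield_coord[OF E]] vfield_parity[OF E vfield_coord[OF D]] that by simp_all
    then show ?thesis unfolding scomm_def
      by (intro has_parity_diff has_parity_scale) (simp_all add: ac_simps)
  qed
  fix f assume f: "f \<in> Cinf N q"
  \<comment> \<open>Stated for arbitrary fields so that it applies to both orders of
    composition.\<close>
  have DE: "D (E f) = (\<Sum>c<N. D (E (coord q c)) \<star> sderiv q c f) +
      (\<Sum>c<N. \<Sum>d<N. ksgn (a * (b + q c)) *\<^sub>s (E (coord q c) \<star> (D (coord q d) \<star> sderiv q d (sderiv q c f))))"
    if D: "vfield N q a D" and E: "vfield N q b E" for D E a b
  proof -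
    have "D (E f) = (\<Sum>c<N. D (E (coord q c) \<star> sderiv q c f))"
      unfolding vfield_eq[OF E f]
      by (rule vfield_sum[OF D]) (use f in \<open>auto intro!: Cinf_mult vfield_coord[OF E] Cinf_sderiv\<close>)
    also have "\<dots> = (\<Sum>c<N. D (E (coord q c)) \<star> sderiv q c f
        + ksgn (a * (b + q c)) *\<^sub>s (E (coord q c) \<star> D (sderiv q c f)))"
      by (intro sum.cong refl vfield_mult[OF D]) (use f in \<open>auto intro!: vfield_coord[OF E] Cinf_sderiv\<close>)
    also have "\<dots> = (\<Sum>c<N. D (E (coord q c)) \<star> sderiv q c f
        + (\<Sum>d<N. ksgn (a * (b + q c)) *\<^sub>s (E (coord q c) \<star> (D (coord q d) \<star> sderiv q d (sderiv q c f)))))"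
    proof (intro sum.cong refl arg_cong2[of _ _ _ _ "(+)"])
      fix c assume "c \<in> {..<N}"
      then have "sderiv q c f \<in> Cinf N q" using f by (simp add: Cinf_sderiv)
      then show "ksgn (a * (b + q c)) *\<^sub>s (E (coord q c) \<star> D (sderiv q c f)) =
        (\<Sum>d<N. ksgn (a * (b + q c)) *\<^sub>s (E (coord q c) \<star> (D (coord q d) \<star> sderiv q d (sderiv q c f))))"
        by (simp add: vfield_eq[OF D, of "sderiv q c f"] smul_sum_right sscale_simps)
    qed
    finally show ?thesis by (simp add: sum.distrib)
  qed
  have swap: "ksgn (a * (b + q c)) *\<^sub>s (?w c \<star> (?v d \<star> sderiv q d (sderiv q c f))) =
      ksgn (a * b) *\<^sub>s ksgn (b * (a + q d)) *\<^sub>s (?v d \<star> (?w c \<star> sderiv q c (sderiv q d f)))"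
    if c: "c < N" and d: "d < N" for c d
  proof -
    have "?w c \<star> ?v d = ksgn ((a + q d) * (b + q c)) *\<^sub>s (?v d \<star> ?w c)"
      using smul_commute vfield_coord(2)[OF D d] vfield_coord(2)[OF E c] by blast
    then have "?w c \<star> (?v d \<star> sderiv q d (sderiv q c f)) =
        ksgn ((a + q d) * (b + q c)) *\<^sub>s (?v d \<star> (?w c \<star> sderiv q d (sderiv q c f)))"
      by (metis smul_assoc smul_scale_left)
    moreover have "ksgn (a * (b + q c)) * (ksgn ((a + q d) * (b + q c)) * ksgn (q d * q c)) =
        ksgn (a * b) * ksgn (b * (a + q d))"
      by (cases a; cases b; cases "q c"; cases "q d"; simp)
    ultimately show ?thesis
      using sderiv_commute[OF f d c] by simp
  qed
  have "scomm a b D E f = (\<Sum>c<N. D (?w c) \<star> sderiv q c f) - ksgn (a * b) *\<^sub>s (\<Sum>c<N. E (?v c) \<star> sderiv q c f)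
      + ((\<Sum>c<N. \<Sum>d<N. ksgn (a * (b + q c)) *\<^sub>s (?w c \<star> (?v d \<star> sderiv q d (sderiv q c f))))
      - (\<Sum>d<N. \<Sum>c<N. ksgn (a * b) *\<^sub>s ksgn (b * (a + q d)) *\<^sub>s (?v d \<star> (?w c \<star> sderiv q c (sderiv q d f)))))"
    unfolding scomm_def DE[OF D E] DE[OF E D] by (simp add: sscale_simps)
  also have "(\<Sum>d<N. \<Sum>c<N. ksgn (a * b) *\<^sub>s ksgn (b * (a + q d)) *\<^sub>s (?v d \<star> (?w c \<star> sderiv q c (sderiv q d f)))) =
     (\<Sum>c<N. \<Sum>d<N. ksgn (a * (b + q c)) *\<^sub>s (?w c \<star> (?v d \<star> sderiv q d (sderiv q c f))))"
    by (subst sum.swap) (intro sum.cong refl, simp only: swap lessThan_iff)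
  finally show "scomm a b D E f = (\<Sum>c<N. scomm a b D E (coord q c) \<star> sderiv q c f)"
    by (simp add: scomm_def smul_diff_left sum_subtractf sscale_simps)
qed

subsection \<open>The Poisson bracket\<close>

lemma dbl_simps [simp]: "c < n \<Longrightarrow> dbl n q c = q c" "dbl n q (n + c) = q c"
  by (simp_all add: dbl_def)

lemma sum_dbl: "(\<Sum>c<2 * n. F c) = (\<Sum>c<n. F c) + (\<Sum>c<n. F (n + c))"
  for F :: "nat \<Rightarrow> 'a :: comm_monoid_add"
proof -
  have "{..<2 * n} = {..<n} \<union> (\<lambda>c. n + c) ` {..<n}"
    using lessThan_atLeast0 image_add_atLeastLessThan[of n 0 n] by (auto simp: mult_2)
  moreover have "{..<n} \<inter> (\<lambda>c. n + c) ` {..<n} = {}" by auto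
  ultimately show ?thesis
    by (simp add: sum.union_disjoint sum.reindex)
qed

lemma poisson_eq:
  assumes "has_parity a f"
  shows "poisson n q f g = (\<Sum>c<n.
      ksgn (q c * (a + 1)) *\<^sub>s (sderiv (dbl n q) (n + c) f \<star> sderiv (dbl n q) c g)
    - ksgn (q c * a) *\<^sub>s (sderiv (dbl n q) c f \<star> sderiv (dbl n q) (n + c) g))"
proof -
  have "poisson_hom n q \<epsilon> 0 g = 0" for \<epsilon>
    by (simp add: poisson_hom_def)
  then have "poisson n q f g = poisson_hom n q a f g"
    unfolding poisson_def using spart_eq[OF assms] spart_eq_zero[OF assms]
    by (cases a) simp_all
  then show ?thesis by (simp add: poisson_hom_def)
qed

context
  fixes n q d
  defines "d \<equiv> dbl n q"
begin

text \<open>For fixed homogeneous \<open>f\<close> the bracket formula is an expansion in the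
  partial derivatives of the second argument; its coefficients are the derivatives of
  \<open>f\<close> along the conjugate coordinates.\<close>

lemma vfield_poisson:
  assumes "f \<in> Cinf (2 * n) d" "has_parity a f"
  shows "vfield (2 * n) d a (poisson n q f)"
    and "c < n \<Longrightarrow> poisson n q f (coord d c) = ksgn (q c * (a + 1)) *\<^sub>s sderiv d (n + c) f"
    and "c < n \<Longrightarrow> poisson n q f (coord d (n + c)) = - (ksgn (q c * a) *\<^sub>s sderiv d c f)"
proof -
  define v where "v c = (if c < n then ksgn (q c * (a + 1)) *\<^sub>s sderiv d (n + c) f
    else - (ksgn (q (c - n) * a) *\<^sub>s sderiv d (c - n) f))" for c
  have 1: "v c \<in> Cinf (2 * n) d" if "c < 2 * n" for c
    using that assms by (auto simp: v_def intro!: Cinf_scale Cinf_minus Cinf_sderiv)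
  have 2: "has_parity (a + d c) (v c)" if "c < 2 * n" for c
  proof (cases "c < n")
    case True
    then show ?thesis using has_parity_sderiv[OF assms(2,1), of "n + c"]
      by (simp add: v_def d_def has_parity_scale)
  next
    case False
    then have "c - n < n" using that by linarith
    then show ?thesis using has_parity_sderiv[OF assms(2,1), of "c - n"] False
      by (simp add: v_def d_def has_parity_scale has_parity_minus dbl_def)
  qed
  have 3: "poisson n q f g = (\<Sum>c<2 * n. v c \<star> sderiv d c g)" for g
    unfolding poisson_eq[OF assms(2)] sum_dbl sum_subtractf
    by (simp add: v_def sum_negf flip: d_def)
  show "vfield (2 * n) d a (poisson n q f)"
    by (rule vfieldI(1)[OF 1 2 3])
  show "c < n \<Longrightarrow> poisson n q f (coord d c) = ksgn (q c * (a + 1)) *\<^sub>s sderiv d (n + c) f"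
    using vfieldI(2)[OF 1 2 3, of c] by (simp add: v_def)
  show "c < n \<Longrightarrow> poisson n q f (coord d (n + c)) = - (ksgn (q c * a) *\<^sub>s sderiv d c f)"
    using vfieldI(2)[OF 1 2 3, of "n + c"] by (simp add: v_def)
qed

lemma poisson_add_left:
  assumes "f \<in> Cinf (2 * n) d" "g \<in> Cinf (2 * n) d"
  shows "poisson n q (f + g) h = poisson n q f h + poisson n q g h"
  using assms unfolding poisson_def poisson_hom_def spart_add d_def
  by (simp add: sderiv_add[of _ "2 * n"] Cinf_spart smul_add_left sscale_simps sum.distrib sum_subtractf)

lemma poisson_scale_left:
  assumes "f \<in> Cinf (2 * n) d"
  shows "poisson n q (r *\<^sub>s f) h = r *\<^sub>s poisson n q f h"
  using assms unfolding poisson_def poisson_hom_def spart_scale d_def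
  by (simp add: sderiv_scale[of _ "2 * n"] Cinf_spart sscale_simps ac_simps sum_subtractf)

lemma poisson_closed:
  assumes "f \<in> Cinf (2 * n) d" "g \<in> Cinf (2 * n) d"
  shows "poisson n q f g \<in> Cinf (2 * n) d"
proof -
  have "poisson n q (spart a f) g \<in> Cinf (2 * n) d" for a
    by (rule vfield_closed[OF vfield_poisson(1)]) (use assms in \<open>auto intro: Cinf_spart has_parity_spart\<close>)
  then show ?thesis
    using poisson_add_left[of "spart 0 f" "spart 1 f" g] assms
    by (simp add: Cinf_spart Cinf_add flip: spart_sum)
qed

text \<open>Commuting the two derivatives past each other exchanges the two kinds of terms in the
  bracket formula.\<close>

lemma poisson_antisym:
  assumes "f \<in> Cinf (2 * n) d" "has_parity a f" "g \<in> Cinf (2 * n) d" "has_parity b g"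
  shows "poisson n q g f = - (ksgn (a * b) *\<^sub>s poisson n q f g)"
proof -
  have *: "sderiv d e g \<star> sderiv d e' f = ksgn ((a + q c) * (b + q c)) *\<^sub>s (sderiv d e' f \<star> sderiv d e g)"
    if "d e = q c" "d e' = q c" for e e' c
    using that smul_commute[OF has_parity_sderiv[OF assms(2,1), of e'] has_parity_sderiv[OF assms(4,3), of e]] by simp
  have "ksgn (q c * (b + 1)) *\<^sub>s (sderiv d (n + c) g \<star> sderiv d c f) - ksgn (q c * b) *\<^sub>s (sderiv d c g \<star> sderiv d (n + c) f) =
     - (ksgn (a * b) *\<^sub>s (ksgn (q c * (a + 1)) *\<^sub>s (sderiv d (n + c) f \<star> sderiv d c g)
       - ksgn (q c * a) *\<^sub>s (sderiv d c f \<star> sderiv d (n + c) g)))" if "c < n" for c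
  proof -
    have "d c = q c" "d (n + c) = q c" using that by (simp_all add: d_def)
    note e = *[OF this(2,1)] *[OF this]
    show ?thesis
      unfolding e by (cases a; cases b; cases "q c"; simp add: sscale_simps)
  qed
  then show ?thesis
    unfolding poisson_eq[OF assms(2)] poisson_eq[OF assms(4)] d_def[symmetric]
    by (simp add: sscale.scale_sum_right flip: sum_negf)
qed

text \<open>Given antisymmetry, the Jacobi identity is invariant under cyclic permutations. This
  brings an argument already known to be reducible to coordinates into the last place.\<close>

lemma poisson_rotate:
  assumes f: "f \<in> Cinf (2 * n) d" "has_parity a f" and g: "g \<in> Cinf (2 * n) d" "has_parity b g"
    and h: "h \<in> Cinf (2 * n) d" "has_parity c h"
    and J: "poisson n q f (poisson n q g h) =
      poisson n q (poisson n q f g) h + ksgn (a * b) *\<^sub>s poisson n q g (poisson n q f h)"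
  shows "poisson n q h (poisson n q f g) =
      poisson n q (poisson n q h f) g + ksgn (c * a) *\<^sub>s poisson n q f (poisson n q h g)"
proof -
  have fg: "poisson n q f g \<in> Cinf (2 * n) d" "has_parity (a + b) (poisson n q f g)"
    and gh: "poisson n q g h \<in> Cinf (2 * n) d" "has_parity (b + c) (poisson n q g h)"
    and hf: "poisson n q h f \<in> Cinf (2 * n) d" "has_parity (c + a) (poisson n q h f)"
    and fh: "poisson n q f h \<in> Cinf (2 * n) d"
    using f g h by (auto intro: poisson_closed vfield_parity[OF vfield_poisson(1)])
  have "poisson n q h (poisson n q f g) = - (ksgn ((a + b) * c) *\<^sub>s poisson n q (poisson n q f g) h)"
    using poisson_antisym[OF fg h] .
  moreover have "poisson n q (poisson n q h f) g = ksgn (b * (c + a)) *\<^sub>s ksgn (a * c) *\<^sub>s poisson n q g (poisson n q f h)"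
    using poisson_antisym[OF g hf] poisson_antisym[OF f h] fh
      vfield_scale[OF vfield_poisson(1)[OF g]] vfield_minus[OF vfield_poisson(1)[OF g]]
    by (simp add: Cinf_scale)
  moreover have "poisson n q f (poisson n q h g) = - (ksgn (b * c) *\<^sub>s poisson n q f (poisson n q g h))"
    using poisson_antisym[OF g h] gh(1) vfield_scale[OF vfield_poisson(1)[OF f]] vfield_minus[OF vfield_poisson(1)[OF f]]
    by (simp add: Cinf_scale)
  ultimately show ?thesis
    unfolding J by (cases a; cases b; cases c; simp add: sscale_simps)
qed

text \<open>Canonical coordinates have constant brackets, so for three coordinates every term of the
  Jacobi identity vanishes; this is the start of the reduction.\<close>

lemma poisson_coord_coord:
  assumes "b < 2 * n" "c < 2 * n"
  shows "\<exists>r. poisson n q (coord d b) (coord d c) = r *\<^sub>s sone"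
proof -
  note v = vfield_poisson(2,3)[OF Cinf_coord[OF assms(1)] has_parity_coord]
  show ?thesis
  proof (cases "c < n")
    case True
    have "r *\<^sub>s (if P then sone else 0) = (if P then r else 0) *\<^sub>s sone" for r P by simp
    then show ?thesis using v(1)[OF True] unfolding sderiv_coord by metis
  next
    case False
    then have *: "c - n < n" "n + (c - n) = c" using assms by auto
    have "- (r *\<^sub>s (if P then sone else 0)) = (if P then - r else 0) *\<^sub>s sone" for r P by simp
    then show ?thesis using v(2)[OF *(1)] unfolding sderiv_coord *(2) by metis
  qed
qed

text \<open>Both sides are vector fields in the last argument, so it may be taken to be a coordinate;
  by antisymmetry the same then holds for the other two arguments.\<close>

lemma poisson_jacobi:
  assumes f: "f \<in> Cinf (2 * n) d" "has_parity a f" and g: "g \<in> Cinf (2 * n) d" "has_parity b g"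
    and h: "h \<in> Cinf (2 * n) d"
  shows "poisson n q f (poisson n q g h) =
      poisson n q (poisson n q f g) h + ksgn (a * b) *\<^sub>s poisson n q g (poisson n q f h)"
proof -
  have step: "poisson n q f (poisson n q g h) =
      poisson n q (poisson n q f g) h + ksgn (a * b) *\<^sub>s poisson n q g (poisson n q f h)"
    if f: "f \<in> Cinf (2 * n) d" "has_parity a f" and g: "g \<in> Cinf (2 * n) d" "has_parity b g"
      and h: "h \<in> Cinf (2 * n) d"
      and J: "\<And>c. c < 2 * n \<Longrightarrow> poisson n q f (poisson n q g (coord d c)) =
      poisson n q (poisson n q f g) (coord d c) + ksgn (a * b) *\<^sub>s poisson n q g (poisson n q f (coord d c))"
    for f g h a b
  proof -
    have fg: "poisson n q f g \<in> Cinf (2 * n) d" "has_parity (a + b) (poisson n q f g)"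
      using f g by (auto intro: poisson_closed vfield_parity[OF vfield_poisson(1)])
    have "scomm a b (poisson n q f) (poisson n q g) h = poisson n q (poisson n q f g) h"
      by (rule vfield_eqI[OF vfield_scomm[OF vfield_poisson(1)[OF f] vfield_poisson(1)[OF g]] vfield_poisson(1)[OF fg] h])
        (simp add: scomm_def J)
    then show ?thesis unfolding scomm_def by (simp add: algebra_simps)
  qed
  have const: "poisson n q f (r *\<^sub>s sone) = 0" "poisson n q (r *\<^sub>s sone) f = 0"
    if "f \<in> Cinf (2 * n) d" "has_parity a f" for f r a
  proof -
    show "poisson n q f (r *\<^sub>s sone) = 0"
      using vfield_poisson(1)[OF that] vfield_scale vfield_sone Cinf_sone by fastforce
    then show "poisson n q (r *\<^sub>s sone) f = 0"
      using poisson_antisym[OF that Cinf_scale[OF Cinf_sone] has_parity_scale[OF has_parity_sone]] by simp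
  qed
  note co = Cinf_coord[of _ "2 * n" d] has_parity_coord[of d]
  have 1: "poisson n q (coord d x) (poisson n q (coord d y) f) =
      poisson n q (poisson n q (coord d x) (coord d y)) f + ksgn (d x * d y) *\<^sub>s poisson n q (coord d y) (poisson n q (coord d x) f)"
    if "x < 2 * n" "y < 2 * n" "f \<in> Cinf (2 * n) d" for x y f
  proof (rule step)
    \<comment> \<open>All inner brackets are constants, and the bracket of anything homogeneous with
      a constant is zero.\<close>
    fix z assume z: "z < 2 * n"
    obtain r where "poisson n q (coord d x) (coord d y) = r *\<^sub>s sone"
      using poisson_coord_coord[OF \<open>x < 2 * n\<close> \<open>y < 2 * n\<close>] by blast
    moreover obtain s where "poisson n q (coord d y) (coord d z) = s *\<^sub>s sone"
      using poisson_coord_coord[OF \<open>y < 2 * n\<close> z] by blast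
    moreover obtain t where "poisson n q (coord d x) (coord d z) = t *\<^sub>s sone"
      using poisson_coord_coord[OF \<open>x < 2 * n\<close> z] by blast
    ultimately show "poisson n q (coord d x) (poisson n q (coord d y) (coord d z)) =
      poisson n q (poisson n q (coord d x) (coord d y)) (coord d z)
        + ksgn (d x * d y) *\<^sub>s poisson n q (coord d y) (poisson n q (coord d x) (coord d z))"
      using const[OF co] that z by simp
  qed (use that co in auto)
  have 2: "poisson n q f (poisson n q (coord d x) h) =
      poisson n q (poisson n q f (coord d x)) h + ksgn (a * d x) *\<^sub>s poisson n q (coord d x) (poisson n q f h)"
    if "x < 2 * n" "f \<in> Cinf (2 * n) d" "has_parity a f" "h \<in> Cinf (2 * n) d" for x f h a
  proof (rule step)
    fix y assume y: "y < 2 * n"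
    show "poisson n q f (poisson n q (coord d x) (coord d y)) =
      poisson n q (poisson n q f (coord d x)) (coord d y) + ksgn (a * d x) *\<^sub>s poisson n q (coord d x) (poisson n q f (coord d y))"
      by (rule poisson_rotate[OF co(1) co(2) co(1) co(2) that(2,3) 1]) (use that y in auto)
  qed (use that co in auto)
  show ?thesis
  proof (rule step[OF f g h])
    fix z assume z: "z < 2 * n"
    show "poisson n q f (poisson n q g (coord d z)) =
      poisson n q (poisson n q f g) (coord d z) + ksgn (a * b) *\<^sub>s poisson n q g (poisson n q f (coord d z))"
      by (rule poisson_rotate[OF g co f 2]) (use f g z in auto)
  qed
qed

end

subsection \<open>Weights and polynomial degrees\<close>

text \<open>The Euler field with weights \<open>w\<close>. Its eigenfunctions are the
  quasi-homogeneous functions, which gives a notion of degree for smooth functions: constant weights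
  1 measure the total degree, \<open>momentum_wt\<close> the degree in the momenta.\<close>

definition euler :: "nat \<Rightarrow> (nat \<Rightarrow> bit) \<Rightarrow> (nat \<Rightarrow> real) \<Rightarrow> sfun \<Rightarrow> sfun" where
  "euler N q w f = (\<Sum>c<N. w c *\<^sub>s (coord q c \<star> sderiv q c f))"

lemma vfield_euler: "vfield N q 0 (euler N q w)"
  by (rule vfieldI[of N "\<lambda>c. w c *\<^sub>s coord q c"])
    (auto simp: euler_def intro!: Cinf_scale Cinf_coord has_parity_scale has_parity_coord)

text \<open>The commutator of a partial derivative with the Euler field is \<open>w c\<close> times
  that derivative: one term of the Leibniz rule hits the coordinate \<open>c\<close>, the others
  reproduce the Euler field. Hence differentiation lowers weights by \<open>w c\<close>.\<close>

lemma euler_sderiv: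
  assumes f: "f \<in> Cinf N q" and c: "c < N"
  shows "euler N q w (sderiv q c f) = sderiv q c (euler N q w f) - w c *\<^sub>s sderiv q c f"
proof -
  have "sderiv q c (coord q b \<star> sderiv q b f) =
      (if c = b then sderiv q b f else 0) + coord q b \<star> sderiv q b (sderiv q c f)" if "b < N" for b
    using that f c sderiv_commute[OF f c that]
    by (simp add: sderiv_mult[OF has_parity_coord Cinf_coord, of b N] Cinf_sderiv sderiv_coord
        smul_sone_left[of _ N q])
  then have *: "w b *\<^sub>s sderiv q c (coord q b \<star> sderiv q b f) = (if c = b then w b *\<^sub>s sderiv q b f else 0)
      + w b *\<^sub>s (coord q b \<star> sderiv q b (sderiv q c f))" if "b < N" for b
    using that by (simp add: sscale_simps)
  then have "sderiv q c (euler N q w f) = w c *\<^sub>s sderiv q c f + euler N q w (sderiv q c f)"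
  proof -
    have "sderiv q c (euler N q w f) = (\<Sum>b<N. w b *\<^sub>s sderiv q c (coord q b \<star> sderiv q b f))"
      unfolding euler_def using f c
      by (subst sderiv_sum[of _ _ N])
        (auto intro!: sum.cong Cinf_scale Cinf_mult Cinf_coord Cinf_sderiv sderiv_scale[of _ N])
    then show ?thesis using * c by (simp add: sum.distrib euler_def)
  qed
  then show ?thesis by simp
qed

definition weight :: "nat \<Rightarrow> (nat \<Rightarrow> bit) \<Rightarrow> (nat \<Rightarrow> real) \<Rightarrow> real \<Rightarrow> sfun \<Rightarrow> bool" where
  "weight N q w r f \<longleftrightarrow> f \<in> Cinf N q \<and> euler N q w f = r *\<^sub>s f"

lemma weight_Cinf: "weight N q w r f \<Longrightarrow> f \<in> Cinf N q"
  by (simp add: weight_def)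

lemma weight_coord: "c < N \<Longrightarrow> weight N q w (w c) (coord q c)"
  unfolding weight_def
  using vfieldI(2)[of N "\<lambda>c. w c *\<^sub>s coord q c" q 0 "euler N q w" c]
  by (auto simp: euler_def intro!: Cinf_scale Cinf_coord has_parity_scale has_parity_coord)

lemma weight_mult:
  assumes "weight N q w r f" "weight N q w s g" "has_parity a f"
  shows "weight N q w (r + s) (f \<star> g)"
  using assms vfield_mult[OF vfield_euler, of f N q g a w]
  by (simp add: weight_def Cinf_mult sscale.scale_left_distrib)

lemma weight_scale: "weight N q w r f \<Longrightarrow> weight N q w r (s *\<^sub>s f)"
  by (simp add: weight_def Cinf_scale vfield_scale[OF vfield_euler] mult.commute)

lemma weight_add: "weight N q w r f \<Longrightarrow> weight N q w r g \<Longrightarrow> weight N q w r (f + g)"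
  by (simp add: weight_def Cinf_add vfield_add[OF vfield_euler] sscale_simps)

lemma weight_minus: "weight N q w r f \<Longrightarrow> weight N q w r (- f)"
  using weight_scale[of N q w r f "- 1"] by simp

lemma weight_diff: "weight N q w r f \<Longrightarrow> weight N q w r g \<Longrightarrow> weight N q w r (f - g)"
  using weight_add[of N q w r f "- g"] by (simp add: weight_minus)

lemma weight_sum: "(\<And>i. i \<in> I \<Longrightarrow> weight N q w r (f i)) \<Longrightarrow> weight N q w r (\<Sum>i\<in>I. f i)"
  by (induction I rule: infinite_finite_induct)
    (simp_all add: weight_add, simp_all add: weight_def vfield_zero[OF vfield_euler])

lemma weight_sderiv:
  assumes "weight N q w r f" "c < N"
  shows "weight N q w (r - w c) (sderiv q c f)"
  using assms euler_sderiv[of f N q c w]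
  by (simp add: weight_def Cinf_sderiv sderiv_scale[of _ N] sscale.scale_left_diff_distrib)

lemma scale_sone_eq_0_iff: "r *\<^sub>s sone = 0 \<longleftrightarrow> r = 0"
proof -
  have "sone {} 0 \<noteq> (0 :: sfun) {} 0" by (simp add: sone_def zero_fun_apply)
  then have "sone \<noteq> 0" by metis
  then show ?thesis by simp
qed

lemma scale_sone_eq_iff: "r *\<^sub>s sone = s *\<^sub>s sone \<longleftrightarrow> r = s"
  using scale_sone_eq_0_iff[of "r - s"] by (simp add: sscale.scale_left_diff_distrib)

lemma weight_const:
  assumes "weight N q w r (s *\<^sub>s sone)" "r \<noteq> 0"
  shows "s = 0"
proof -
  have "euler N q w (s *\<^sub>s sone) = 0"
    by (simp add: vfield_scale[OF vfield_euler] vfield_sone[OF vfield_euler] Cinf_sone)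
  then have "(r * s) *\<^sub>s sone = 0" using assms by (simp add: weight_def)
  then show ?thesis using assms(2) unfolding scale_sone_eq_0_iff by simp
qed

text \<open>Polynomials of degree at most \<open>k\<close>, described by their derivatives: those of
  order \<open>k\<close> are constants. For the cubic Hamiltonians this is what makes the third
  derivatives numbers.\<close>

primrec poly_deg :: "nat \<Rightarrow> (nat \<Rightarrow> bit) \<Rightarrow> nat \<Rightarrow> sfun \<Rightarrow> bool" where
  "poly_deg N q 0 f \<longleftrightarrow> (\<exists>r. f = r *\<^sub>s sone)"
| "poly_deg N q (Suc k) f \<longleftrightarrow> f \<in> Cinf N q \<and> (\<forall>c<N. poly_deg N q k (sderiv q c f))"

lemma poly_deg_Cinf: "poly_deg N q k f \<Longrightarrow> f \<in> Cinf N q"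
  by (cases k) (auto intro: Cinf_scale Cinf_sone)

lemma poly_deg_zero: "poly_deg N q k 0"
proof (induction k)
  case 0
  show ?case by (auto intro: exI[of _ 0])
qed simp

lemma poly_deg_scale: "poly_deg N q k f \<Longrightarrow> poly_deg N q k (r *\<^sub>s f)"
  by (induction k arbitrary: f) (auto simp: sderiv_scale[of _ N] intro: Cinf_scale)

lemma poly_deg_add: "poly_deg N q k f \<Longrightarrow> poly_deg N q k g \<Longrightarrow> poly_deg N q k (f + g)"
  by (induction k arbitrary: f g)
    (auto simp: sderiv_add[of _ N] simp flip: sscale.scale_left_distrib intro: Cinf_add)

lemma poly_deg_sum: "(\<And>i. i \<in> I \<Longrightarrow> poly_deg N q k (f i)) \<Longrightarrow> poly_deg N q k (\<Sum>i\<in>I. f i)"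
  by (induction I rule: infinite_finite_induct) (simp_all add: poly_deg_zero poly_deg_add)

text \<open>Induction by the Leibniz rule: a derivative of the product either removes the coordinate
  or lowers the degree of \<open>f\<close>.\<close>

lemma poly_deg_coord_mult:
  "b < N \<Longrightarrow> poly_deg N q k f \<Longrightarrow> poly_deg N q (Suc k) (coord q b \<star> f)"
proof (induction k arbitrary: f)
  case 0
  then obtain r where r: "f = r *\<^sub>s sone" by auto
  have "coord q b \<star> f = r *\<^sub>s coord q b"
    using 0 by (simp add: r smul_sone_right[of _ N q] Cinf_coord)
  moreover have "poly_deg N q 0 (if c = b then sone else 0)" for c
    using sscale.scale_one[of sone] poly_deg_zero[of N q 0] by (auto intro: exI[of _ 1])
  then have "poly_deg N q (Suc 0) (coord q b)"
    using 0 by (auto simp: sderiv_coord Cinf_coord)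
  ultimately show ?case by (metis poly_deg_scale)
next
  case (Suc k)
  have f: "f \<in> Cinf N q" using Suc.prems poly_deg_Cinf by blast
  have "poly_deg N q (Suc k) (sderiv q c (coord q b \<star> f))" if c: "c < N" for c
  proof -
    have "poly_deg N q (Suc k) (coord q b \<star> sderiv q c f)"
      using Suc c by simp
    moreover have "poly_deg N q (Suc k) ((if c = b then sone else 0) \<star> f)"
      using Suc.prems f poly_deg_zero[of N q "Suc k"]
      by (cases "c = b") (simp_all add: smul_sone_left[of _ N q] del: poly_deg.simps)
    ultimately show ?thesis
      using Suc.prems(1) f c
      by (simp add: sderiv_mult[OF has_parity_coord Cinf_coord, of b N] sderiv_coord poly_deg_add poly_deg_scale
          del: poly_deg.simps)
  qed
  then show ?case using Suc.prems(1) f by (simp add: Cinf_mult Cinf_coord)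
qed

lemma poly_deg_3_triple:
  assumes "a < N" "b < N" "c < N"
  shows "poly_deg N q 3 (coord q a \<star> coord q b \<star> coord q c)"
proof -
  have "coord q c = coord q c \<star> sone" using assms by (simp add: smul_sone_right[of _ N q] Cinf_coord)
  moreover have "poly_deg N q 0 sone" by (auto intro: exI[of _ 1])
  ultimately have "poly_deg N q (Suc 0) (coord q c)" using poly_deg_coord_mult assms by metis
  then show ?thesis
    unfolding smul_assoc numeral_3_eq_3 using assms by (intro poly_deg_coord_mult)
qed

lemma weight_triple:
  assumes "a < N" "b < N" "c < N"
  shows "weight N q w (w a + w b + w c) (coord q a \<star> coord q b \<star> coord q c)"
  by (rule weight_mult[OF weight_mult[OF weight_coord weight_coord has_parity_coord] weight_coord
        has_parity_mult[OF has_parity_coord has_parity_coord]]) (use assms in auto)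

text \<open>Euler's identity for homogeneous functions of degree one.\<close>

lemma weight_one_linear:
  assumes "weight N q (\<lambda>c. 1) 1 f" "\<And>c. c < N \<Longrightarrow> sderiv q c f = r c *\<^sub>s sone"
  shows "f = (\<Sum>c<N. r c *\<^sub>s coord q c)"
proof -
  have "f = euler N q (\<lambda>c. 1) f" using assms(1) by (simp add: weight_def)
  also have "\<dots> = (\<Sum>c<N. r c *\<^sub>s coord q c)"
    unfolding euler_def using assms(2) by (simp add: smul_sone_right[of _ N q] Cinf_coord)
  finally show ?thesis .
qed

text \<open>Each term of the bracket differentiates \<open>f\<close> and \<open>g\<close> along the
  two members of a conjugate pair, which together have weight \<open>m\<close>.\<close>

lemma weight_poisson:
  assumes f: "weight (2 * n) (dbl n q) w r f" "has_parity a f" and g: "weight (2 * n) (dbl n q) w s g"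
    and m: "\<And>c. c < n \<Longrightarrow> w c + w (n + c) = m"
  shows "weight (2 * n) (dbl n q) w (r + s - m) (poisson n q f g)"
proof -
  have "weight (2 * n) (dbl n q) w (r + s - m) (sderiv (dbl n q) i f \<star> sderiv (dbl n q) j g)"
    if "i < 2 * n" "j < 2 * n" "w i + w j = m" for i j
  proof -
    have "r + s - m = (r - w i) + (s - w j)" using that by simp
    then show ?thesis using f g that
      by (metis weight_mult weight_sderiv has_parity_sderiv weight_Cinf)
  qed
  then show ?thesis
    unfolding poisson_eq[OF f(2)]
    by (intro weight_sum weight_diff weight_scale) (use m in \<open>auto simp: add.commute\<close>)
qed

subsection \<open>Functions on the base\<close>

text \<open>The second parity function \<open>q'\<close> is there because a function on the base is
  differentiated along a momentum, a coordinate of the cotangent bundle.\<close>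

lemma sderiv_beyond:
  assumes "f \<in> Cinf N q" "N \<le> c"
  shows "sderiv q' c f = 0"
proof (cases "q' c")
  case zero
  have "pd c (f A) = 0" for A
    using assms by (intro pd_not_dependent[of "even_coords N q"]) (auto simp: Cinf_iff even_coords_def)
  then show ?thesis using zero by (simp add: sderiv_def fun_eq_iff zero_fun_apply)
next
  case one
  have "f (insert c A) = 0" for A
  proof -
    have "\<not> insert c A \<subseteq> odd_coords N q" using assms(2) by (auto simp: odd_coords_def)
    then show ?thesis using assms(1) by (simp add: Cinf_iff)
  qed
  then show ?thesis using one by (auto simp: sderiv_odd zero_fun_apply intro!: sfun_eqI)
qed

lemma sderiv_dbl [simp]: "c < n \<Longrightarrow> sderiv (dbl n q) c f = sderiv q c f"
  by (simp add: sderiv_def)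

lemma coord_dbl [simp]: "c < n \<Longrightarrow> coord (dbl n q) c = coord q c"
  by (simp add: coord_def)

lemma Cinf_dbl: "f \<in> Cinf n q \<Longrightarrow> f \<in> Cinf (2 * n) (dbl n q)"
  unfolding Cinf_iff
proof (elim conjE, intro conjI allI impI)
  fix A assume "\<forall>A. \<not> A \<subseteq> odd_coords n q \<longrightarrow> f A = 0" "\<not> A \<subseteq> odd_coords (2 * n) (dbl n q)"
  moreover have "odd_coords n q \<subseteq> odd_coords (2 * n) (dbl n q)" by (auto simp: odd_coords_def)
  ultimately show "f A = 0" by blast
next
  fix A assume "\<forall>A. smooth_in (even_coords n q) (f A)"
  moreover have "even_coords n q \<subseteq> even_coords (2 * n) (dbl n q)" by (auto simp: even_coords_def)
  ultimately show "smooth_in (even_coords (2 * n) (dbl n q)) (f A)" using smooth_in_mono by blast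
qed

lemma poisson_coord_left:
  assumes "c < n" "h \<in> Cinf (2 * n) (dbl n q)"
  shows "poisson n q (coord q c) h = - (ksgn (q c) *\<^sub>s sderiv (dbl n q) (n + c) h)"
    and "poisson n q (coord (dbl n q) (n + c)) h = sderiv q c h"
proof -
  have one: "sone \<star> sderiv (dbl n q) b h = sderiv (dbl n q) b h" if "b < 2 * n" for b
    using that assms(2) by (simp add: smul_sone_left[of _ "2 * n" "dbl n q"] Cinf_sderiv)
  have "poisson n q (coord (dbl n q) c) h =
      (\<Sum>b<n. if b = c then - (ksgn (q c) *\<^sub>s sderiv (dbl n q) (n + b) h) else 0)"
    unfolding poisson_eq[OF has_parity_coord[of "dbl n q" c]] sderiv_coord
    using assms(1) one by (intro sum.cong) auto
  then show "poisson n q (coord q c) h = - (ksgn (q c) *\<^sub>s sderiv (dbl n q) (n + c) h)"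
    using assms(1) by simp
  have "ksgn (q c * (q c + 1)) = 1" by (cases "q c"; simp)
  then have "poisson n q (coord (dbl n q) (n + c)) h = (\<Sum>b<n. if b = c then sderiv (dbl n q) b h else 0)"
    unfolding poisson_eq[OF has_parity_coord[of "dbl n q" "n + c"]] sderiv_coord
    using assms(1) one by (intro sum.cong) (auto simp del: sderiv_dbl)
  then show "poisson n q (coord (dbl n q) (n + c)) h = sderiv q c h"
    using assms(1) by simp
qed

lemma poisson_zero_left [simp]: "poisson n q 0 g = 0"
  using poisson_scale_left[of 0 n q 0 g] by simp

lemma poisson_base:
  assumes "has_parity a H" "g \<in> Cinf n q"
  shows "poisson n q H g = (\<Sum>c<n. ksgn (q c * (a + 1)) *\<^sub>s (sderiv (dbl n q) (n + c) H \<star> sderiv q c g))"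
  unfolding poisson_eq[OF assms(1)] using assms(2) by (simp add: sderiv_beyond[of _ n q])

text \<open>Functions on the base do not depend on the momenta, so each of the two brackets
  contributes one momentum derivative, and both fall on \<open>H\<close>.\<close>

lemma poisson_base_base:
  assumes H: "H \<in> Cinf (2 * n) (dbl n q)" "has_parity 1 H"
    and f: "f \<in> Cinf n q" "has_parity a f" and g: "g \<in> Cinf n q"
  shows "poisson n q f (poisson n q H g) = (\<Sum>c<n. \<Sum>b<n. - (ksgn (q c * a) *\<^sub>s
    (sderiv q c f \<star> (sderiv (dbl n q) (n + c) (sderiv (dbl n q) (n + b) H) \<star> sderiv q b g))))"
proof -
  have Hg: "poisson n q H g = (\<Sum>b<n. sderiv (dbl n q) (n + b) H \<star> sderiv q b g)"
    unfolding poisson_base[OF H(2) g] by simp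
  have g': "sderiv q b g \<in> Cinf n q" if "b < n" for b using g that by (rule Cinf_sderiv)
  have "sderiv (dbl n q) (n + c) (poisson n q H g) =
     (\<Sum>b<n. sderiv (dbl n q) (n + c) (sderiv (dbl n q) (n + b) H) \<star> sderiv q b g)" if "c < n" for c
  proof -
    have 1: "sderiv (dbl n q) (n + b) H \<in> Cinf (2 * n) (dbl n q)" if "b < n" for b
      using that H by (intro Cinf_sderiv) auto
    have "sderiv (dbl n q) (n + c) (sderiv (dbl n q) (n + b) H \<star> sderiv q b g) =
      sderiv (dbl n q) (n + c) (sderiv (dbl n q) (n + b) H) \<star> sderiv q b g" if "b < n" for b
      using sderiv_mult[OF has_parity_sderiv[OF H(2,1)] 1[OF that] Cinf_dbl[OF g'[OF that]], of "n + c"] \<open>c < n\<close>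
        sderiv_beyond[OF g'[OF that], of "n + c" "dbl n q"] by simp
    then show ?thesis
      unfolding Hg using that 1 g' by (subst sderiv_sum[of _ _ "2 * n"]) (auto intro!: Cinf_mult intro: Cinf_dbl)
  qed
  then show ?thesis
    unfolding poisson_eq[OF f(2)] using f(1)
    by (simp add: sderiv_beyond[of _ n q] smul_sum_right sscale_simps sum_negf)
qed


subsection \<open>The fields and Hamiltonians\<close>

text \<open>The coefficient of the partial derivative number \<open>k\<close> in the field. Grouping
  the triple sum by its last index shows that the field and its Hamiltonian have the same
  coefficients.\<close>

definition Q_comp :: "nat \<Rightarrow> (nat \<Rightarrow> bit) \<Rightarrow> (nat \<Rightarrow> nat \<Rightarrow> nat \<Rightarrow> real) \<Rightarrow> nat \<Rightarrow> sfun" where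
  "Q_comp n q Qc k = (1/2) *\<^sub>s (\<Sum>i<n. \<Sum>j<n. Qc i j k *\<^sub>s (coord q j \<star> coord q i))"

lemma Cinf_Q_comp: "Q_comp n q Qc k \<in> Cinf n q"
  unfolding Q_comp_def by (intro Cinf_scale Cinf_sum Cinf_mult Cinf_coord) auto

lemma sum_rotate: "(\<Sum>i<n. \<Sum>j<n. \<Sum>k<n. F i j k) = (\<Sum>k<n. \<Sum>i<n. \<Sum>j<n. F i j k)"
  for n :: nat and F :: "nat \<Rightarrow> nat \<Rightarrow> nat \<Rightarrow> 'a :: comm_monoid_add"
  by (subst sum.swap[of _ "{..<n}" "{..<n}"], subst (2) sum.swap) (rule refl)

lemma Q_field_eq: "Q_field n q Qc f = (\<Sum>k<n. Q_comp n q Qc k \<star> sderiv q k f)"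
  unfolding Q_field_def Q_comp_def
  by (subst sum_rotate) (simp add: smul_sum_left sscale_simps)

lemma Q_ham_eq: "Q_ham n q Qc = (\<Sum>k<n. Q_comp n q Qc k \<star> coord (dbl n q) (n + k))"
  unfolding Q_ham_def Q_form_def Q_comp_def Let_def
  by (subst sum_rotate) (simp add: smul_sum_left sscale_simps)

lemma vfield_imp_odd_vector_field:
  assumes "vfield N q 1 D"
  shows "odd_vector_field N q D"
  unfolding odd_vector_field_def
proof (intro conjI ballI allI impI)
  fix f g r a assume f: "f \<in> Cinf N q"
  show "D f \<in> Cinf N q" using vfield_closed[OF assms f] .
  show "has_parity (a + 1) (D f)" if "has_parity a f"
    using vfield_parity[OF assms f that] by (simp add: add.commute)
  assume g: "g \<in> Cinf N q"
  show "D (f + r *\<^sub>s g) = D f + r *\<^sub>s D g"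
    using vfield_add[OF assms f Cinf_scale[OF g]] vfield_scale[OF assms g] by simp
  show "D (f \<star> g) = D f \<star> g + ksgn a *\<^sub>s (f \<star> D g)" if "has_parity a f"
    using vfield_mult[OF assms f g that] by simp
qed

definition momentum_wt :: "nat \<Rightarrow> nat \<Rightarrow> real" where
  "momentum_wt n c = (if c < n then 0 else 1)"

lemma momentum_wt_simps [simp]: "c < n \<Longrightarrow> momentum_wt n c = 0" "momentum_wt n (n + c) = 1"
  by (simp_all add: momentum_wt_def)

lemma Q_ham_weight:
  assumes "\<And>i j k. i < n \<Longrightarrow> j < n \<Longrightarrow> k < n \<Longrightarrow> w j + w i + w (n + k) = r"
  shows "weight (2 * n) (dbl n q) w r (Q_ham n q Qc)"
  unfolding Q_ham_def Q_form_def Let_def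
proof (intro weight_scale weight_sum)
  fix i j k assume "i \<in> {..<n}" "j \<in> {..<n}" "k \<in> {..<n}"
  then show "weight (2 * n) (dbl n q) w r (coord (dbl n q) j \<star> coord (dbl n q) i \<star> coord (dbl n q) (n + k))"
    using weight_triple[of j "2 * n" i "n + k" "dbl n q" w] assms[of i j k] by simp
qed

lemma S_ham_weight:
  assumes "\<And>i j k. i < n \<Longrightarrow> j < n \<Longrightarrow> k < n \<Longrightarrow> w k + w (n + j) + w (n + i) = r"
  shows "weight (2 * n) (dbl n q) w r (S_ham n q Sc)"
  unfolding S_ham_def S_form_def Let_def
proof (intro weight_scale weight_sum)
  fix k i j assume "i \<in> {..<n}" "j \<in> {..<n}" "k \<in> {..<n}"
  then show "weight (2 * n) (dbl n q) w r (coord (dbl n q) k \<star> coord (dbl n q) (n + j) \<star> coord (dbl n q) (n + i))"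
    using weight_triple[of k "2 * n" "n + j" "n + i" "dbl n q" w] assms[of i j k] by simp
qed

lemma poly_deg_Q_ham: "poly_deg (2 * n) (dbl n q) 3 (Q_ham n q Qc)"
  unfolding Q_ham_def Q_form_def Let_def by (intro poly_deg_scale poly_deg_sum poly_deg_3_triple) auto

lemma poly_deg_S_ham: "poly_deg (2 * n) (dbl n q) 3 (S_ham n q Sc)"
  unfolding S_ham_def S_form_def Let_def by (intro poly_deg_scale poly_deg_sum poly_deg_3_triple) auto

lemma Q_form_Cinf: "Q_form n q Qc \<in> Cinf (2 * n) (dbl n q)"
  unfolding Q_form_def Let_def by (intro Cinf_sum Cinf_scale Cinf_mult Cinf_coord) auto

lemma S_form_Cinf: "S_form n q Sc \<in> Cinf (2 * n) (dbl n q)"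
  unfolding S_form_def Let_def by (intro Cinf_sum Cinf_scale Cinf_mult Cinf_coord) auto

lemma Q_ham_Cinf: "Q_ham n q Qc \<in> Cinf (2 * n) (dbl n q)"
  unfolding Q_ham_def by (intro Cinf_scale Q_form_Cinf)

lemma S_ham_Cinf: "S_ham n q Sc \<in> Cinf (2 * n) (dbl n q)"
  unfolding S_ham_def by (intro Cinf_scale S_form_Cinf)

text \<open>For odd \<open>H\<close> the Jacobi identity with \<open>H\<close> in the first two
  places says that twice the square of the field is the field of \<open>{H, H}\<close>.\<close>

lemma homological_ham_field:
  assumes "H \<in> Cinf (2 * n) (dbl n q)" "has_parity 1 H" "poisson n q H H = 0"
  shows "homological (2 * n) (dbl n q) (ham_field n q H)"
proof -
  have "poisson n q H (poisson n q H f) = 0" if "f \<in> Cinf (2 * n) (dbl n q)" for f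
  proof -
    have "poisson n q H (poisson n q H f) = - poisson n q H (poisson n q H f)"
      using poisson_jacobi[OF assms(1,2) assms(1,2) that] assms(3) by simp
    then have "(1 + 1) *\<^sub>s poisson n q H (poisson n q H f) = 0"
      unfolding sscale.scale_left_distrib by (simp add: eq_neg_iff_add_eq_0)
    then show ?thesis by simp
  qed
  then show ?thesis
    using vfield_imp_odd_vector_field[OF vfield_poisson(1)[OF assms(1,2)]]
    by (simp add: homological_def ham_field_def)
qed


context
  fixes n q Qc
  assumes hom: "homological n q (Q_field n q Qc)"
begin

text \<open>The components get their parities from the oddness contained in
  \<open>homological\<close>, applied to the coordinates.\<close>

lemma vfield_Q_field: "vfield n q 1 (Q_field n q Qc)"
  and Q_field_coord: "k < n \<Longrightarrow> Q_field n q Qc (coord q k) = Q_comp n q Qc k"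
proof -
  show co: "Q_field n q Qc (coord q k) = Q_comp n q Qc k" if "k < n" for k
    by (rule vector_field_coord[OF Cinf_Q_comp that Q_field_eq])
  have "has_parity (1 + q k) (Q_field n q Qc (coord q k))" if "k < n" for k
    using hom Cinf_coord[OF that, of q] has_parity_coord[of q k]
    by (auto simp: homological_def odd_vector_field_def add.commute[of 1])
  then show "vfield n q 1 (Q_field n q Qc)"
    by (intro vfieldI(1)[OF Cinf_Q_comp _ Q_field_eq]) (simp add: co)
qed

lemma has_parity_Q_comp: "k < n \<Longrightarrow> has_parity (1 + q k) (Q_comp n q Qc k)"
  using vfield_coord(2)[OF vfield_Q_field] Q_field_coord by metis

lemma has_parity_Q_ham: "has_parity 1 (Q_ham n q Qc)"
proof -
  have "has_parity (1 + q k + dbl n q (n + k)) (Q_comp n q Qc k \<star> coord (dbl n q) (n + k))" if "k < n" for k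
    by (intro has_parity_mult has_parity_Q_comp has_parity_coord that)
  then show ?thesis unfolding Q_ham_eq by (intro has_parity_sum) (simp add: add.assoc)
qed

lemma sderiv_Q_ham:
  assumes "c < n"
  shows "sderiv (dbl n q) (n + c) (Q_ham n q Qc) = Q_comp n q Qc c"
    and "sderiv q c (Q_ham n q Qc) = (\<Sum>k<n. sderiv q c (Q_comp n q Qc k) \<star> coord (dbl n q) (n + k))"
proof -
  have *: "sderiv (dbl n q) b (Q_ham n q Qc) = (\<Sum>k<n. sderiv (dbl n q) b (Q_comp n q Qc k) \<star> coord (dbl n q) (n + k)
      + ksgn (dbl n q b * (1 + q k)) *\<^sub>s (Q_comp n q Qc k \<star> (if b = n + k then sone else 0)))" if "b < 2 * n" for b
  proof -
    have "sderiv (dbl n q) b (Q_comp n q Qc k \<star> coord (dbl n q) (n + k)) =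
      sderiv (dbl n q) b (Q_comp n q Qc k) \<star> coord (dbl n q) (n + k)
      + ksgn (dbl n q b * (1 + q k)) *\<^sub>s (Q_comp n q Qc k \<star> (if b = n + k then sone else 0))" if "k < n" for k
      using sderiv_mult[OF has_parity_Q_comp[OF that] Cinf_dbl[OF Cinf_Q_comp] Cinf_coord[of "n + k" "2 * n"] \<open>b < 2 * n\<close>]
        that unfolding sderiv_coord by simp
    then show ?thesis
      unfolding Q_ham_eq using that
      by (subst sderiv_sum[of _ _ "2 * n"]) (auto intro!: Cinf_mult Cinf_coord Cinf_dbl[OF Cinf_Q_comp])
  qed
  have "ksgn (q c * (1 + q c)) = 1" by (cases "q c"; simp)
  then have "(\<Sum>k<n. ksgn (q c * (1 + q k)) *\<^sub>s (Q_comp n q Qc k \<star> (if c = k then sone else 0))) =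
    (\<Sum>k<n. if c = k then Q_comp n q Qc k else 0)"
    by (intro sum.cong) (auto simp: smul_sone_right[OF Cinf_Q_comp])
  then show "sderiv (dbl n q) (n + c) (Q_ham n q Qc) = Q_comp n q Qc c"
    using *[of "n + c"] assms by (simp add: sderiv_beyond[OF Cinf_Q_comp])
  show "sderiv q c (Q_ham n q Qc) = (\<Sum>k<n. sderiv q c (Q_comp n q Qc k) \<star> coord (dbl n q) (n + k))"
    using *[of c] assms by simp
qed

lemma poisson_Q_ham_base: "f \<in> Cinf n q \<Longrightarrow> poisson n q (Q_ham n q Qc) f = Q_field n q Qc f"
  unfolding poisson_base[OF has_parity_Q_ham] Q_field_eq by (simp add: sderiv_Q_ham)

text \<open>In \<open>{Q, v_k \<eta>_k}\<close> the first Leibniz term contains the field applied to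
  its own component \<open>v_k\<close>, which is the square of the field on a coordinate. The second
  terms add up to the sum of the same expressions times momenta, so they vanish too.\<close>

lemma poisson_Q_ham_self: "poisson n q (Q_ham n q Qc) (Q_ham n q Qc) = 0"
proof -
  let ?Q = "Q_ham n q Qc" and ?D = "Q_field n q Qc" and ?v = "Q_comp n q Qc"
    and ?\<eta> = "\<lambda>k. coord (dbl n q) (n + k)"
  note vf = vfield_poisson[OF Q_ham_Cinf has_parity_Q_ham]
  have D0: "?D (?v k) = 0" if "k < n" for k
    using hom Q_field_coord[OF that] Cinf_coord[OF that] unfolding homological_def by metis
  have "poisson n q ?Q ?Q = (\<Sum>k<n. poisson n q ?Q (?v k \<star> ?\<eta> k))"
    by (subst (2) Q_ham_eq, rule vfield_sum[OF vf(1)]) (auto intro!: Cinf_mult Cinf_coord Cinf_dbl[OF Cinf_Q_comp])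
  also have "\<dots> = (\<Sum>k<n. ?v k \<star> sderiv q k ?Q)"
  proof (rule sum.cong[OF refl])
    fix k assume "k \<in> {..<n}"
    then have k: "k < n" by simp
    have "ksgn (1 + q k) * ksgn (q k) = - 1" by (cases "q k"; simp)
    then show "poisson n q ?Q (?v k \<star> ?\<eta> k) = ?v k \<star> sderiv q k ?Q"
      using k vf(3)[OF k]
      by (simp add: vfield_mult[OF vf(1) Cinf_dbl[OF Cinf_Q_comp] Cinf_coord has_parity_Q_comp[OF k]]
          poisson_Q_ham_base[OF Cinf_Q_comp] D0)
  qed
  also have "\<dots> = (\<Sum>k<n. \<Sum>j<n. ?v k \<star> sderiv q k (?v j) \<star> ?\<eta> j)"
    by (simp add: sderiv_Q_ham smul_sum_right smul_assoc)
  also have "\<dots> = (\<Sum>j<n. ?D (?v j) \<star> ?\<eta> j)"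
    by (subst sum.swap) (simp add: Q_field_eq smul_sum_left)
  finally show ?thesis by (simp add: D0)
qed

end

text \<open>Euler's identity in the momenta, applied first to the derivatives of \<open>T\<close>,
  of degree 1, and then to \<open>T\<close> itself.\<close>

lemma momentum_quadratic_eq_0:
  assumes T: "weight (2 * n) (dbl n q) (momentum_wt n) 2 T"
    and 0: "\<And>b c. b < n \<Longrightarrow> c < n \<Longrightarrow> sderiv (dbl n q) (n + b) (sderiv (dbl n q) (n + c) T) = 0"
  shows "T = 0"
proof -
  have *: "euler (2 * n) (dbl n q) (momentum_wt n) f = (\<Sum>c<n. coord (dbl n q) (n + c) \<star> sderiv (dbl n q) (n + c) f)" for f
    unfolding euler_def sum_dbl by simp
  have "sderiv (dbl n q) (n + c) T = 0" if "c < n" for c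
  proof -
    have "weight (2 * n) (dbl n q) (momentum_wt n) 1 (sderiv (dbl n q) (n + c) T)"
      using weight_sderiv[OF T, of "n + c"] that by simp
    then have "sderiv (dbl n q) (n + c) T = euler (2 * n) (dbl n q) (momentum_wt n) (sderiv (dbl n q) (n + c) T)"
      by (simp add: weight_def)
    also have "\<dots> = 0" unfolding * using 0 that by simp
    finally show ?thesis .
  qed
  then have "2 *\<^sub>s T = 0" using T unfolding weight_def * by simp
  then show ?thesis by simp
qed

text \<open>Two momentum derivatives leave a function of total degree 1 and momentum degree 0, hence
  a linear function on the base.\<close>

lemma S_ham_second_deriv:
  assumes "b < n" "c < n"
  shows "\<exists>r. sderiv (dbl n q) (n + b) (sderiv (dbl n q) (n + c) (S_ham n q Sc)) = (\<Sum>k<n. r k *\<^sub>s coord q k) \<and>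
    (\<forall>k<n. sderiv q k (sderiv (dbl n q) (n + b) (sderiv (dbl n q) (n + c) (S_ham n q Sc))) = r k *\<^sub>s sone)"
proof -
  let ?S = "S_ham n q Sc" and ?d = "dbl n q"
  let ?G = "sderiv ?d (n + b) (sderiv ?d (n + c) ?S)"
  have "weight (2 * n) ?d (\<lambda>c. 1) 3 ?S" by (rule S_ham_weight) simp
  then have tot: "weight (2 * n) ?d (\<lambda>c. 1) 1 ?G"
    using assms weight_sderiv[of "2 * n" ?d "\<lambda>c. 1" 2 "sderiv ?d (n + c) ?S" "n + b"]
      weight_sderiv[of "2 * n" ?d "\<lambda>c. 1" 3 ?S "n + c"] by simp
  have "weight (2 * n) ?d (momentum_wt n) 2 ?S" by (rule S_ham_weight) simp
  then have mom: "weight (2 * n) ?d (momentum_wt n) 0 ?G"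
    using assms weight_sderiv[of "2 * n" ?d "momentum_wt n" 1 "sderiv ?d (n + c) ?S" "n + b"]
      weight_sderiv[of "2 * n" ?d "momentum_wt n" 2 ?S "n + c"] by simp
  have "\<exists>r. sderiv ?d k ?G = r *\<^sub>s sone" if "k < 2 * n" for k
    using poly_deg_S_ham[of n q Sc] assms that by (simp add: numeral_3_eq_3)
  then obtain r where r: "\<And>k. k < 2 * n \<Longrightarrow> sderiv ?d k ?G = r k *\<^sub>s sone" by metis
  \<comment> \<open>One more momentum derivative would be a constant of momentum weight -1.\<close>
  have "r (n + k) = 0" if "k < n" for k
    using weight_const[of "2 * n" ?d "momentum_wt n" "- 1"] weight_sderiv[OF mom, of "n + k"] r[of "n + k"] that
    by simp
  moreover have "?G = (\<Sum>k<2 * n. r k *\<^sub>s coord ?d k)"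
    by (rule weight_one_linear[OF tot r])
  moreover have "\<forall>k<n. sderiv q k ?G = r k *\<^sub>s sone"
    using r sderiv_dbl by (metis trans_less_add1 mult_2)
  ultimately show ?thesis
    by (intro exI[of _ r] conjI) (simp_all add: sum_dbl)
qed

lemma S_ham_second_deriv_Cinf:
  assumes "b < n" "c < n"
  shows "sderiv (dbl n q) (n + b) (sderiv (dbl n q) (n + c) (S_ham n q Sc)) \<in> Cinf n q"
proof -
  obtain r where "sderiv (dbl n q) (n + b) (sderiv (dbl n q) (n + c) (S_ham n q Sc)) = (\<Sum>k<n. r k *\<^sub>s coord q k)"
    using S_ham_second_deriv[OF assms] by blast
  then show ?thesis by (auto intro!: Cinf_sum Cinf_scale Cinf_coord)
qed

lemma QS_condition_iff:
  assumes hom: "homological n q (Q_field n q Qc)"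
    and S1: "has_parity 1 (S_ham n q Sc)"
  shows "QS_condition n q (Q_field n q Qc) (S_ham n q Sc) \<longleftrightarrow> poisson n q (Q_ham n q Qc) (S_ham n q Sc) = 0"
proof -
  let ?D = "Q_field n q Qc" and ?S = "S_ham n q Sc" and ?Q = "Q_ham n q Qc" and ?d = "dbl n q"
  let ?T = "poisson n q ?Q ?S"
  note Q = Q_ham_Cinf[of n q Qc] has_parity_Q_ham[OF hom]
  note S = S_ham_Cinf[of n q Sc] S1
  have "has_parity (1 + 1) ?T"
    by (rule vfield_parity[OF vfield_poisson(1)[OF Q] S])
  then have T: "?T \<in> Cinf (2 * n) ?d" "has_parity 0 ?T"
    using poisson_closed[OF Q(1) S(1)] by simp_all
  \<comment> \<open>Two uses of the Jacobi identity move \<open>Q\<close> through the iterated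
    bracket; the last summand is the obstruction to the derivation rule.\<close>
  have main: "?D (poisson n q f (poisson n q ?S g)) =
      poisson n q (?D f) (poisson n q ?S g) + ksgn (a + 1) *\<^sub>s poisson n q f (poisson n q ?S (?D g))
      + ksgn a *\<^sub>s poisson n q f (poisson n q ?T g)"
    if f: "f \<in> Cinf n q" "has_parity a f" and g: "g \<in> Cinf n q" for f g a
  proof -
    note fd = Cinf_dbl[OF f(1)] f(2) and gd = Cinf_dbl[OF g]
    have closed: "poisson n q ?S g \<in> Cinf (2 * n) ?d" "poisson n q ?T g \<in> Cinf (2 * n) ?d"
      "poisson n q ?S (?D g) \<in> Cinf (2 * n) ?d"
      by (intro poisson_closed S(1) T(1) gd Cinf_dbl[OF vfield_closed[OF vfield_Q_field[OF hom] g]])+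
    \<comment> \<open>The Schouten bracket of functions on the base is again a function on the base;
      only there does the field agree with the bracket with \<open>Q\<close>.\<close>
    have "poisson n q f (poisson n q ?S g) \<in> Cinf n q"
      unfolding poisson_base_base[OF S f g]
      using f g by (intro Cinf_sum Cinf_minus Cinf_scale Cinf_mult Cinf_sderiv S_ham_second_deriv_Cinf) auto
    then have "?D (poisson n q f (poisson n q ?S g)) = poisson n q ?Q (poisson n q f (poisson n q ?S g))"
      using poisson_Q_ham_base[OF hom] by simp
    also have "\<dots> = poisson n q (?D f) (poisson n q ?S g) + ksgn a *\<^sub>s poisson n q f (poisson n q ?Q (poisson n q ?S g))"
      using poisson_jacobi[OF Q fd closed(1)] poisson_Q_ham_base[OF hom f(1)] by simp
    also have "poisson n q ?Q (poisson n q ?S g) = poisson n q ?T g - poisson n q ?S (?D g)"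
      using poisson_jacobi[OF Q S gd] poisson_Q_ham_base[OF hom g] by simp
    also have "poisson n q f (poisson n q ?T g - poisson n q ?S (?D g)) =
        poisson n q f (poisson n q ?T g) - poisson n q f (poisson n q ?S (?D g))"
      by (rule vfield_diff[OF vfield_poisson(1)[OF fd] closed(2,3)])
    finally show ?thesis by (simp add: ksgn_add sscale_simps algebra_simps)
  qed
  show ?thesis
  proof
    assume QS: "QS_condition n q ?D ?S"
    show "?T = 0"
    proof (rule momentum_quadratic_eq_0)
      \<comment> \<open>Momentum degrees add, and each canonical bracket removes one
        momentum.\<close>
      have "weight (2 * n) ?d (momentum_wt n) (1 + 2 - 1) ?T"
        by (intro weight_poisson[OF _ Q(2)] Q_ham_weight S_ham_weight) simp_all
      then show "weight (2 * n) ?d (momentum_wt n) 2 ?T" by simp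
      fix b c assume bc: "b < n" "c < n"
      \<comment> \<open>With coordinates for \<open>f\<close> and \<open>g\<close> the obstruction
        is, up to sign, a second momentum derivative of \<open>{Q, S}\<close>.\<close>
      have "poisson n q (coord q b) (poisson n q ?T (coord q c)) = 0"
        using QS main[OF Cinf_coord[OF bc(1)] has_parity_coord Cinf_coord[OF bc(2)]]
          Cinf_coord[OF bc(1), of q] has_parity_coord[of q b] Cinf_coord[OF bc(2), of q]
        unfolding QS_condition_def schouten_bracket_def by auto
      then show "sderiv ?d (n + b) (sderiv ?d (n + c) ?T) = 0"
        using vfield_poisson(2)[OF T bc(2)] bc poisson_coord_left(1)[OF bc(1), of "ksgn (q c) *\<^sub>s sderiv ?d (n + c) ?T" q]
          sderiv_scale[of "sderiv ?d (n + c) ?T" "2 * n" ?d "n + b"] T(1)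
        by (simp add: Cinf_scale Cinf_sderiv)
    qed
  next
    assume T0: "?T = 0"
    have "poisson n q f 0 = 0" if "f \<in> Cinf n q" "has_parity a f" for f a
      using vfield_zero[OF vfield_poisson(1)[OF Cinf_dbl[OF that(1)] that(2)]] .
    then show "QS_condition n q ?D ?S"
      unfolding QS_condition_def schouten_bracket_def using main T0 by simp
  qed
qed

subsection \<open>The Lie superalgebra of a quadratic homological field\<close>

text \<open>The hypothesis \<open>comm\<close> says \<open>[y, [x, [D, z]]] = 0\<close>; bracketing it with \<open>D\<close> turns the last term into
  a bracket of \<open>[D, y]\<close> with \<open>[x, [D, z]]\<close>, and what remains follows from \<open>D\<^sup>2 = 0\<close> alone.\<close>

lemma derived_bracket_jacobi:
  fixes x y z D :: "sfun \<Rightarrow> sfun"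
  defines "br a b u v \<equiv> scomm (a + 1) (1 + (b + 1)) u (scomm 1 (b + 1) D v)"
  assumes x: "vfield N q (a + 1) x" and y: "vfield N q (b + 1) y" and z: "vfield N q (c + 1) z"
    and D: "vfield N q 1 D" "\<And>u. u \<in> Cinf N q \<Longrightarrow> D (D u) = 0"
    and comm: "\<And>u. u \<in> Cinf N q \<Longrightarrow> br a c x z (y u) = ksgn ((b + 1) * (a + c + 1)) *\<^sub>s y (br a c x z u)"
    and f: "f \<in> Cinf N q"
  shows "br a (b + c) x (br b c y z) f =
    br (a + b) c (br a b x y) z f + ksgn (a * b) *\<^sub>s br b (a + c) y (br a c x z) f"
proof -
  \<comment> \<open>Collecting equal terms produces pointwise multiples \<open>2 * u\<close>, so the
    fields must also be known to respect these.\<close>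
  have two: "2 * u = u + u" for u :: sfun
    by (rule mult_2)
  have two_op: "E (2 * u) = 2 * E u" if "vfield N q e E" "u \<in> Cinf N q" for E u e
    unfolding two by (rule vfield_add[OF that that(2)])
  have two_Cinf: "2 * u \<in> Cinf N q" if "u \<in> Cinf N q" for u
    unfolding two by (rule Cinf_add[OF that that])
  define W where "W = br a c x z"
  have W: "vfield N q (a + 1 + (1 + (c + 1))) W"
    unfolding W_def br_def by (intro vfield_scomm x z D)
  note gen = two_Cinf Cinf_add[of _ N q] Cinf_diff[of _ N q] Cinf_minus[of _ N q] f D(2)
    vfield_closed[OF D(1)] vfield_add[OF D(1)] vfield_diff[OF D(1)] vfield_minus[OF D(1)] two_op[OF D(1)]
    vfield_zero[OF D(1)]
  note ops = two_op[OF x] two_op[OF z] vfield_closed[OF x] vfield_closed[OF z]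
    vfield_add[OF x] vfield_add[OF z] vfield_diff[OF x] vfield_diff[OF z]
    vfield_minus[OF x] vfield_minus[OF z] vfield_zero[OF x] vfield_zero[OF z]
  note yops = two_op[OF y] vfield_closed[OF y] vfield_add[OF y] vfield_diff[OF y] vfield_minus[OF y] vfield_zero[OF y]
  note Wops = two_op[OF W] vfield_closed[OF W] vfield_add[OF W] vfield_diff[OF W] vfield_minus[OF W] vfield_zero[OF W]
  have "W (y u) = ksgn ((b + 1) * (a + c + 1)) *\<^sub>s y (W u)" if "u \<in> Cinf N q" for u
    using comm[OF that] by (simp add: W_def)
  then have "br b (a + c) y W f = - (ksgn (b + 1) *\<^sub>s scomm b (a + c + 1) (scomm 1 (b + 1) D y) W f)"
    unfolding br_def scomm_def by (cases b; cases "a + c"; simp add: gen yops Wops)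
  \<comment> \<open>This is pure expansion of the nested commutators with
    \<open>D (D u) = 0\<close>, one parity case at a time.\<close>
  moreover have "br a (b + c) x (br b c y z) f = br (a + b) c (br a b x y) z f
      - ksgn (a * b + (b + 1)) *\<^sub>s scomm b (a + c + 1) (scomm 1 (b + 1) D y) W f"
    unfolding W_def br_def scomm_def
    by (cases a; cases b; cases c; simp add: gen ops yops)
  ultimately show ?thesis by (simp add: ksgn_add flip: W_def)
qed

section \<open>Homogeneous vectors and constant fields\<close>

lemma bvec_vspace [simp]: "i < N \<Longrightarrow> bvec i \<in> vspace N"
  by (auto simp: bvec_def vspace_def)

lemma bvec_vhom: "i < N \<Longrightarrow> bvec i \<in> vhom N p (p i)"
  by (auto simp: bvec_def vspace_def vhom_def)

lemma vhom_vspace: "X \<in> vhom N p a \<Longrightarrow> X \<in> vspace N"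
  by (simp add: vhom_def)

lemma vhom_parity: "X \<in> vhom N p a \<Longrightarrow> X i \<noteq> 0 \<Longrightarrow> p i = a"
  by (auto simp: vhom_def vspace_def) (meson not_less)

lemma vhom_component: "X \<in> vhom N p a \<Longrightarrow> ksgn (p i) * X i = ksgn a * X i"
  using vhom_parity by fastforce

lemma vhomI: "(\<And>i. i \<ge> N \<Longrightarrow> X i = 0) \<Longrightarrow> (\<And>i. i < N \<Longrightarrow> X i \<noteq> 0 \<Longrightarrow> p i = a) \<Longrightarrow> X \<in> vhom N p a"
  by (auto simp: vhom_def vspace_def)

lemma vspace_vhom_decomp:
  assumes "Z \<in> vspace N"
  obtains Z0 Z1 where "Z0 \<in> vhom N p 0" "Z1 \<in> vhom N p 1" "Z = Z0 + 1 *\<^sub>v Z1"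
proof
  let ?Z = "\<lambda>a i. if p i = a then Z i else 0"
  show "?Z 0 \<in> vhom N p 0" "?Z 1 \<in> vhom N p 1"
    using assms by (auto intro!: vhomI simp: vspace_def split: if_splits)
  show "Z = ?Z 0 + 1 *\<^sub>v ?Z 1"
  proof
    fix i show "Z i = (?Z 0 + 1 *\<^sub>v ?Z 1) i" by (cases "p i") (simp_all add: plus_fun_apply vscale_def)
  qed
qed

lemma sone_nonzero [simp]: "sone \<noteq> 0"
  using scale_sone_eq_0_iff[of 1] by auto

lemma Pi_par_simp: "Pi_par p i = p i + 1"
  by (simp add: Pi_par_def)

lemma has_parity_const: "has_parity a (r *\<^sub>s sone) \<Longrightarrow> r = 0 \<or> a = 0"
proof (rule disjCI)
  assume r: "has_parity a (r *\<^sub>s sone)" and a: "a \<noteq> 0"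
  then have "(r *\<^sub>s sone) {} = 0" unfolding has_parity_iff by auto
  then show "r = 0" by (simp add: sone_def sscale_apply zero_fun_apply fun_eq_iff)
qed

lemma vfield_const_field:
  assumes X: "X \<in> vhom N p a"
  shows "vfield N (Pi_par p) (a + 1) (const_field N p X)"
    and "k < N \<Longrightarrow> const_field N p X (coord (Pi_par p) k) = (ksgn (p k) * X k) *\<^sub>s sone"
proof -
  have 1: "(ksgn (p k) * X k) *\<^sub>s sone \<in> Cinf N (Pi_par p)" for k
    by (intro Cinf_scale Cinf_sone)
  have 2: "has_parity (a + 1 + Pi_par p k) ((ksgn (p k) * X k) *\<^sub>s sone)" for k
  proof (cases "X k = 0")
    case False
    then have "p k = a" using X vhom_parity by blast
    then have "a + 1 + Pi_par p k = 0" by (cases a; simp add: Pi_par_simp)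
    then show ?thesis by (simp add: has_parity_scale has_parity_sone)
  qed simp
  have 3: "const_field N p X f = (\<Sum>k<N. ((ksgn (p k) * X k) *\<^sub>s sone) \<star> sderiv (Pi_par p) k f)"
    if "f \<in> Cinf N (Pi_par p)" for f
    unfolding const_field_def using that
    by (intro sum.cong) (simp_all add: smul_sone_left[of _ N "Pi_par p"] Cinf_sderiv)
  show "vfield N (Pi_par p) (a + 1) (const_field N p X)"
    by (rule vfieldI(1)[OF 1 2 3])
  show "k < N \<Longrightarrow> const_field N p X (coord (Pi_par p) k) = (ksgn (p k) * X k) *\<^sub>s sone"
    by (rule vfieldI(2)[OF 1 2 3])
qed

text \<open>The commutator is a vector field, and it vanishes on coordinates because constant fields
  send them to constants.\<close>

lemma const_field_commute:
  assumes X: "X \<in> vhom N p a" and Y: "Y \<in> vhom N p b" and f: "f \<in> Cinf N (Pi_par p)"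
  shows "const_field N p Y (const_field N p X f) =
    ksgn ((a + 1) * (b + 1)) *\<^sub>s const_field N p X (const_field N p Y f)"
proof -
  note vX = vfield_const_field[OF X] and vY = vfield_const_field[OF Y]
  have "vfield N (Pi_par p) (a + 1 + (b + 1)) (\<lambda>f. 0)"
    by (rule vfieldI(1)[where v = "\<lambda>c. 0"]) simp_all
  moreover have "scomm (a + 1) (b + 1) (const_field N p X) (const_field N p Y) (coord (Pi_par p) k) = 0" if "k < N" for k
    using that unfolding scomm_def
    by (simp add: vX(2) vY(2) vfield_scale[OF vX(1)] vfield_scale[OF vY(1)] Cinf_sone
        vfield_sone[OF vX(1)] vfield_sone[OF vY(1)])
  ultimately have "scomm (a + 1) (b + 1) (const_field N p X) (const_field N p Y) f = 0"
    using vfield_eqI[OF vfield_scomm[OF vX(1) vY(1)] _ f, of _ "\<lambda>f. 0"] by blast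
  then have "const_field N p X (const_field N p Y f) =
      ksgn ((a + 1) * (b + 1)) *\<^sub>s const_field N p Y (const_field N p X f)"
    by (simp add: scomm_def)
  then show ?thesis by simp
qed

section \<open>Brackets given by structure constants\<close>

definition struct_bracket :: "nat \<Rightarrow> (nat \<Rightarrow> nat \<Rightarrow> nat \<Rightarrow> real) \<Rightarrow> vbracket" where
  "struct_bracket N c X Y = (\<lambda>k. if k < N then \<Sum>i<N. \<Sum>j<N. X i * Y j * c i j k else 0)"

lemma struct_bracket_vspace [simp]: "struct_bracket N c X Y \<in> vspace N"
  by (simp add: struct_bracket_def vspace_def)

lemma struct_bracket_linear:
  "struct_bracket N c (X + r *\<^sub>v Y) Z = struct_bracket N c X Z + r *\<^sub>v struct_bracket N c Y Z"
  "struct_bracket N c Z (X + r *\<^sub>v Y) = struct_bracket N c Z X + r *\<^sub>v struct_bracket N c Z Y"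
  by (auto simp: struct_bracket_def vscale_def plus_fun_apply fun_eq_iff sum_distrib_left algebra_simps sum.distrib)

context
  fixes N p D t
  assumes vf: "vfield N (Pi_par p) 1 D"
    and t: "\<And>i j k. i < N \<Longrightarrow> j < N \<Longrightarrow> k < N \<Longrightarrow>
      sderiv (Pi_par p) i (sderiv (Pi_par p) j (D (coord (Pi_par p) k))) = t i j k *\<^sub>s sone"
begin

text \<open>The factor for \<open>p k\<close> comes from the constant field of the bracket, that for
  \<open>p i\<close> from the constant field of the first argument. The sign of the constant field
  of the second argument cancels against the one produced by its commutator with
  \<open>D\<close>.\<close>

abbreviation (input) field_bracket where "field_bracket \<equiv> struct_bracket N (\<lambda>i j k. ksgn (p i + p k) * t i j k)"

lemma struct_parity:
  assumes "i < N" "j < N" "k < N" "t i j k \<noteq> 0"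
  shows "p k = p i + p j"
proof -
  let ?q = "Pi_par p"
  have "has_parity (1 + ?q k + ?q j + ?q i) (sderiv ?q i (sderiv ?q j (D (coord ?q k))))"
    using assms vfield_coord[OF vf]
    by (intro has_parity_sderiv[of _ _ N] Cinf_sderiv) auto
  then have "1 + ?q k + ?q j + ?q i = 0"
    using t[OF assms(1-3)] assms(4) has_parity_const by metis
  then show ?thesis by (cases "p i"; cases "p j"; cases "p k"; simp add: Pi_par_simp)
qed

text \<open>Graded symmetry of second derivatives in the shifted parities; after the parity shift it
  becomes graded antisymmetry of the bracket.\<close>

lemma struct_antisym:
  assumes "i < N" "j < N" "k < N"
  shows "t i j k = ksgn (Pi_par p i * Pi_par p j) * t j i k"
proof -
  have "t i j k *\<^sub>s sone = (ksgn (Pi_par p i * Pi_par p j) * t j i k) *\<^sub>s sone"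
    using sderiv_commute[OF vfield_coord(1)[OF vf assms(3)] assms(1,2)] t assms
    by simp
  then show ?thesis by (simp add: scale_sone_eq_iff)
qed

lemma field_bracket_vhom:
  assumes X: "X \<in> vhom N p a" and Y: "Y \<in> vhom N p b"
  shows "field_bracket X Y \<in> vhom N p (a + b)"
proof (rule vhomI)
  fix k assume k: "k < N" and "field_bracket X Y k \<noteq> 0"
  then have "(\<Sum>i<N. \<Sum>j<N. X i * Y j * (ksgn (p i + p k) * t i j k)) \<noteq> 0"
    by (simp add: struct_bracket_def)
  then obtain i where i: "i < N" and "(\<Sum>j<N. X i * Y j * (ksgn (p i + p k) * t i j k)) \<noteq> 0"
    by (rule sum.not_neutral_contains_not_neutral) auto
  from this(2) obtain j where j: "j < N" and "X i * Y j * (ksgn (p i + p k) * t i j k) \<noteq> 0"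
    by (rule sum.not_neutral_contains_not_neutral) auto
  then show "p k = a + b"
    using struct_parity[OF i j k] vhom_parity[OF X, of i] vhom_parity[OF Y, of j] by auto
qed (simp add: struct_bracket_def)

text \<open>Both sides are vector fields, so only coordinates need to be compared. There most terms
  vanish because constant fields send coordinates to constants, and what survives is a second
  derivative of a component of \<open>D\<close>.\<close>

lemma field_bracket_bracket_of_field: "bracket_of_field N p D field_bracket"
  unfolding bracket_of_field_def
proof (intro allI ballI)
  fix a b X Y f
  assume X: "X \<in> vhom N p a" and Y: "Y \<in> vhom N p b" and f: "f \<in> Cinf N (Pi_par p)"
  let ?q = "Pi_par p" and ?x = "const_field N p X" and ?y = "const_field N p Y"
  note x = vfield_const_field[OF X] and y = vfield_const_field[OF Y]
  note Dy = vfield_scomm[OF vf y(1)] and xy = vfield_const_field[OF field_bracket_vhom[OF X Y]]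
  show "const_field N p (field_bracket X Y) f = scomm (a + 1) (1 + (b + 1)) ?x (scomm 1 (b + 1) D ?y) f"
  proof (rule vfield_eqI[OF xy(1) vfield_scomm[OF x(1) Dy] f])
    fix k assume k: "k < N"
    let ?v = "D (coord ?q k)"
    have v: "?v \<in> Cinf N ?q" using vfield_coord(1)[OF vf k] .
    have 1: "scomm 1 (b + 1) D ?y (coord ?q k) = ksgn b *\<^sub>s ?y ?v"
      using k by (simp add: scomm_def y(2) vfield_scale[OF vf] vfield_sone[OF vf] Cinf_sone ksgn_add)
    have 2: "scomm 1 (b + 1) D ?y (?x (coord ?q k)) = 0"
      using k by (simp add: x(2) vfield_scale[OF Dy] vfield_sone[OF Dy] Cinf_sone)
    have "ksgn b *\<^sub>s ?y ?v = (\<Sum>j<N. Y j *\<^sub>s sderiv ?q j ?v)"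
      unfolding const_field_def sscale.scale_sum_right sscale.scale_scale
    proof (rule sum.cong[OF refl])
      fix j
      have "ksgn b * (ksgn (p j) * Y j) = Y j" unfolding vhom_component[OF Y] by simp
      then show "(ksgn b * (ksgn (p j) * Y j)) *\<^sub>s sderiv ?q j ?v = Y j *\<^sub>s sderiv ?q j ?v" by simp
    qed
    then have "?x (ksgn b *\<^sub>s ?y ?v) = (\<Sum>j<N. Y j *\<^sub>s ?x (sderiv ?q j ?v))"
      using v by (simp only:) (subst vfield_sum[OF x(1)],
          auto intro!: Cinf_scale Cinf_sderiv sum.cong vfield_scale[OF x(1)])
    also have "\<dots> = (\<Sum>j<N. \<Sum>i<N. (ksgn (p k) * (X i * Y j * (ksgn (p i + p k) * t i j k))) *\<^sub>s sone)"
      unfolding const_field_def sscale.scale_sum_right sscale.scale_scale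
    proof (intro sum.cong refl)
      fix i j assume "j \<in> {..<N}" "i \<in> {..<N}"
      moreover have "Y j * (ksgn (p i) * X i) * t i j k = ksgn (p k) * (X i * Y j * (ksgn (p i + p k) * t i j k))"
        by (cases "p i"; cases "p k"; simp)
      ultimately show "(Y j * (ksgn (p i) * X i)) *\<^sub>s sderiv ?q i (sderiv ?q j ?v) =
          (ksgn (p k) * (X i * Y j * (ksgn (p i + p k) * t i j k))) *\<^sub>s sone"
        using t[of i j k] k by simp
    qed
    also have "\<dots> = (ksgn (p k) * field_bracket X Y k) *\<^sub>s sone"
      using k by (subst sum.swap) (simp add: struct_bracket_def sum_distrib_left sscale.scale_sum_left)
    finally show "const_field N p (field_bracket X Y) (coord ?q k) =
        scomm (a + 1) (1 + (b + 1)) ?x (scomm 1 (b + 1) D ?y) (coord ?q k)"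
      unfolding scomm_def[of "a + 1"] 1 2 using xy(2)[OF k] by simp
  qed
qed

lemma field_bracket_antisym:
  assumes X: "X \<in> vhom N p a" and Y: "Y \<in> vhom N p b"
  shows "field_bracket X Y = - (ksgn (a * b) *\<^sub>v field_bracket Y X)"
proof
  fix k
  show "field_bracket X Y k = (- (ksgn (a * b) *\<^sub>v field_bracket Y X)) k"
  proof (cases "k < N")
    case k: True
    have "X i * Y j * (ksgn (p i + p k) * t i j k) = - (ksgn (a * b) * (Y j * X i * (ksgn (p j + p k) * t j i k)))"
      if "i < N" "j < N" for i j
    proof (cases "X i = 0 \<or> Y j = 0")
      case False
      then have "p i = a" "p j = b" using X Y vhom_parity by blast+
      then show ?thesis using struct_antisym[OF that k]
        by (cases a; cases b; cases "p k"; simp add: Pi_par_simp)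
    qed auto
    then have "field_bracket X Y k = (\<Sum>i<N. \<Sum>j<N. - (ksgn (a * b) * (Y j * X i * (ksgn (p j + p k) * t j i k))))"
      using k by (simp add: struct_bracket_def)
    also have "\<dots> = - (ksgn (a * b) * field_bracket Y X k)"
      using k by (subst sum.swap) (simp add: struct_bracket_def sum_distrib_left sum_negf)
    finally show ?thesis by (simp add: uminus_apply vscale_def)
  qed (simp add: struct_bracket_def uminus_apply vscale_def)
qed

text \<open>A vector can be recovered from its constant field by evaluation on coordinates, so the
  Jacobi identity may be checked on the fields, where it is
  \<open>derived_bracket_jacobi\<close>.\<close>

lemma field_bracket_lie_superalgebra:
  assumes D0: "\<And>f. f \<in> Cinf N (Pi_par p) \<Longrightarrow> D (D f) = 0"
  shows "lie_superalgebra N p field_bracket"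
  unfolding lie_superalgebra_def
proof (intro conjI ballI allI)
  show "field_bracket X Y \<in> vhom N p (a + b)" if "X \<in> vhom N p a" "Y \<in> vhom N p b" for a b X Y
    using field_bracket_vhom that .
  show "field_bracket X Y = - (ksgn (a * b) *\<^sub>v field_bracket Y X)" if "X \<in> vhom N p a" "Y \<in> vhom N p b" for a b X Y
    using field_bracket_antisym that .
  have jac: "field_bracket X (field_bracket Y Z) = field_bracket (field_bracket X Y) Z + ksgn (a * b) *\<^sub>v field_bracket Y (field_bracket X Z)"
    if X: "X \<in> vhom N p a" and Y: "Y \<in> vhom N p b" and Z: "Z \<in> vhom N p c" for a b c X Y Z
  proof
    fix k
    show "field_bracket X (field_bracket Y Z) k = (field_bracket (field_bracket X Y) Z + ksgn (a * b) *\<^sub>v field_bracket Y (field_bracket X Z)) k"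
    proof (cases "k < N")
      case k: True
      let ?i = "const_field N p"
      have B: "?i (field_bracket U V) f = scomm (a + 1) (1 + (b + 1)) (?i U) (scomm 1 (b + 1) D (?i V)) f"
        if "U \<in> vhom N p a" "V \<in> vhom N p b" "f \<in> Cinf N (Pi_par p)" for U V a b f
        using field_bracket_bracket_of_field that unfolding bracket_of_field_def by blast
      \<comment> \<open>The correspondence holds on \<open>Cinf\<close> only; substituting it inside
        a commutator requires that \<open>D\<close> preserves \<open>Cinf\<close>.\<close>
      have BB: "scomm a (b + 1) D (?i (field_bracket U V)) f =
          scomm a (b + 1) D (scomm (c + 1) (1 + (d + 1)) (?i U) (scomm 1 (d + 1) D (?i V))) f"
        if "U \<in> vhom N p c" "V \<in> vhom N p d" "f \<in> Cinf N (Pi_par p)" for U V a b c d f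
        using B[OF that(1,2)] that(3) vfield_closed[OF vf] by (simp add: scomm_def)
      note co = Cinf_coord[OF k, of "Pi_par p"]
      note cl = vfield_closed[OF vf] vfield_closed[OF vfield_const_field(1)[OF X]]
        vfield_closed[OF vfield_const_field(1)[OF Y]] vfield_closed[OF vfield_const_field(1)[OF Z]]
      have e1: "?i (field_bracket X (field_bracket Y Z)) (coord (Pi_par p) k) = scomm (a + 1) (1 + (b + c + 1)) (?i X)
          (scomm 1 (b + c + 1) D (scomm (b + 1) (1 + (c + 1)) (?i Y) (scomm 1 (c + 1) D (?i Z)))) (coord (Pi_par p) k)"
        unfolding B[OF X field_bracket_vhom[OF Y Z] co] using BB[OF Y Z] co cl by (simp add: scomm_def[of "a + 1"])
      have e2: "?i (field_bracket Y (field_bracket X Z)) (coord (Pi_par p) k) = scomm (b + 1) (1 + (a + c + 1)) (?i Y)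
          (scomm 1 (a + c + 1) D (scomm (a + 1) (1 + (c + 1)) (?i X) (scomm 1 (c + 1) D (?i Z)))) (coord (Pi_par p) k)"
        unfolding B[OF Y field_bracket_vhom[OF X Z] co] using BB[OF X Z] co cl by (simp add: scomm_def[of "b + 1"])
      have Dz: "scomm 1 (c + 1) D (?i Z) f \<in> Cinf N (Pi_par p)" if "f \<in> Cinf N (Pi_par p)" for f
        using that cl by (simp add: scomm_def Cinf_diff Cinf_scale)
      have e3: "?i (field_bracket (field_bracket X Y) Z) (coord (Pi_par p) k) = scomm (a + b + 1) (1 + (c + 1))
          (scomm (a + 1) (1 + (b + 1)) (?i X) (scomm 1 (b + 1) D (?i Y))) (scomm 1 (c + 1) D (?i Z)) (coord (Pi_par p) k)"
        unfolding B[OF field_bracket_vhom[OF X Y] Z co] using B[OF X Y] Dz co by (simp add: scomm_def[of "a + b + 1"])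
      \<comment> \<open>The derived bracket of two constant fields is again a constant field, hence
        commutes with the third one.\<close>
      have comm: "scomm (a + 1) (1 + (c + 1)) (?i X) (scomm 1 (c + 1) D (?i Z)) (?i Y u) = ksgn ((b + 1) * (a + c + 1)) *\<^sub>s
          ?i Y (scomm (a + 1) (1 + (c + 1)) (?i X) (scomm 1 (c + 1) D (?i Z)) u)" if "u \<in> Cinf N (Pi_par p)" for u
        unfolding B[OF X Z that, symmetric] B[OF X Z cl(3)[OF that], symmetric]
        by (rule const_field_commute[OF Y field_bracket_vhom[OF X Z] that])
      have "?i (field_bracket X (field_bracket Y Z)) (coord (Pi_par p) k) =
          ?i (field_bracket (field_bracket X Y) Z) (coord (Pi_par p) k) + ksgn (a * b) *\<^sub>s ?i (field_bracket Y (field_bracket X Z)) (coord (Pi_par p) k)"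
        unfolding e1 e2 e3
        by (rule derived_bracket_jacobi[OF vfield_const_field(1)[OF X] vfield_const_field(1)[OF Y]
              vfield_const_field(1)[OF Z] vf D0 comm co])
      then have "(ksgn (p k) * field_bracket X (field_bracket Y Z) k) *\<^sub>s sone =
          (ksgn (p k) * field_bracket (field_bracket X Y) Z k + ksgn (a * b) * (ksgn (p k) * field_bracket Y (field_bracket X Z) k)) *\<^sub>s sone"
        unfolding vfield_const_field(2)[OF field_bracket_vhom[OF X field_bracket_vhom[OF Y Z]] k]
          vfield_const_field(2)[OF field_bracket_vhom[OF field_bracket_vhom[OF X Y] Z] k]
          vfield_const_field(2)[OF field_bracket_vhom[OF Y field_bracket_vhom[OF X Z]] k]
        by (simp only: sscale.scale_left_distrib sscale.scale_scale)
      then show ?thesis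
        unfolding scale_sone_eq_iff by (cases "p k") (simp_all add: plus_fun_apply vscale_def)
    qed (simp add: struct_bracket_def plus_fun_apply vscale_def)
  qed
  show "field_bracket X (field_bracket Y Z) = field_bracket (field_bracket X Y) Z + ksgn (a * b) *\<^sub>v field_bracket Y (field_bracket X Z)"
    if X: "X \<in> vhom N p a" and Y: "Y \<in> vhom N p b" and "Z \<in> vspace N" for a b X Y Z
  proof -
    obtain Z0 Z1 where Z: "Z0 \<in> vhom N p 0" "Z1 \<in> vhom N p 1" "Z = Z0 + 1 *\<^sub>v Z1"
      using vspace_vhom_decomp[OF \<open>Z \<in> vspace N\<close>, of p] by metis
    show ?thesis
      unfolding Z(3) struct_bracket_linear jac[OF X Y Z(1)] jac[OF X Y Z(2)]
      by (auto simp: plus_fun_apply vscale_def fun_eq_iff algebra_simps)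
  qed
qed (simp_all add: struct_bracket_linear)

end

subsection \<open>Doubles\<close>

lemma vspace_add [simp]: "X \<in> vspace N \<Longrightarrow> Y \<in> vspace N \<Longrightarrow> X + Y \<in> vspace N"
  by (simp add: vspace_def plus_fun_apply)

lemma vspace_scale [simp]: "X \<in> vspace N \<Longrightarrow> r *\<^sub>v X \<in> vspace N"
  by (simp add: vspace_def vscale_def)

lemma vspace_zero [simp]: "0 \<in> vspace N"
  by (simp add: vspace_def zero_fun_apply)

lemma vspace_sum: "(\<And>i. i \<in> I \<Longrightarrow> X i \<in> vspace N) \<Longrightarrow> (\<Sum>i\<in>I. X i) \<in> vspace N"
  by (induction I rule: infinite_finite_induct) auto

lemma vspace_expand:
  assumes "X \<in> vspace N"
  shows "X = (\<Sum>i<N. X i *\<^sub>v bvec i)"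
proof
  fix k
  have "(\<Sum>i<N. X i *\<^sub>v bvec i) k = (\<Sum>i<N. if i = k then X k else 0)"
    unfolding sum_fun_apply by (intro sum.cong) (auto simp: vscale_def bvec_def)
  then show "X k = (\<Sum>i<N. X i *\<^sub>v bvec i) k"
    using assms by (auto simp: vspace_def)
qed

section \<open>Consequences of the Lie superalgebra axioms\<close>

context
  fixes N p br
  assumes lie: "lie_superalgebra N p br"
begin

lemma lie_closed: "X \<in> vspace N \<Longrightarrow> Y \<in> vspace N \<Longrightarrow> br X Y \<in> vspace N"
  using lie unfolding lie_superalgebra_def by blast

lemma lie_linear:
  assumes "X \<in> vspace N" "Y \<in> vspace N" "Z \<in> vspace N"
  shows "br (X + r *\<^sub>v Y) Z = br X Z + r *\<^sub>v br Y Z" "br Z (X + r *\<^sub>v Y) = br Z X + r *\<^sub>v br Z Y"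
  using lie assms unfolding lie_superalgebra_def by blast+

lemma lie_parity: "X \<in> vhom N p a \<Longrightarrow> Y \<in> vhom N p b \<Longrightarrow> br X Y \<in> vhom N p (a + b)"
  using lie unfolding lie_superalgebra_def by blast

lemma lie_antisym: "X \<in> vhom N p a \<Longrightarrow> Y \<in> vhom N p b \<Longrightarrow> br X Y = - (ksgn (a * b) *\<^sub>v br Y X)"
  using lie unfolding lie_superalgebra_def by blast

lemma lie_jacobi: "X \<in> vhom N p a \<Longrightarrow> Y \<in> vhom N p b \<Longrightarrow> Z \<in> vspace N \<Longrightarrow>
    br X (br Y Z) = br (br X Y) Z + ksgn (a * b) *\<^sub>v br Y (br X Z)"
  using lie unfolding lie_superalgebra_def by blast

lemma lie_zero:
  assumes "Z \<in> vspace N"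
  shows "br 0 Z = 0" "br Z 0 = 0"
proof -
  have "(0 :: nat \<Rightarrow> real) + (- 1) *\<^sub>v 0 = 0" by (simp add: fun_eq_iff vscale_def zero_fun_apply)
  moreover have "X + (- 1) *\<^sub>v X = 0" for X :: "nat \<Rightarrow> real"
    by (simp add: fun_eq_iff vscale_def zero_fun_apply plus_fun_apply)
  ultimately show "br 0 Z = 0" "br Z 0 = 0"
    using lie_linear[of 0 0 Z "- 1"] assms by simp_all
qed

lemma lie_sum:
  assumes "\<And>i. i \<in> I \<Longrightarrow> X i \<in> vspace N" "Z \<in> vspace N"
  shows "br (\<Sum>i\<in>I. r i *\<^sub>v X i) Z = (\<Sum>i\<in>I. r i *\<^sub>v br (X i) Z)"
    and "br Z (\<Sum>i\<in>I. r i *\<^sub>v X i) = (\<Sum>i\<in>I. r i *\<^sub>v br Z (X i))"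
proof -
  have "br (\<Sum>i\<in>I. r i *\<^sub>v X i) Z = (\<Sum>i\<in>I. r i *\<^sub>v br (X i) Z) \<and>
      br Z (\<Sum>i\<in>I. r i *\<^sub>v X i) = (\<Sum>i\<in>I. r i *\<^sub>v br Z (X i))"
    using assms
  proof (induction I rule: infinite_finite_induct)
    case (insert i I)
    have "(\<Sum>i\<in>I. r i *\<^sub>v X i) \<in> vspace N" using insert by (intro vspace_sum vspace_scale) auto
    then show ?case
      using insert lie_linear[of "\<Sum>i\<in>I. r i *\<^sub>v X i" "X i" Z "r i"] by (simp add: add.commute)
  qed (simp_all add: lie_zero)
  then show "br (\<Sum>i\<in>I. r i *\<^sub>v X i) Z = (\<Sum>i\<in>I. r i *\<^sub>v br (X i) Z)"
    "br Z (\<Sum>i\<in>I. r i *\<^sub>v X i) = (\<Sum>i\<in>I. r i *\<^sub>v br Z (X i))" by blast+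
qed

lemma lie_expand:
  assumes "X \<in> vspace N" "Y \<in> vspace N"
  shows "br X Y = (\<Sum>i<N. X i *\<^sub>v (\<Sum>j<N. Y j *\<^sub>v br (bvec i) (bvec j)))"
proof -
  have "br X Y = (\<Sum>i<N. X i *\<^sub>v br (bvec i) Y)"
    using lie_sum(1)[of "{..<N}" bvec Y X] vspace_expand[OF assms(1)] assms(2) by simp
  also have "\<dots> = (\<Sum>i<N. X i *\<^sub>v (\<Sum>j<N. Y j *\<^sub>v br (bvec i) (bvec j)))"
    using lie_sum(2)[of "{..<N}" bvec "bvec _" Y] vspace_expand[OF assms(2)] by (intro sum.cong) auto
  finally show ?thesis .
qed

end

lemma vhom_dbl: "X \<in> vhom n p a \<Longrightarrow> X \<in> vhom (2 * n) (dbl n p) a"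
  by (auto simp: vhom_def vspace_def dbl_def)

lemma dual_emb_vspace: "X \<in> vspace n \<Longrightarrow> dual_emb n X \<in> vspace (2 * n)"
  by (auto simp: vspace_def dual_emb_def)

lemma dual_emb_vhom_iff: "dual_emb n X \<in> vhom (2 * n) (dbl n p) a \<longleftrightarrow> X \<in> vhom n p a"
proof
  assume *: "dual_emb n X \<in> vhom (2 * n) (dbl n p) a"
  have X: "X i = dual_emb n X (n + i)" for i by (simp add: dual_emb_def)
  show "X \<in> vhom n p a"
  proof (rule vhomI)
    show "X i = 0" if "i \<ge> n" for i
      using vhom_vspace[OF *] that unfolding X[of i] by (simp add: vspace_def)
    show "p i = a" if "X i \<noteq> 0" for i
      using vhom_parity[OF *, of "n + i"] that X[of i] by simp
  qed
qed (auto simp: vhom_def vspace_def dual_emb_def dbl_def)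

lemma dual_emb_inject: "dual_emb n X = dual_emb n Y \<Longrightarrow> X = Y"
proof
  fix i assume "dual_emb n X = dual_emb n Y"
  then have "dual_emb n X (n + i) = dual_emb n Y (n + i)" by simp
  then show "X i = Y i" by (simp add: dual_emb_def)
qed

lemma dual_emb_linear:
  "dual_emb n (X + Y) = dual_emb n X + dual_emb n Y" "dual_emb n (r *\<^sub>v X) = r *\<^sub>v dual_emb n X"
  "dual_emb n (- X) = - dual_emb n X"
  by (auto simp: dual_emb_def plus_fun_apply vscale_def uminus_apply fun_eq_iff)

lemma dual_emb_bvec: "dual_emb n (bvec i) = bvec (n + i)"
  by (auto simp: dual_emb_def bvec_def fun_eq_iff)

text \<open>A subspace closed under the bracket inherits every axiom; the embedding is injective,
  linear and respects parities, so the identities can be pulled back.\<close>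

lemma lie_superalgebra_dual:
  assumes lie: "lie_superalgebra (2 * n) (dbl n p) brd"
    and cl: "\<And>X Y. X \<in> vspace n \<Longrightarrow> Y \<in> vspace n \<Longrightarrow> brs X Y \<in> vspace n"
    and emb: "\<And>X Y. X \<in> vspace n \<Longrightarrow> Y \<in> vspace n \<Longrightarrow> brd (dual_emb n X) (dual_emb n Y) = dual_emb n (brs X Y)"
  shows "lie_superalgebra n p brs"
  unfolding lie_superalgebra_def
proof (intro conjI ballI allI)
  show "brs X Y \<in> vspace n" if "X \<in> vspace n" "Y \<in> vspace n" for X Y using cl that .
  show "brs (X + r *\<^sub>v Y) Z = brs X Z + r *\<^sub>v brs Y Z" "brs Z (X + r *\<^sub>v Y) = brs Z X + r *\<^sub>v brs Z Y"
    if "X \<in> vspace n" "Y \<in> vspace n" "Z \<in> vspace n" for X Y Z r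
    using that lie_linear[OF lie dual_emb_vspace dual_emb_vspace dual_emb_vspace, of X Y Z r]
    by (rule_tac dual_emb_inject[of n], simp add: dual_emb_linear flip: emb)+
  show "brs X Y \<in> vhom n p (a + b)" if "X \<in> vhom n p a" "Y \<in> vhom n p b" for a b X Y
    using lie_parity[OF lie, of "dual_emb n X" a "dual_emb n Y" b] that vhom_vspace[OF that(1)] vhom_vspace[OF that(2)]
    by (simp add: dual_emb_vhom_iff emb)
  show "brs X Y = - (ksgn (a * b) *\<^sub>v brs Y X)" if "X \<in> vhom n p a" "Y \<in> vhom n p b" for a b X Y
  proof (rule dual_emb_inject[of n])
    show "dual_emb n (brs X Y) = dual_emb n (- (ksgn (a * b) *\<^sub>v brs Y X))"
      using lie_antisym[OF lie, of "dual_emb n X" a "dual_emb n Y" b] that vhom_vspace[OF that(1)] vhom_vspace[OF that(2)]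
      by (simp add: dual_emb_vhom_iff emb dual_emb_linear)
  qed
  show "brs X (brs Y Z) = brs (brs X Y) Z + ksgn (a * b) *\<^sub>v brs Y (brs X Z)"
    if "X \<in> vhom n p a" "Y \<in> vhom n p b" "Z \<in> vspace n" for a b X Y Z
  proof (rule dual_emb_inject[of n])
    show "dual_emb n (brs X (brs Y Z)) = dual_emb n (brs (brs X Y) Z + ksgn (a * b) *\<^sub>v brs Y (brs X Z))"
      using lie_jacobi[OF lie, of "dual_emb n X" a "dual_emb n Y" b "dual_emb n Z"] that
        vhom_vspace[OF that(1)] vhom_vspace[OF that(2)]
      by (simp add: dual_emb_vhom_iff dual_emb_vspace emb cl dual_emb_linear)
  qed
qed

lemma dbl_inner_bvec:
  assumes "i < n"
  shows "dbl_inner n p u (bvec (n + i)) = u i" "dbl_inner n p u (bvec i) = ksgn (p i) * u (n + i)"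
    "dbl_inner n p (bvec i) u = u (n + i)" "dbl_inner n p (bvec (n + i)) u = ksgn (p i) * u i"
proof -
  have "dbl_inner n p u (bvec (n + i)) = (\<Sum>j<n. if j = i then u i else 0)"
    "dbl_inner n p u (bvec i) = (\<Sum>j<n. if j = i then ksgn (p i) * u (n + i) else 0)"
    "dbl_inner n p (bvec i) u = (\<Sum>j<n. if j = i then u (n + i) else 0)"
    "dbl_inner n p (bvec (n + i)) u = (\<Sum>j<n. if j = i then ksgn (p i) * u i else 0)"
    unfolding dbl_inner_def by (rule sum.cong; use assms in \<open>auto simp: bvec_def\<close>)+
  then show "dbl_inner n p u (bvec (n + i)) = u i" "dbl_inner n p u (bvec i) = ksgn (p i) * u (n + i)"
    "dbl_inner n p (bvec i) u = u (n + i)" "dbl_inner n p (bvec (n + i)) u = ksgn (p i) * u i"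
    using assms by simp_all
qed

lemma dbl_inner_base: "X \<in> vspace n \<Longrightarrow> dbl_inner n p X u = (\<Sum>i<n. X i * u (n + i))"
  by (simp add: dbl_inner_def vspace_def)

lemma dbl_inner_scale: "dbl_inner n p (r *\<^sub>v u) v = r * dbl_inner n p u v" "dbl_inner n p u (r *\<^sub>v v) = r * dbl_inner n p u v"
  "dbl_inner n p (- u) v = - dbl_inner n p u v" "dbl_inner n p u (- v) = - dbl_inner n p u v"
  by (simp_all add: dbl_inner_def vscale_def uminus_apply sum_distrib_left sum_negf[symmetric] algebra_simps)

lemma dbl_inner_add: "dbl_inner n p u (v + w) = dbl_inner n p u v + dbl_inner n p u w"
  by (simp add: dbl_inner_def plus_fun_apply algebra_simps sum.distrib)

lemma dbl_inner_zero: "dbl_inner n p u 0 = 0"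
  by (simp add: dbl_inner_def zero_fun_apply)

lemma dbl_inner_sum: "dbl_inner n p u (\<Sum>i\<in>I. r i *\<^sub>v v i) = (\<Sum>i\<in>I. r i * dbl_inner n p u (v i))"
  by (induction I rule: infinite_finite_induct) (simp_all add: dbl_inner_add dbl_inner_scale dbl_inner_zero)

lemma dbl_inner_nondegenerate:
  assumes "u \<in> vspace (2 * n)" "v \<in> vspace (2 * n)"
    and "\<And>k. k < 2 * n \<Longrightarrow> dbl_inner n p u (bvec k) = dbl_inner n p v (bvec k)"
  shows "u = v"
proof
  fix k
  consider "k < n" | i where "k = n + i" "i < n" | "k \<ge> 2 * n"
    by (metis add_diff_inverse_nat add_less_cancel_left mult_2 not_less)
  then show "u k = v k"
  proof cases
    case 1
    then show ?thesis using assms(3)[of "n + k"] by (simp add: dbl_inner_bvec)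
  next
    case 2
    then show ?thesis using assms(3)[of i] by (simp add: dbl_inner_bvec)
  qed (use assms in \<open>simp add: vspace_def\<close>)
qed

context
  fixes n p br brs brd
  assumes dbl: "double_structure n p br brs brd"
begin

lemma dbl_lie: "lie_superalgebra (2 * n) (dbl n p) brd"
  using dbl unfolding double_structure_def by blast

lemma dbl_br: "X \<in> vspace n \<Longrightarrow> Y \<in> vspace n \<Longrightarrow> brd X Y = br X Y"
  using dbl unfolding double_structure_def by blast

lemma dbl_brs: "i < n \<Longrightarrow> j < n \<Longrightarrow> brd (bvec (n + i)) (bvec (n + j)) = dual_emb n (brs (bvec i) (bvec j))"
  using dbl unfolding double_structure_def by (metis dual_emb_bvec bvec_vspace)

lemma dbl_inv:
  assumes "u \<in> vhom (2 * n) (dbl n p) a" "v \<in> vhom (2 * n) (dbl n p) b" "w \<in> vspace (2 * n)"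
  shows "dbl_inner n p (brd u v) w = - (ksgn (a * b) * dbl_inner n p v (brd u w))"
proof -
  have "dbl_inner n p (brd u v) w + ksgn (a * b) * dbl_inner n p v (brd u w) = 0"
    using dbl assms unfolding double_structure_def by blast
  then show ?thesis by simp
qed

lemma dbl_inv':
  assumes "u \<in> vhom (2 * n) (dbl n p) a" "v \<in> vhom (2 * n) (dbl n p) b" "w \<in> vspace (2 * n)"
  shows "dbl_inner n p (brd u v) w = dbl_inner n p u (brd v w)"
  using dbl_inv[OF assms(2,1,3)] lie_antisym[OF dbl_lie assms(1,2)]
  by (simp add: dbl_inner_scale mult.commute)

end

text \<open>Among three basis vectors two lie in the same half of the double. Invariance moves the
  bracket onto these two, where it is prescribed, and nondegeneracy of the inner product recovers
  the bracket from such pairings.\<close>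

lemma double_structure_unique:
  assumes d1: "double_structure n p br brs d1" and d2: "double_structure n p br brs d2"
    and u: "u \<in> vspace (2 * n)" and v: "v \<in> vspace (2 * n)"
  shows "d1 u v = d2 u v"
proof -
  have same: "d1 (bvec i) (bvec j) = d2 (bvec i) (bvec j)"
    if "i < 2 * n" "j < 2 * n" "i < n \<longleftrightarrow> j < n" for i j
  proof (cases "i < n")
    case True
    then show ?thesis using that dbl_br[OF d1] dbl_br[OF d2] by simp
  next
    case False
    then have "i = n + (i - n)" "j = n + (j - n)" "i - n < n" "j - n < n"
      using that by auto
    then show ?thesis using dbl_brs[OF d1, of "i - n" "j - n"] dbl_brs[OF d2, of "i - n" "j - n"] by simp
  qed
  have "d1 (bvec i) (bvec j) = d2 (bvec i) (bvec j)" if "i < 2 * n" "j < 2 * n" for i j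
  proof (rule dbl_inner_nondegenerate[where p = p])
    show "d1 (bvec i) (bvec j) \<in> vspace (2 * n)" "d2 (bvec i) (bvec j) \<in> vspace (2 * n)"
      using that lie_closed[OF dbl_lie[OF d1]] lie_closed[OF dbl_lie[OF d2]] by simp_all
    fix k assume k: "k < 2 * n"
    note h = bvec_vhom[OF that(1), of "dbl n p"] bvec_vhom[OF that(2), of "dbl n p"] bvec_vspace[OF k]
    consider "i < n \<longleftrightarrow> j < n" | "i < n \<longleftrightarrow> k < n" | "j < n \<longleftrightarrow> k < n" by blast
    then show "dbl_inner n p (d1 (bvec i) (bvec j)) (bvec k) = dbl_inner n p (d2 (bvec i) (bvec j)) (bvec k)"
    proof cases
      case 1 then show ?thesis using same that by simp
    next
      case 2 then show ?thesis using same that k dbl_inv[OF d1 h] dbl_inv[OF d2 h] by simp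
    next
      case 3 then show ?thesis using same that k dbl_inv'[OF d1 h] dbl_inv'[OF d2 h] by simp
    qed
  qed
  then show ?thesis
    unfolding lie_expand[OF dbl_lie[OF d1] u v] lie_expand[OF dbl_lie[OF d2] u v] by simp
qed

lemma cobracket_parity:
  assumes "lie_superalgebra n p brs" "X \<in> vhom n p a" "i < n" "j < n" "cobracket n p brs X i j \<noteq> 0"
  shows "a = p i + p j"
proof -
  have "(\<Sum>k<n. X k * brs (bvec i) (bvec j) k) \<noteq> 0"
    using assms(5) by (auto simp: cobracket_def)
  then obtain k where "X k \<noteq> 0" "brs (bvec i) (bvec j) k \<noteq> 0"
    by (metis (mono_tags, lifting) mult_eq_0_iff sum.not_neutral_contains_not_neutral)
  then show ?thesis
    using vhom_parity[OF assms(2)] vhom_parity[OF lie_parity[OF assms(1) bvec_vhom bvec_vhom]] assms(3,4) by metis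
qed

lemma cobracket_antisym:
  assumes "lie_superalgebra n p brs" "i < n" "j < n"
  shows "cobracket n p brs X i j = - (ksgn (p i * p j) * cobracket n p brs X j i)"
proof -
  have "brs (bvec i) (bvec j) k = - (ksgn (p i * p j) * brs (bvec j) (bvec i) k)" for k
    using lie_antisym[OF assms(1) bvec_vhom[OF assms(2)] bvec_vhom[OF assms(3)]] by (simp add: vscale_def uminus_apply)
  then show ?thesis
    by (simp add: cobracket_def mult.commute sum_distrib_left sum_negf algebra_simps)
qed

text \<open>The cocycle condition is the Jacobi identity for \<open>X\<close>, \<open>e\<^sup>k\<close>, \<open>e\<^sup>l\<close>, paired with \<open>Y\<close>.\<close>

lemma double_structure_lie_bialgebra:
  assumes dbl: "double_structure n p br brs brd"
    and br: "lie_superalgebra n p br" and brs: "lie_superalgebra n p brs"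
  shows "lie_bialgebra n p br brs"
  unfolding lie_bialgebra_def
proof (intro conjI br brs allI ballI impI)
  fix a b X Y k l
  assume X: "X \<in> vhom n p a" and Y: "Y \<in> vhom n p b" and k: "k < n" and l: "l < n"
  let ?B = "dbl_inner n p" and ?\<delta> = "cobracket n p brs"
  note lie = dbl_lie[OF dbl] and inv = dbl_inv[OF dbl] and inv' = dbl_inv'[OF dbl]
  have e: "bvec i \<in> vhom (2 * n) (dbl n p) (p i)" "bvec (n + i) \<in> vhom (2 * n) (dbl n p) (p i)" if "i < n" for i
    using that bvec_vhom[of i "2 * n" "dbl n p"] bvec_vhom[of "n + i" "2 * n" "dbl n p"] by simp_all
  \<comment> \<open>\<open>[U, e^k]\<close> is expanded in the basis of the double: its components
    along \<open>e_i\<close> are cobracket components of \<open>U\<close>, those along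
    \<open>e^i\<close> come from the coadjoint action. Each basis vector is then bracketed with
    \<open>e^l\<close> and paired with \<open>V\<close>.\<close>
  have coadj: "?B V (brd (brd U (bvec (n + k))) (bvec (n + l))) =
      (\<Sum>i<n. ksgn (p k * p i) * ?\<delta> U k i * br V (bvec i) l - ksgn (c * p i + p i * p l) * ?\<delta> V i l * br U (bvec i) k)"
    if U: "U \<in> vhom n p c" and V: "V \<in> vhom n p d" and k: "k < n" and l: "l < n" for U V c d k l
  proof -
    note U' = vhom_dbl[OF U] and V' = vhom_dbl[OF V]
    note v = vhom_vspace[OF U] vhom_vspace[OF V] vhom_vspace[OF U'] vhom_vspace[OF V']
    have base: "?B W (brd (bvec (n + i)) (bvec (n + j))) = ksgn (p i * p j) * ?\<delta> W i j"
      if "W \<in> vspace n" "i < n" "j < n" for W i j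
      using that by (simp add: dbl_inner_base dbl_brs[OF dbl] dual_emb_def cobracket_def)
    let ?w = "brd U (bvec (n + k))"
    have w: "?w \<in> vspace (2 * n)" using v k by (intro lie_closed[OF lie]) auto
    have 1: "?w i = ksgn (p k * p i) * ?\<delta> U k i" if i: "i < n" for i
    proof -
      have "?w i = ?B ?w (bvec (n + i))" using i by (simp add: dbl_inner_bvec)
      also have "\<dots> = ?B U (brd (bvec (n + k)) (bvec (n + i)))"
        using U' e k i by (intro inv') auto
      finally show ?thesis using base v k i by simp
    qed
    have 2: "?w (n + i) = - (ksgn (c * p i) * br U (bvec i) k)" if i: "i < n" for i
    proof -
      have "br U (bvec i) k = ?B (brd U (bvec i)) (bvec (n + k))"
        using i k v by (simp add: dbl_inner_bvec dbl_br[OF dbl])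
      also have "\<dots> = - (ksgn (c * p i) * ?B (bvec i) ?w)"
        using U' e k i by (intro inv) auto
      finally show ?thesis using i by (simp add: dbl_inner_bvec)
    qed
    have 3: "?B V (brd (bvec i) (bvec (n + l))) = br V (bvec i) l" if i: "i < n" for i
    proof -
      have "?B V (brd (bvec i) (bvec (n + l))) = ?B (brd V (bvec i)) (bvec (n + l))"
        using V' e l i by (intro inv'[symmetric]) auto
      then show ?thesis using i l v by (simp add: dbl_inner_bvec dbl_br[OF dbl])
    qed
    have "brd ?w (bvec (n + l)) = (\<Sum>c<2 * n. ?w c *\<^sub>v brd (bvec c) (bvec (n + l)))"
      using lie_sum(1)[OF lie, of "{..<2 * n}" bvec "bvec (n + l)" ?w] l vspace_expand[OF w] by simp
    then have "?B V (brd ?w (bvec (n + l))) = (\<Sum>c<2 * n. ?w c * ?B V (brd (bvec c) (bvec (n + l))))"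
      by (simp add: dbl_inner_sum)
    also have "\<dots> = (\<Sum>i<n. ?w i * ?B V (brd (bvec i) (bvec (n + l)))) +
       (\<Sum>i<n. ?w (n + i) * ?B V (brd (bvec (n + i)) (bvec (n + l))))"
      by (rule sum_dbl)
    also have "\<dots> = (\<Sum>i<n. ksgn (p k * p i) * ?\<delta> U k i * br V (bvec i) l) +
       (\<Sum>i<n. - (ksgn (c * p i + p i * p l) * ?\<delta> V i l * br U (bvec i) k))"
      using 1 2 3 base v l by (simp add: ksgn_add ac_simps)
    finally show ?thesis by (simp add: sum.distrib sum_negf sum_subtractf)
  qed
  note X' = vhom_dbl[OF X] and Y' = vhom_dbl[OF Y]
  note v = vhom_vspace[OF X] vhom_vspace[OF Y] vhom_vspace[OF X'] vhom_vspace[OF Y']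
  let ?k = "bvec (n + k)" and ?l = "bvec (n + l)"
  have kl: "?k \<in> vspace (2 * n)" "?l \<in> vspace (2 * n)" using k l by simp_all
  have "?\<delta> (br X Y) k l = ksgn (p k * p l) * ?B (brd X Y) (brd ?k ?l)"
    using k l v by (simp add: dbl_inner_base dbl_br[OF dbl] lie_closed[OF br] dbl_brs[OF dbl] dual_emb_def cobracket_def)
  also have "?B (brd X Y) (brd ?k ?l) = - (ksgn (a * b) * ?B Y (brd X (brd ?k ?l)))"
    using X' Y' kl by (intro inv lie_closed[OF lie])
  also have "brd X (brd ?k ?l) = brd (brd X ?k) ?l + ksgn (a * p k) *\<^sub>v brd ?k (brd X ?l)"
    using lie_jacobi[OF lie X' e(2)[OF k] kl(2)] .
  also have "brd ?k (brd X ?l) = - (ksgn (p k * (a + p l)) *\<^sub>v brd (brd X ?l) ?k)"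
    using lie_antisym[OF lie e(2)[OF k] lie_parity[OF lie X' e(2)[OF l]]] .
  finally have "?\<delta> (br X Y) k l = - (ksgn (p k * p l) * ksgn (a * b) * ?B Y (brd (brd X ?k) ?l))
      + ksgn (a * b) * ?B Y (brd (brd X ?l) ?k)"
    unfolding dbl_inner_add dbl_inner_scale
    by (cases a; cases b; cases "p k"; cases "p l"; simp)
  also have "\<dots> = (\<Sum>i<n. - (ksgn (p k * p l) * ksgn (a * b) *
        (ksgn (p k * p i) * ?\<delta> X k i * br Y (bvec i) l - ksgn (a * p i + p i * p l) * ?\<delta> Y i l * br X (bvec i) k))
      + ksgn (a * b) * (ksgn (p l * p i) * ?\<delta> X l i * br Y (bvec i) k - ksgn (a * p i + p i * p k) * ?\<delta> Y i k * br X (bvec i) l))"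
    unfolding coadj[OF X Y k l] coadj[OF X Y l k] by (simp only: sum_distrib_left sum_negf sum.distrib)
  also have "\<dots> = (\<Sum>i<n. (?\<delta> Y i l * br X (bvec i) k + ksgn (a * p k) * ?\<delta> Y k i * br X (bvec i) l)
      - ksgn (a * b) * (?\<delta> X i l * br Y (bvec i) k + ksgn (b * p k) * ?\<delta> X k i * br Y (bvec i) l))"
  \<comment> \<open>The four products match one by one. Most of the signs agree only after the
    parity relations for nonzero brackets and cobrackets are inserted; the remaining discrepancies
    are resolved by antisymmetry of the cobracket.\<close>
  proof (rule sum.cong[OF refl])
    fix i assume "i \<in> {..<n}"
    then have i: "i < n" by simp
    have pb: "br U (bvec i) m \<noteq> 0 \<Longrightarrow> p m = c + p i" if "U \<in> vhom n p c" for U c m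
      using vhom_parity[OF lie_parity[OF br that bvec_vhom[OF i]]] .
    have "- (ksgn (p k * p l) * ksgn (a * b) * (ksgn (p k * p i) * ?\<delta> X k i * br Y (bvec i) l)) =
        - (ksgn (a * b) * (ksgn (b * p k) * ?\<delta> X k i * br Y (bvec i) l))"
    proof (cases "br Y (bvec i) l = 0")
      case False
      then have "p l = b + p i" using pb[OF Y] by blast
      then show ?thesis by (cases a; cases b; cases "p k"; cases "p i"; simp)
    qed simp
    moreover have "ksgn (p k * p l) * ksgn (a * b) * (ksgn (a * p i + p i * p l) * ?\<delta> Y i l * br X (bvec i) k) =
        ?\<delta> Y i l * br X (bvec i) k"
    proof (cases "?\<delta> Y i l = 0 \<or> br X (bvec i) k = 0")
      case False
      then have "p k = a + p i" "b = p i + p l" using pb[OF X] cobracket_parity[OF brs Y i l] by blast+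
      then show ?thesis by (cases a; cases "p l"; cases "p i"; simp)
    qed auto
    moreover have "ksgn (a * b) * (ksgn (p l * p i) * ?\<delta> X l i * br Y (bvec i) k) =
        - (ksgn (a * b) * (?\<delta> X i l * br Y (bvec i) k))"
      unfolding cobracket_antisym[OF brs l i] by simp
    moreover have "- (ksgn (a * b) * (ksgn (a * p i + p i * p k) * ?\<delta> Y i k * br X (bvec i) l)) =
        ksgn (a * p k) * ?\<delta> Y k i * br X (bvec i) l"
    proof (cases "?\<delta> Y k i = 0")
      case False
      then have "b = p k + p i" using cobracket_parity[OF brs Y k i] by blast
      then show ?thesis unfolding cobracket_antisym[OF brs i k, of Y]
        by (cases a; cases "p k"; cases "p i"; simp)
    qed (simp add: cobracket_antisym[OF brs i k, of Y])
    ultimately show "- (ksgn (p k * p l) * ksgn (a * b) *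
        (ksgn (p k * p i) * ?\<delta> X k i * br Y (bvec i) l - ksgn (a * p i + p i * p l) * ?\<delta> Y i l * br X (bvec i) k))
      + ksgn (a * b) * (ksgn (p l * p i) * ?\<delta> X l i * br Y (bvec i) k - ksgn (a * p i + p i * p k) * ?\<delta> Y i k * br X (bvec i) l) =
      (?\<delta> Y i l * br X (bvec i) k + ksgn (a * p k) * ?\<delta> Y k i * br X (bvec i) l)
      - ksgn (a * b) * (?\<delta> X i l * br Y (bvec i) k + ksgn (b * p k) * ?\<delta> X k i * br Y (bvec i) l)"
      by (simp only: right_diff_distrib distrib_left)
  qed
  finally show "?\<delta> (br X Y) k l = ad_tensor n p br a X (?\<delta> Y) k l - ksgn (a * b) * ad_tensor n p br b Y (?\<delta> X) k l"
    by (simp add: ad_tensor_def sum.distrib sum_subtractf flip: sum_distrib_left)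
qed

subsection \<open>Third derivatives of the Hamiltonian as structure constants\<close>

text \<open>For a cubic function the third derivative is a constant, and evaluation at the empty
  monomial and the origin reads off its value.\<close>

definition third_deriv :: "(nat \<Rightarrow> bit) \<Rightarrow> sfun \<Rightarrow> nat \<Rightarrow> nat \<Rightarrow> nat \<Rightarrow> real" where
  "third_deriv q f i j k = sderiv q i (sderiv q j (sderiv q k f)) {} (\<lambda>_. 0)"

context
  fixes N q f i j k
  assumes f: "poly_deg N q 3 f" and i: "i < N" and j: "j < N" and k: "k < N"
begin

lemma third_deriv: "sderiv q i (sderiv q j (sderiv q k f)) = third_deriv q f i j k *\<^sub>s sone"
proof -
  obtain r where "sderiv q i (sderiv q j (sderiv q k f)) = r *\<^sub>s sone"
    using f i j k unfolding numeral_3_eq_3 poly_deg.simps by blast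
  then show ?thesis by (simp add: third_deriv_def sscale_apply sone_def)
qed

lemma third_deriv_swap12: "third_deriv q f i j k = ksgn (q i * q j) * third_deriv q f j i k"
  unfolding third_deriv_def
  by (subst sderiv_commute[OF Cinf_sderiv[OF poly_deg_Cinf[OF f] k] i j]) (simp add: sscale_apply)

lemma third_deriv_swap23: "third_deriv q f i j k = ksgn (q j * q k) * third_deriv q f i k j"
  unfolding third_deriv_def
  by (subst sderiv_commute[OF poly_deg_Cinf[OF f] j k], subst sderiv_scale[of _ N])
    (auto simp: sscale_apply intro!: Cinf_sderiv i j k poly_deg_Cinf[OF f])

lemma third_deriv_parity:
  assumes "has_parity a f" "third_deriv q f i j k \<noteq> 0"
  shows "q i + q j + q k = a"
proof -
  have "has_parity (a + q k + q j + q i) (sderiv q i (sderiv q j (sderiv q k f)))"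
    using assms(1) poly_deg_Cinf[OF f] i j k by (intro has_parity_sderiv[of _ _ N] Cinf_sderiv) auto
  then have "a + q k + q j + q i = 0"
    using assms(2) has_parity_const unfolding third_deriv by blast
  then show ?thesis by (cases a; cases "q i"; cases "q j"; cases "q k"; simp)
qed

text \<open>A selection rule: the third derivative is a constant of weight \<open>r\<close> minus
  the weights of the three indices, and nonzero constants have weight 0.\<close>

lemma third_deriv_weight:
  assumes "weight N q w r f" "w i + w j + w k \<noteq> r"
  shows "third_deriv q f i j k = 0"
proof (rule weight_const)
  show "weight N q w (r - w k - w j - w i) (third_deriv q f i j k *\<^sub>s sone)"
    unfolding third_deriv[symmetric] using assms(1) i j k by (intro weight_sderiv)
qed (use assms(2) in simp)

lemma third_deriv_add:
  assumes "poly_deg N q 3 g"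
  shows "third_deriv q (f + g) i j k = third_deriv q f i j k + third_deriv q g i j k"
  using i j k poly_deg_Cinf[OF f] poly_deg_Cinf[OF assms]
  by (simp add: third_deriv_def sderiv_add[of _ N] Cinf_sderiv plus_fun_apply)

end

lemma Pi_par_dbl: "Pi_par (dbl n p) = dbl n (Pi_par p)"
  by (simp add: Pi_par_def dbl_def fun_eq_iff)

lemma poisson_sum_left:
  assumes "\<And>i. i \<in> I \<Longrightarrow> f i \<in> Cinf (2 * n) (dbl n q)"
  shows "poisson n q (\<Sum>i\<in>I. r i *\<^sub>s f i) g = (\<Sum>i\<in>I. r i *\<^sub>s poisson n q (f i) g)"
  using assms
proof (induction I rule: infinite_finite_induct)
  case (insert i I)
  have "(\<Sum>i\<in>I. r i *\<^sub>s f i) \<in> Cinf (2 * n) (dbl n q)"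
    using insert by (intro Cinf_sum Cinf_scale) auto
  then show ?case
    using insert by (simp add: poisson_add_left poisson_scale_left Cinf_scale)
qed simp_all

text \<open>The Hamiltonian field differentiates along the conjugate coordinate, which is why the last index
  of the tensor \<open>T\<close> of third derivatives is conjugated here.\<close>

definition ham_const :: "nat \<Rightarrow> (nat \<Rightarrow> bit) \<Rightarrow> (nat \<Rightarrow> nat \<Rightarrow> nat \<Rightarrow> real) \<Rightarrow> nat \<Rightarrow> nat \<Rightarrow> nat \<Rightarrow> real" where
  "ham_const n p T i j k = (if k < n then T i j (n + k) else ksgn (p (k - n)) * T i j (k - n))"

lemma ham_const_simps [simp]:
  "k < n \<Longrightarrow> ham_const n p T i j k = T i j (n + k)" "ham_const n p T i j (n + k) = ksgn (p k) * T i j k"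
  by (simp_all add: ham_const_def)

abbreviation ham_bracket where
  "ham_bracket n p T \<equiv> struct_bracket (2 * n) (\<lambda>i j k. ksgn (dbl n p i + dbl n p k) * ham_const n p T i j k)"

lemma ham_bracket_base:
  assumes "X \<in> vspace n" "Y \<in> vspace n" "k < 2 * n"
  shows "ham_bracket n p T X Y k = (\<Sum>i<n. \<Sum>j<n. X i * Y j * (ksgn (p i + dbl n p k) * ham_const n p T i j k))"
  using assms unfolding struct_bracket_def sum_dbl by (simp add: vspace_def)

lemma ham_bracket_dual:
  assumes "k < 2 * n"
  shows "ham_bracket n p T (dual_emb n X) (dual_emb n Y) k =
    (\<Sum>i<n. \<Sum>j<n. X i * Y j * (ksgn (p i + dbl n p k) * ham_const n p T (n + i) (n + j) k))"
  using assms unfolding struct_bracket_def sum_dbl by (simp add: dual_emb_def)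

lemma ham_const_deriv:
  assumes H: "poly_deg (2 * n) (dbl n (Pi_par p)) 3 H" "has_parity 1 H"
    and i: "i < 2 * n" and j: "j < 2 * n" and k: "k < 2 * n"
  shows "sderiv (dbl n (Pi_par p)) i (sderiv (dbl n (Pi_par p)) j
      (ham_field n (Pi_par p) H (coord (dbl n (Pi_par p)) k))) =
    ham_const n p (third_deriv (dbl n (Pi_par p)) H) i j k *\<^sub>s sone"
proof (cases "k < n")
  case True
  then show ?thesis
    using vfield_poisson(2)[OF poly_deg_Cinf[OF H(1)] H(2) True] third_deriv[OF H(1) i j, of "n + k"]
    by (simp add: ham_field_def)
next
  case False
  then obtain m where m: "k = n + m" "m < n" using k by (metis add_diff_inverse_nat add_less_cancel_left mult_2)
  let ?d = "dbl n (Pi_par p)"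
  have Hm: "sderiv ?d m H \<in> Cinf (2 * n) ?d"
    using m poly_deg_Cinf[OF H(1)] by (intro Cinf_sderiv) auto
  \<comment> \<open>The sign of the momentum component of a Hamiltonian field becomes the factor in
    \<open>ham_const\<close> after the parity shift.\<close>
  have "- ksgn (Pi_par p m) = ksgn (p m)" by (simp add: Pi_par_simp ksgn_add)
  then have "ham_field n (Pi_par p) H (coord ?d k) = ksgn (p m) *\<^sub>s sderiv ?d m H"
    using vfield_poisson(3)[OF poly_deg_Cinf[OF H(1)] H(2) m(2)]
    by (metis ham_field_def m(1) mult.right_neutral sscale.scale_minus_left)
  then show ?thesis
    using third_deriv[OF H(1) i j, of m] m Hm i j
    by (simp add: sderiv_scale[of _ "2 * n"] Cinf_sderiv del: sderiv_dbl)
qed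

text \<open>The inner product pairs conjugate indices, which undoes the conjugation in
  \<open>ham_const\<close>; what remains is the tensor \<open>T\<close> itself, whose symmetries are
  known.\<close>

lemma dbl_inner_ham_bracket:
  "dbl_inner n p (ham_bracket n p T u v) w =
    (\<Sum>i<2 * n. \<Sum>j<2 * n. \<Sum>k<2 * n. u i * v j * w k * (ksgn (dbl n p i + dbl n p k) * T i j k))"
  "dbl_inner n p v (ham_bracket n p T u w) =
    (\<Sum>i<2 * n. \<Sum>j<2 * n. \<Sum>k<2 * n. u i * v j * w k * (ksgn (dbl n p i) * T i k j))"
proof -
  let ?P = "dbl n p"
  have "dbl_inner n p (ham_bracket n p T u v) w =
      (\<Sum>k<2 * n. \<Sum>i<2 * n. \<Sum>j<2 * n. u i * v j * w k * (ksgn (?P i + ?P k) * T i j k))"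
    unfolding dbl_inner_def sum_dbl[of "\<lambda>k. \<Sum>i<2 * n. \<Sum>j<2 * n. u i * v j * w k * (ksgn (?P i + ?P k) * T i j k)"]
    unfolding sum.distrib
    \<comment> \<open>Conjugation exchanges the two halves of the index range, so the two partial
      sums appear in the opposite order.\<close>
    by (rule trans[OF add.commute], intro arg_cong2[of _ _ _ _ "(+)"] sum.cong refl)
      (simp_all add: struct_bracket_def sum_distrib_left sum_distrib_right mult_ac)
  also have "\<dots> = (\<Sum>i<2 * n. \<Sum>j<2 * n. \<Sum>k<2 * n. u i * v j * w k * (ksgn (?P i + ?P k) * T i j k))"
    by (rule sum_rotate[symmetric])
  finally show "dbl_inner n p (ham_bracket n p T u v) w =
    (\<Sum>i<2 * n. \<Sum>j<2 * n. \<Sum>k<2 * n. u i * v j * w k * (ksgn (?P i + ?P k) * T i j k))" .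
  have "dbl_inner n p v (ham_bracket n p T u w) =
      (\<Sum>j<2 * n. \<Sum>i<2 * n. \<Sum>k<2 * n. u i * v j * w k * (ksgn (?P i) * T i k j))"
    unfolding dbl_inner_def sum_dbl[of "\<lambda>j. \<Sum>i<2 * n. \<Sum>k<2 * n. u i * v j * w k * (ksgn (?P i) * T i k j)"]
    unfolding sum.distrib
    by (intro arg_cong2[of _ _ _ _ "(+)"] sum.cong refl)
      (simp_all add: struct_bracket_def sum_distrib_left sum_distrib_right ksgn_add mult_ac)
  also have "\<dots> = (\<Sum>i<2 * n. \<Sum>j<2 * n. \<Sum>k<2 * n. u i * v j * w k * (ksgn (?P i) * T i k j))"
    by (rule sum.swap)
  finally show "dbl_inner n p v (ham_bracket n p T u w) =
    (\<Sum>i<2 * n. \<Sum>j<2 * n. \<Sum>k<2 * n. u i * v j * w k * (ksgn (?P i) * T i k j))" .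
qed

lemma ham_bracket_invariant:
  assumes H: "poly_deg (2 * n) (dbl n (Pi_par p)) 3 H" "has_parity 1 H"
    and u: "u \<in> vhom (2 * n) (dbl n p) a" and v: "v \<in> vhom (2 * n) (dbl n p) b"
  defines "T \<equiv> third_deriv (dbl n (Pi_par p)) H"
  shows "dbl_inner n p (ham_bracket n p T u v) w + ksgn (a * b) * dbl_inner n p v (ham_bracket n p T u w) = 0"
proof -
  let ?P = "dbl n p"
  have par: "dbl n (Pi_par p) m = ?P m + 1" for m by (simp add: dbl_def Pi_par_def)
  have "u i * v j * w k * (ksgn (?P i + ?P k) * T i j k) + ksgn (a * b) * (u i * v j * w k * (ksgn (?P i) * T i k j)) = 0"
    if "i < 2 * n" "j < 2 * n" "k < 2 * n" for i j k
  proof (cases "u i = 0 \<or> v j = 0 \<or> T i j k = 0")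
    case True
    then show ?thesis using third_deriv_swap23[OF H(1) that(1,3,2)] by (auto simp: T_def)
  next
    case False
    have ab: "?P i = a" "?P j = b" using False u v vhom_parity by blast+
    \<comment> \<open>Where \<open>T\<close> does not vanish, oddness of \<open>H\<close> makes the
      parity of \<open>i\<close> the sum of those of \<open>j\<close> and \<open>k\<close>; with
      this relation the two signs are opposite.\<close>
    have "dbl n (Pi_par p) i + dbl n (Pi_par p) j + dbl n (Pi_par p) k = 1"
      using third_deriv_parity[OF H(1) that H(2)] False by (simp add: T_def)
    then have ak: "a = b + ?P k"
      using ab unfolding par by (cases a; cases b; cases "?P k"; simp)
    have "T i k j = ksgn ((?P k + 1) * (?P j + 1)) * T i j k"
      using third_deriv_swap23[OF H(1) that(1,3,2)] unfolding par T_def .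
    then show ?thesis
      using ab ak by (cases b; cases "?P k"; simp)
  qed
  then have "(\<Sum>i<2 * n. \<Sum>j<2 * n. \<Sum>k<2 * n. u i * v j * w k * (ksgn (?P i + ?P k) * T i j k)
      + ksgn (a * b) * (u i * v j * w k * (ksgn (?P i) * T i k j))) = 0"
    by (intro sum.neutral ballI) simp
  then show ?thesis
    unfolding dbl_inner_ham_bracket by (simp add: sum.distrib sum_distrib_left)
qed

section \<open>The brackets on the base, the dual and the double attached to \<open>Q\<close> and
  \<open>S\<close>\<close>

context
  fixes n p Qc Sc
  assumes hom: "homological n (Pi_par p) (Q_field n (Pi_par p) Qc)"
    and S1: "has_parity 1 (S_ham n (Pi_par p) Sc)"
begin

abbreviation (input) "QQ \<equiv> Q_ham n (Pi_par p) Qc"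
abbreviation (input) "SS \<equiv> S_ham n (Pi_par p) Sc"
abbreviation (input) "dd \<equiv> dbl n (Pi_par p)"
abbreviation (input) "g_bracket \<equiv> struct_bracket n (\<lambda>i j k. ksgn (p i + p k) * third_deriv dd QQ i j (n + k))"
text \<open>The sign is that of the bracket of a base coordinate with a function,
  \<open>- ksgn (p i + 1) = ksgn (p i)\<close>. It agrees with the sign in the double, where the
  factors for \<open>p k\<close> from the bracket and from \<open>ham_const\<close> cancel.\<close>

abbreviation (input) "dual_bracket \<equiv> struct_bracket n (\<lambda>i j k. ksgn (p i) * third_deriv dd SS (n + i) (n + j) k)"
abbreviation (input) "dbl_bracket \<equiv> ham_bracket n p (third_deriv dd (QQ + SS))"

lemma sum_ham: "poly_deg (2 * n) dd 3 (QQ + SS)" "has_parity 1 (QQ + SS)"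
  using poly_deg_add[OF poly_deg_Q_ham poly_deg_S_ham] has_parity_add[OF has_parity_Q_ham[OF hom] S1] by blast+

lemma vfield_sum_ham: "vfield (2 * n) (Pi_par (dbl n p)) 1 (ham_field n (Pi_par p) (QQ + SS))"
  unfolding Pi_par_dbl ham_field_def by (rule vfield_poisson(1)[OF poly_deg_Cinf[OF sum_ham(1)] sum_ham(2)])

lemma dbl_bracket_of_field: "bracket_of_field (2 * n) (dbl n p) (ham_field n (Pi_par p) (QQ + SS)) dbl_bracket"
  by (rule field_bracket_bracket_of_field[OF vfield_sum_ham]) (simp add: Pi_par_dbl ham_const_deriv[OF sum_ham])

lemma dbl_bracket_lie:
  assumes "poisson n (Pi_par p) (QQ + SS) (QQ + SS) = 0"
  shows "lie_superalgebra (2 * n) (dbl n p) dbl_bracket"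
proof (rule field_bracket_lie_superalgebra[OF vfield_sum_ham])
  show "ham_field n (Pi_par p) (QQ + SS) (ham_field n (Pi_par p) (QQ + SS) f) = 0"
    if "f \<in> Cinf (2 * n) (Pi_par (dbl n p))" for f
    using homological_ham_field[OF poly_deg_Cinf[OF sum_ham(1)] sum_ham(2) assms] that
    by (simp add: homological_def Pi_par_dbl)
qed (simp add: Pi_par_dbl ham_const_deriv[OF sum_ham])

lemma g_bracket_deriv:
  assumes "i < n" "j < n" "k < n"
  shows "sderiv (Pi_par p) i (sderiv (Pi_par p) j (Q_field n (Pi_par p) Qc (coord (Pi_par p) k))) =
    third_deriv dd QQ i j (n + k) *\<^sub>s sone"
  using third_deriv[OF poly_deg_Q_ham, of i n j "n + k" "Pi_par p" Qc] assms
  by (simp add: sderiv_Q_ham[OF hom] Q_field_coord[OF hom])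

lemma g_bracket_of_field: "bracket_of_field n p (Q_field n (Pi_par p) Qc) g_bracket"
  by (rule field_bracket_bracket_of_field[OF vfield_Q_field[OF hom] g_bracket_deriv])

lemma g_bracket_lie: "lie_superalgebra n p g_bracket"
  by (rule field_bracket_lie_superalgebra[OF vfield_Q_field[OF hom] g_bracket_deriv])
    (use hom in \<open>auto simp: homological_def\<close>)

lemma third_deriv_sum_ham:
  assumes "i < 2 * n" "j < 2 * n" "k < 2 * n"
  shows "third_deriv dd (QQ + SS) i j k =
    (if momentum_wt n i + momentum_wt n j + momentum_wt n k = 1 then third_deriv dd QQ i j k else 0) +
    (if momentum_wt n i + momentum_wt n j + momentum_wt n k = 2 then third_deriv dd SS i j k else 0)"
proof -
  have "weight (2 * n) dd (momentum_wt n) 1 QQ" by (rule Q_ham_weight) simp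
  moreover have "weight (2 * n) dd (momentum_wt n) 2 SS" by (rule S_ham_weight) simp
  ultimately show ?thesis
    using third_deriv_add[OF poly_deg_Q_ham assms poly_deg_S_ham, of "Pi_par p" Qc Sc]
      third_deriv_weight[OF poly_deg_Q_ham assms, of "Pi_par p" "momentum_wt n" 1 Qc]
      third_deriv_weight[OF poly_deg_S_ham assms, of "Pi_par p" "momentum_wt n" 2 Sc]
    by auto
qed

text \<open>With two base indices, a momentum as third index leaves only \<open>Q\<close>, while a
  third base index gives momentum weight 0, which neither \<open>Q\<close> nor \<open>S\<close>
  has.\<close>

lemma dbl_bracket_g:
  assumes "X \<in> vspace n" "Y \<in> vspace n"
  shows "dbl_bracket X Y = g_bracket X Y"
proof
  fix k
  consider "k < n" | m where "k = n + m" "m < n" | "k \<ge> 2 * n"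
    by (metis add_diff_inverse_nat add_less_cancel_left mult_2 not_less)
  then show "dbl_bracket X Y k = g_bracket X Y k"
  proof cases
    case 1
    then show ?thesis
      by (subst ham_bracket_base[OF assms]) (simp_all add: struct_bracket_def third_deriv_sum_ham)
  next
    case 2
    then show ?thesis
      by (subst ham_bracket_base[OF assms]) (simp_all add: struct_bracket_def third_deriv_sum_ham)
  qed (simp add: struct_bracket_def)
qed

text \<open>With two momentum indices, a base index as third one leaves only \<open>S\<close>, while
  a third momentum would require momentum weight 3.\<close>

lemma dbl_bracket_dual: "dbl_bracket (dual_emb n X) (dual_emb n Y) = dual_emb n (dual_bracket X Y)"
proof
  fix k
  consider "k < n" | m where "k = n + m" "m < n" | "k \<ge> 2 * n"
    by (metis add_diff_inverse_nat add_less_cancel_left mult_2 not_less)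
  then show "dbl_bracket (dual_emb n X) (dual_emb n Y) k = dual_emb n (dual_bracket X Y) k"
  proof cases
    case 1
    then show ?thesis
      by (subst ham_bracket_dual) (simp_all add: dual_emb_def third_deriv_sum_ham)
  next
    case 2
    then show ?thesis
      by (subst ham_bracket_dual) (simp_all add: struct_bracket_def dual_emb_def third_deriv_sum_ham ksgn_add mult_ac)
  qed (simp add: struct_bracket_def dual_emb_def)
qed

lemma S_ham_second_deriv_eq:
  assumes "i < n" "j < n"
  shows "sderiv dd (n + i) (sderiv dd (n + j) SS) =
    (\<Sum>k<n. third_deriv dd SS (n + i) (n + j) k *\<^sub>s coord (Pi_par p) k)"
proof -
  obtain r where r: "sderiv dd (n + i) (sderiv dd (n + j) SS) = (\<Sum>k<n. r k *\<^sub>s coord (Pi_par p) k)"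
    "\<And>k. k < n \<Longrightarrow> sderiv (Pi_par p) k (sderiv dd (n + i) (sderiv dd (n + j) SS)) = r k *\<^sub>s sone"
    using S_ham_second_deriv[OF assms, of "Pi_par p" Sc] by blast
  have "r k = third_deriv dd SS (n + i) (n + j) k" if k: "k < n" for k
  proof -
    have b: "k < 2 * n" "n + i < 2 * n" "n + j < 2 * n" using k assms by auto
    note S = poly_deg_S_ham[of n "Pi_par p" Sc]
    have "third_deriv dd SS k (n + i) (n + j) *\<^sub>s sone = r k *\<^sub>s sone"
      using third_deriv[OF S b] r(2)[OF k] k by simp
    then have "r k = third_deriv dd SS k (n + i) (n + j)" by (simp add: scale_sone_eq_iff)
    also have "\<dots> = ksgn (dd k * dd (n + i)) * (ksgn (dd k * dd (n + j)) * third_deriv dd SS (n + i) (n + j) k)"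
      using third_deriv_swap12[OF S b] third_deriv_swap23[OF S b(2,1,3)] by simp
    \<comment> \<open>Moving \<open>k\<close> past both momenta costs a sign with exponent
      \<open>k\<close> times their total parity; by oddness of \<open>S\<close> that parity is
      \<open>k + 1\<close>, and \<open>k * (k + 1)\<close> is even.\<close>
    also have "\<dots> = third_deriv dd SS (n + i) (n + j) k"
    proof (cases "third_deriv dd SS (n + i) (n + j) k = 0")
      case False
      then have "dd (n + i) + dd (n + j) + dd k = 1" using third_deriv_parity[OF S b(2,3,1) S1] by simp
      then show ?thesis by (cases "dd (n + i)"; cases "dd (n + j)"; cases "dd k"; simp)
    qed simp
    finally show ?thesis .
  qed
  then show ?thesis unfolding r(1) by simp
qed

lemma dual_bracket_of_schouten: "bracket_of_schouten n p SS dual_bracket"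
  unfolding bracket_of_schouten_def schouten_bracket_def
proof (intro ballI)
  fix \<alpha> \<beta> :: "nat \<Rightarrow> real"
  let ?q = "Pi_par p"
  note S = poly_deg_Cinf[OF poly_deg_S_ham] S1
  note v = vfield_poisson[OF S]
  have co: "coord ?q i \<in> Cinf (2 * n) dd" if "i < n" for i
    using Cinf_dbl[OF Cinf_coord[OF that]] .
  have 1: "poisson n ?q SS (lin_fun n p \<beta>) = (\<Sum>j<n. \<beta> j *\<^sub>s sderiv dd (n + j) SS)"
  proof -
    have "poisson n ?q SS (lin_fun n p \<beta>) = (\<Sum>j<n. poisson n ?q SS (\<beta> j *\<^sub>s coord ?q j))"
      unfolding lin_fun_def by (rule vfield_sum[OF v(1)]) (simp add: Cinf_scale co)
    then show ?thesis using v(2) by (simp add: vfield_scale[OF v(1)] co)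
  qed
  have cl: "\<beta> j *\<^sub>s sderiv dd (n + j) SS \<in> Cinf (2 * n) dd" "sderiv dd (n + j) SS \<in> Cinf (2 * n) dd" if "j < n" for j
    using that S(1) by (simp_all add: Cinf_scale Cinf_sderiv)
  have 2: "poisson n ?q (coord ?q i) (poisson n ?q SS (lin_fun n p \<beta>)) =
      (\<Sum>j<n. \<Sum>k<n. (\<beta> j * (ksgn (p i) * third_deriv dd SS (n + i) (n + j) k)) *\<^sub>s coord ?q k)" if i: "i < n" for i
  proof -
    have "- (ksgn (?q i) *\<^sub>s f) = ksgn (p i) *\<^sub>s f" for f
      by (cases "p i") (simp_all add: Pi_par_simp)
    then have "poisson n ?q (coord ?q i) (poisson n ?q SS (lin_fun n p \<beta>)) =
        ksgn (p i) *\<^sub>s sderiv dd (n + i) (\<Sum>j<n. \<beta> j *\<^sub>s sderiv dd (n + j) SS)"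
      unfolding 1 using cl by (subst poisson_coord_left(1)[OF i]) (auto intro!: Cinf_sum)
    also have "sderiv dd (n + i) (\<Sum>j<n. \<beta> j *\<^sub>s sderiv dd (n + j) SS) =
        (\<Sum>j<n. \<beta> j *\<^sub>s sderiv dd (n + i) (sderiv dd (n + j) SS))"
      using cl i by (subst sderiv_sum[of _ _ "2 * n"]) (auto intro!: sum.cong sderiv_scale[of _ "2 * n"])
    finally show ?thesis
      using i by (simp add: S_ham_second_deriv_eq sscale_simps mult.left_commute)
  qed
  have "poisson n ?q (lin_fun n p \<alpha>) (poisson n ?q SS (lin_fun n p \<beta>)) =
      (\<Sum>i<n. \<alpha> i *\<^sub>s poisson n ?q (coord ?q i) (poisson n ?q SS (lin_fun n p \<beta>)))"
    unfolding lin_fun_def[of n p \<alpha>] by (rule poisson_sum_left) (simp add: co)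
  also have "\<dots> = (\<Sum>i<n. \<Sum>j<n. \<Sum>k<n. (\<alpha> i * \<beta> j * (ksgn (p i) * third_deriv dd SS (n + i) (n + j) k)) *\<^sub>s coord ?q k)"
    using 2 by (simp add: sscale_simps mult.assoc)
  also have "\<dots> = lin_fun n p (dual_bracket \<alpha> \<beta>)"
    by (subst sum_rotate) (simp add: lin_fun_def struct_bracket_def sscale.scale_sum_left)
  finally show "poisson n ?q (lin_fun n p \<alpha>) (poisson n ?q SS (lin_fun n p \<beta>)) = lin_fun n p (dual_bracket \<alpha> \<beta>)" .
qed

text \<open>The Lie axioms for the dual bracket are inherited from the double. The bialgebra
  property then follows from the existence of the double, and uniqueness holds for any double
  structure.\<close>

lemma dbl_bracket_double:
  assumes "poisson n (Pi_par p) (QQ + SS) (QQ + SS) = 0"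
  shows "drinfeld_double n p g_bracket dual_bracket dbl_bracket"
proof -
  have "double_structure n p g_bracket dual_bracket dbl_bracket"
    unfolding double_structure_def
    using dbl_bracket_lie[OF assms] dbl_bracket_g dbl_bracket_dual ham_bracket_invariant[OF sum_ham] by blast
  moreover have "lie_superalgebra n p dual_bracket"
    by (rule lie_superalgebra_dual[OF dbl_bracket_lie[OF assms]]) (simp_all add: dbl_bracket_dual)
  ultimately show ?thesis
    unfolding drinfeld_double_def
    using double_structure_lie_bialgebra g_bracket_lie double_structure_unique by blast
qed

end

theorem theorem2p5:
  fixes n :: nat and p :: "nat \<Rightarrow> bit"
    and Qc Sc :: "nat \<Rightarrow> nat \<Rightarrow> nat \<Rightarrow> real"
  defines "q \<equiv> Pi_par p"
  defines "Qhat \<equiv> Q_field n q Qc"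
    and "Q \<equiv> Q_ham n q Qc"
    and "S \<equiv> S_ham n q Sc"
  assumes "homological n q Qhat"
    and "schouten_tensor n q S"
  shows "poisson n q Q S = (1/4) *\<^sub>s poisson n q (Q_form n q Qc) (S_form n q Sc) \<and>
         (QS_condition n q Qhat S \<longleftrightarrow> poisson n q Q S = 0) \<and>
         (QS_condition n q Qhat S \<longrightarrow>
           poisson n q (Q + S) (Q + S) = 0 \<and>
           homological (2 * n) (dbl n q) (ham_field n q (Q + S)) \<and>
           (\<exists>br brs brd.
              bracket_of_field n p Qhat br \<and>
              bracket_of_schouten n p S brs \<and>
              bracket_of_field (2 * n) (dbl n p) (ham_field n q (Q + S)) brd \<and>
              drinfeld_double n p br brs brd))"
proof -
  note hom = assms(5)[unfolded Qhat_def q_def]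
  have "has_parity 1 S" and SS: "poisson n q S S = 0"
    using assms(6) unfolding schouten_tensor_def by blast+
  then have S1: "has_parity 1 (S_ham n (Pi_par p) Sc)" by (simp add: S_def q_def)
  have Q: "Q \<in> Cinf (2 * n) (dbl n q)" "has_parity 1 Q"
    and S: "S \<in> Cinf (2 * n) (dbl n q)" "has_parity 1 S"
    using has_parity_Q_ham[OF hom] S1 by (simp_all add: Q_def S_def q_def Q_ham_Cinf S_ham_Cinf)
  note vQ = vfield_poisson(1)[OF Q]
  have Qf: "has_parity 1 (Q_form n q Qc)"
    using has_parity_scale[OF Q(2), of 2] by (simp add: Q_def Q_ham_def)
  have quarter: "poisson n q Q S = (1/4) *\<^sub>s poisson n q (Q_form n q Qc) (S_form n q Sc)"
    using vfield_scale[OF vfield_poisson(1)[OF Q_form_Cinf Qf] S_form_Cinf, of "1/2" Sc] poisson_scale_left[OF Q_form_Cinf]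
    by (simp add: Q_def S_def Q_ham_def S_ham_def)
  have QS: "QS_condition n q Qhat S \<longleftrightarrow> poisson n q Q S = 0"
    using QS_condition_iff[OF hom S1] by (simp add: Q_def S_def Qhat_def q_def)
  have QQ: "poisson n q Q Q = 0"
    using poisson_Q_ham_self[OF hom] by (simp add: Q_def q_def)
  \<comment> \<open>The bracket is symmetric on odd functions, so the expansion is
    \<open>{Q, Q} + 2 {Q, S} + {S, S}\<close>.\<close>
  have "poisson n q (Q + S) (Q + S) = 0" if "poisson n q Q S = 0"
    using that poisson_antisym[OF Q S] QQ SS
      vfield_add[OF vQ Q(1) S(1)] vfield_add[OF vfield_poisson(1)[OF S] Q(1) S(1)]
    by (simp add: poisson_add_left[OF Q(1) S(1)])
  then show ?thesis
    using quarter QS homological_ham_field[OF Cinf_add[OF Q(1) S(1)] has_parity_add[OF Q(2) S(2)]]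
      g_bracket_of_field[OF hom S1] dual_bracket_of_schouten[OF hom S1] dbl_bracket_of_field[OF hom S1]
      dbl_bracket_double[OF hom S1]
    unfolding Q_def S_def Qhat_def q_def by blast
qed

end
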